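(* For every $\varepsilon>0$ and every fixed tree $T$, there exists $d_0>0$ such that the following holds. For any $p=p(n)$ with $\frac{d_0}{n}\le p\le 0.99$, with high probability the maximum number of vertices of an induced $T$-matching in $G(n,p)$ lies between $(2-\varepsilon)\log_q(np)$ and $(2+\varepsilon)\log_q(np)$, where $q=\frac{1}{1-p}$.
   Context: $G(n,p)$ is the binomial random graph on vertex set $[n]$ in which each pair is an edge independently with probability $p$. "With high probability" means with probability $1-o_n(1)$ as $n\to\infty$. For a graph $T$, a $T$-matching is a graph each of whose connected components is isomorphic to $T$; an induced $T$-matching in $G$ is a set of vertices of $G$ whose induced subgraph is a $T$-matching. *)

theory Defs
  imports "HOL-Probability.Probability" "HOL-Probability.Product_PMF"
begin

text \<open>Simple graphs are pairs of a vertex set and a set of two-element subsets of it.\<close>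

type_synonym 'a sgraph = "'a set \<times> 'a set set"

abbreviation verts :: "'a sgraph \<Rightarrow> 'a set" where "verts \<equiv> fst"

abbreviation edges :: "'a sgraph \<Rightarrow> 'a set set" where "edges \<equiv> snd"

definition vpairs :: "'a set \<Rightarrow> 'a set set" where
  "vpairs V = {e. e \<subseteq> V \<and> card e = 2}"

definition simple_graph :: "'a sgraph \<Rightarrow> bool" where
  "simple_graph G \<longleftrightarrow> edges G \<subseteq> vpairs (verts G)"

definition adj :: "'a sgraph \<Rightarrow> 'a \<Rightarrow> 'a \<Rightarrow> bool" where
  "adj G u v \<longleftrightarrow> {u, v} \<in> edges G"

definition induced :: "'a sgraph \<Rightarrow> 'a set \<Rightarrow> 'a sgraph" where
  "induced G S = (verts G \<inter> S, {e \<in> edges G. e \<subseteq> S})"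

definition graph_iso :: "'a sgraph \<Rightarrow> 'b sgraph \<Rightarrow> bool" where
  "graph_iso G H \<longleftrightarrow> (\<exists>f. bij_betw f (verts G) (verts H) \<and>
     (\<forall>u\<in>verts G. \<forall>v\<in>verts G. adj G u v \<longleftrightarrow> adj H (f u) (f v)))"

definition walk :: "'a sgraph \<Rightarrow> 'a list \<Rightarrow> bool" where
  "walk G xs \<longleftrightarrow> xs \<noteq> [] \<and> set xs \<subseteq> verts G \<and> successively (adj G) xs"

definition joined :: "'a sgraph \<Rightarrow> 'a \<Rightarrow> 'a \<Rightarrow> bool" where
  "joined G u v \<longleftrightarrow> (\<exists>xs. walk G xs \<and> hd xs = u \<and> last xs = v)"

definition components :: "'a sgraph \<Rightarrow> 'a sgraph set" where
  "components G = {induced G {v. joined G u v} | u. u \<in> verts G}"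

definition connected_graph :: "'a sgraph \<Rightarrow> bool" where
  "connected_graph G \<longleftrightarrow> verts G \<noteq> {} \<and> (\<forall>u\<in>verts G. \<forall>v\<in>verts G. joined G u v)"

definition graph_cycle :: "'a sgraph \<Rightarrow> 'a list \<Rightarrow> bool" where
  "graph_cycle G xs \<longleftrightarrow> walk G xs \<and> length xs \<ge> 3 \<and> distinct xs \<and> adj G (last xs) (hd xs)"

definition is_tree :: "'a sgraph \<Rightarrow> bool" where
  "is_tree G \<longleftrightarrow> simple_graph G \<and> finite (verts G) \<and> connected_graph G \<and> (\<nexists>xs. graph_cycle G xs)"

text \<open>The empty graph has no components, hence is a \<open>T\<close>-matching for every \<open>T\<close>.\<close>

definition matching :: "'b sgraph \<Rightarrow> 'a sgraph \<Rightarrow> bool" where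
  "matching T G \<longleftrightarrow> (\<forall>C\<in>components G. graph_iso C T)"

definition induced_matching :: "'b sgraph \<Rightarrow> 'a sgraph \<Rightarrow> 'a set \<Rightarrow> bool" where
  "induced_matching T G S \<longleftrightarrow> S \<subseteq> verts G \<and> matching T (induced G S)"

definition max_induced_matching :: "'b sgraph \<Rightarrow> 'a sgraph \<Rightarrow> nat" where
  "max_induced_matching T G = Max {card S | S. induced_matching T G S}"

definition gnp :: "nat \<Rightarrow> real \<Rightarrow> nat sgraph pmf" where
  "gnp n p = map_pmf (\<lambda>X. ({1..n}, {e \<in> vpairs {1..n}. X e}))
     (Pi_pmf (vpairs {1..n}) False (\<lambda>_. bernoulli_pmf p))"

end

(* With d = np, q = 1/(1-p) and t = |T|, fix an order of the vertices of T in which every vertex but the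
   first has exactly one earlier neighbour. A T-matching on k = mt vertices is then a rooted forest on
   {0..<k}, and an induced T-matching in G(n,p) is a list of k distinct vertices.

   Upper bound: every induced T-matching comes from at least m! lists, so the first moment, divided by m!,
   bounds the probability that one exists; for k > (2+eps) log_q d this is at most 2^(-m).

   Lower bound: for a fixed list xs, the ratio P(xs and ys) / (P(xs) P(ys)) is at most p^(-r) q^(l choose 2)
   when xs and ys share l vertices and r edges, and it is 0 if they conflict. The lists ys whose overlap with
   xs has index set U are counted by revealing ys entry by entry: an entry in U whose parent is also in U has
   at most t choices, any other entry in U at most k. Hence each element of U costs a factor of order
   (ln d)/d. Overlaps with l <= y are counted through their non-isolated part only, because single common
   vertices carry no factor 1/p; the remaining overlaps form a geometric series.
   This gives P(Y >= a) >= 1 - o(1) for d >= n^0.48. For smaller d it gives P(Y >= a) >= exp(-delta L^2/n)/2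
   with small delta and L = log_q d, and since changing the edges at one vertex changes the maximum Y by at
   most t, the bound P(Y >= a) P(Y <= b) <= exp(-(a-b)^2/(4nt^2)) turns it into a bound on P(Y <= b). *)

theory Submission
  imports Defs "HOL-Combinatorics.Permutations" "HOL-Real_Asymp.Real_Asymp"
begin

section \<open>Two-sided tails under bounded differences\<close>

text \<open>The sparse range is the obstacle. Counted in full, overlaps of size l contribute about
  (k choose l) alpha^l with alpha of order (ln d)/d, which puts a factor exp(alpha k) into the
  second-moment ratio. Here alpha k has the order of L^2/n, with a constant that the gain eps^2
  L^2/(64 t^2 n) from concentration cannot beat for small eps. Keeping only non-isolated common
  vertices replaces alpha k by a multiple of m alpha^2, smaller by a factor of order (ln d)/d, at
  the price of q^(y choose 2). For y = 2 theta L / sqrt d this price is exp(O(theta^2 L^2/n)) with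
  theta as small as desired, while the terms l > y stay geometric once d is large in terms of theta;
  this determines d_0. The threshold n^0.48 lies just below sqrt n: L^2/n must tend to infinity in
  the sparse range, and the ratio must tend to 1 in the dense one. In the upper bound, dividing by
  m! is essential: a T-matching on k vertices has only k - m edges, so the expected number of lists
  contains d^k p^(-m), and m! is what offsets p^(-m).\<close>

lemma finite_set_Pi_pmf_bool:
  fixes Q :: "'a \<Rightarrow> bool pmf"
  assumes "finite A"
  shows "finite (set_pmf (Pi_pmf A b Q))"
  using set_Pi_pmf_subset'[OF assms] finite_PiE_dflt[OF assms]
  by (metis finite_code finite_subset subset_UNIV)

lemma expectation_pair_pmf_finite:
  fixes F :: "'a \<times> 'b \<Rightarrow> real"
  assumes "finite (set_pmf M)" "finite (set_pmf N)"
  shows "measure_pmf.expectation (pair_pmf M N) F =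
    measure_pmf.expectation N (\<lambda>y. measure_pmf.expectation M (\<lambda>x. F (x, y)))"
proof -
  have "measure_pmf.expectation (pair_pmf M N) F =
      (\<Sum>z\<in>set_pmf M \<times> set_pmf N. F z * pmf (pair_pmf M N) z)"
    by (rule integral_measure_pmf_real) (use assms in auto)
  also have "\<dots> = (\<Sum>(x, y)\<in>set_pmf M \<times> set_pmf N. F (x, y) * (pmf M x * pmf N y))"
    by (intro sum.cong) (auto simp: pmf_pair)
  also have "\<dots> = (\<Sum>x\<in>set_pmf M. \<Sum>y\<in>set_pmf N. F (x, y) * (pmf M x * pmf N y))"
    by (simp add: sum.cartesian_product)
  also have "\<dots> = (\<Sum>y\<in>set_pmf N. (\<Sum>x\<in>set_pmf M. F (x, y) * pmf M x) * pmf N y)"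
    by (subst sum.swap) (simp add: sum_distrib_right mult.assoc)
  also have "\<dots> = (\<Sum>y\<in>set_pmf N. measure_pmf.expectation M (\<lambda>x. F (x, y)) * pmf N y)"
    by (intro sum.cong refl arg_cong2[where f = "(*)"] integral_measure_pmf_real[symmetric])
      (use assms in auto)
  also have "\<dots> = measure_pmf.expectation N (\<lambda>y. measure_pmf.expectation M (\<lambda>x. F (x, y)))"
    by (rule integral_measure_pmf_real[symmetric]) (use assms in auto)
  finally show ?thesis .
qed

text \<open>With u = |ln r| this is cosh u \<le> exp (u^2): quadratic bounds on both exponentials
  settle u \<le> 1, and u \<le> u^2 settles the rest.\<close>

lemma ratio_add_inverse_le:
  fixes r s :: real
  assumes "0 < r" "r \<le> exp s" "1 / r \<le> exp s"
  shows "r + 1 / r \<le> 2 * exp (s\<^sup>2)"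
proof -
  define u where "u = \<bar>ln r\<bar>"
  have "ln r \<le> s" using assms by (metis exp_gt_zero ln_exp ln_le_cancel_iff)
  moreover have "ln (1 / r) \<le> s" using assms by (metis exp_gt_zero ln_exp ln_le_cancel_iff zero_less_divide_1_iff)
  ultimately have us: "u \<le> s" "0 \<le> u" using assms by (auto simp: u_def ln_div)
  have "r + 1 / r = exp u + exp (- u)"
    using assms by (cases "ln r \<ge> 0") (auto simp: u_def exp_minus field_simps)
  also have "\<dots> \<le> 2 * exp (u\<^sup>2)"
  proof (cases "u \<le> 1")
    case True
    then have "exp u \<le> 1 + u + u\<^sup>2"
      using us exp_bound by blast
    moreover have "exp (- u) \<le> 1 - u + u\<^sup>2"
    proof -
      have "1 \<le> (1 - u + u\<^sup>2) * (1 + u)"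
        using us by (simp add: algebra_simps power2_eq_square)
      also have "\<dots> \<le> (1 - u + u\<^sup>2) * exp u"
        using True exp_ge_add_one_self[of u] by (intro mult_left_mono) auto
      finally show ?thesis by (simp add: exp_minus field_simps)
    qed
    ultimately show ?thesis using exp_ge_add_one_self[of "u\<^sup>2"] by linarith
  next
    case False
    then have "u \<le> u\<^sup>2" by (simp add: power2_eq_square)
    then have "exp u \<le> exp (u\<^sup>2)" "exp (- u) \<le> exp (u\<^sup>2)" using False by auto
    then show ?thesis by linarith
  qed
  also have "exp (u\<^sup>2) \<le> exp (s\<^sup>2)" using us by (auto intro: power_mono)
  finally show ?thesis by simp
qed

text \<open>Symmetrising the double sum over independent y and z pairs
  \<open>\<phi> y * \<psi> z\<close> with \<open>\<phi> z * \<psi> y\<close>. Since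
  \<open>\<psi>\<close> is at most \<open>K / \<phi>\<close>, such a pair is at most K (r + 1/r)
  with r = \<open>\<phi> y / \<phi> z\<close>, and the ratio hypothesis, used in both directions,
  gives |ln r| \<le> s.\<close>

lemma expectation_mult_expectation_le:
  fixes \<phi> \<psi> :: "'a \<Rightarrow> real"
  assumes fin: "finite (set_pmf N)"
    and pos: "\<And>y. 0 < \<phi> y" "\<And>y. 0 < \<psi> y"
    and K: "\<And>y. \<phi> y * \<psi> y \<le> K"
    and ratio: "\<And>y z. y \<in> set_pmf N \<Longrightarrow> z \<in> set_pmf N \<Longrightarrow> \<phi> y \<le> exp s * \<phi> z"
  shows "measure_pmf.expectation N \<phi> * measure_pmf.expectation N \<psi> \<le> K * exp (s\<^sup>2)"
proof -
  define A where "A = set_pmf N"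
  define w where "w = pmf N"
  have EN: "measure_pmf.expectation N h = (\<Sum>y\<in>A. h y * w y)" for h :: "'a \<Rightarrow> real"
    unfolding A_def w_def by (rule integral_measure_pmf_real) (use fin in auto)
  have K0: "0 \<le> K" using K pos by (meson less_eq_real_def mult_pos_pos order_trans)
  have prod: "measure_pmf.expectation N \<phi> * measure_pmf.expectation N \<psi> =
      (\<Sum>y\<in>A. \<Sum>z\<in>A. \<phi> y * \<psi> z * (w y * w z))"
    unfolding EN sum_product by (intro sum.cong refl) (simp add: mult_ac)
  have prod': "measure_pmf.expectation N \<phi> * measure_pmf.expectation N \<psi> =
      (\<Sum>y\<in>A. \<Sum>z\<in>A. \<phi> z * \<psi> y * (w y * w z))"
    unfolding prod by (subst sum.swap) (simp add: mult_ac)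
  have pt: "\<phi> y * \<psi> z + \<phi> z * \<psi> y \<le> 2 * K * exp (s\<^sup>2)" if "y \<in> A" "z \<in> A" for y z
  proof -
    define r where "r = \<phi> y / \<phi> z"
    have "\<psi> z \<le> K / \<phi> z" "\<psi> y \<le> K / \<phi> y"
      using K[of z] K[of y] pos(1)[of z] pos(1)[of y] by (auto simp: field_simps)
    then have "\<phi> y * \<psi> z + \<phi> z * \<psi> y \<le> \<phi> y * (K / \<phi> z) + \<phi> z * (K / \<phi> y)"
      using pos by (intro add_mono mult_left_mono) (auto simp: less_imp_le)
    also have "\<dots> = K * (r + 1 / r)" by (simp add: r_def algebra_simps)
    also have "\<dots> \<le> K * (2 * exp (s\<^sup>2))"
      using ratio[of y z] ratio[of z y] that pos(1)[of z] pos(1)[of y] K0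
      by (intro mult_left_mono ratio_add_inverse_le) (auto simp: r_def A_def field_simps)
    finally show ?thesis by simp
  qed
  have "2 * (measure_pmf.expectation N \<phi> * measure_pmf.expectation N \<psi>) =
     (\<Sum>y\<in>A. \<Sum>z\<in>A. (\<phi> y * \<psi> z + \<phi> z * \<psi> y) * (w y * w z))"
    using prod prod' by (simp add: distrib_right sum.distrib)
  also have "\<dots> \<le> (\<Sum>y\<in>A. \<Sum>z\<in>A. (2 * K * exp (s\<^sup>2)) * (w y * w z))"
    by (intro sum_mono mult_right_mono pt) (auto simp: w_def)
  also have "\<dots> = 2 * K * exp (s\<^sup>2) * (\<Sum>y\<in>A. w y) * (\<Sum>z\<in>A. w z)"
    by (simp add: sum_distrib_left sum_distrib_right mult_ac)
  also have "(\<Sum>y\<in>A. w y) = 1"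
    unfolding A_def w_def by (rule sum_pmf_eq_1) (use fin in auto)
  finally show ?thesis by simp
qed

text \<open>Bounding the product of the two exponential moments avoids centring \<open>Z\<close> at its mean.\<close>

lemma Pi_pmf_exp_moments_bounded_differences:
  fixes Z :: "('a \<Rightarrow> bool) \<Rightarrow> real" and B :: "nat \<Rightarrow> 'a set"
  assumes fin: "\<And>i. finite (B i)"
    and disj: "\<And>i j. i \<noteq> j \<Longrightarrow> B i \<inter> B j = {}"
    and s: "0 \<le> s"
    and lip: "\<And>i x y. i < n \<Longrightarrow> (\<And>e. e \<notin> B i \<Longrightarrow> x e = y e) \<Longrightarrow> \<bar>Z x - Z y\<bar> \<le> 1"
  shows "measure_pmf.expectation (Pi_pmf (\<Union>i<n. B i) False Q) (\<lambda>x. exp (s * Z x)) *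
         measure_pmf.expectation (Pi_pmf (\<Union>i<n. B i) False Q) (\<lambda>x. exp (- s * Z x)) \<le> exp (s\<^sup>2 * n)"
  using lip
proof (induction n arbitrary: Z)
  case 0
  then show ?case by (simp flip: exp_add)
next
  case (Suc n)
  define A where "A = (\<Union>i<n. B i)"
  define M where "M = Pi_pmf A False Q"
  define N where "N = Pi_pmf (B n) False Q"
  define mg where "mg = (\<lambda>(f :: 'a \<Rightarrow> bool, g) x. if x \<in> A then f x else g x)"
  have finA: "finite A" using fin by (auto simp: A_def)
  have "B i \<inter> B n = {}" if "i < n" for i using disj that by simp
  then have dAB: "A \<inter> B n = {}" unfolding A_def by blast
  have UN: "(\<Union>i<Suc n. B i) = A \<union> B n" by (auto simp: A_def lessThan_Suc)
  have Pi: "Pi_pmf (\<Union>i<Suc n. B i) False Q = map_pmf mg (pair_pmf M N)"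
    unfolding UN M_def N_def mg_def by (rule Pi_pmf_union) (use finA fin dAB in auto)
  have fM: "finite (set_pmf M)" and fN: "finite (set_pmf N)"
    unfolding M_def N_def using finite_set_Pi_pmf_bool finA fin by auto
  \<comment> \<open>Conditional exponential moments given the values g on the last block. Their
    product is bounded pointwise by the induction hypothesis for Z with that block frozen, and
    \<open>\<phi>\<close> varies by a factor of at most exp s because the block moves Z by at most
    1.\<close>
  define \<phi> where "\<phi> = (\<lambda>g. measure_pmf.expectation M (\<lambda>f. exp (s * Z (mg (f, g)))))"
  define \<psi> where "\<psi> = (\<lambda>g. measure_pmf.expectation M (\<lambda>f. exp (- s * Z (mg (f, g)))))"
  have int: "integrable (measure_pmf M) h" for h :: "('a \<Rightarrow> bool) \<Rightarrow> real"
    by (rule integrable_measure_pmf_finite) (rule fM)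
  have posE: "0 < measure_pmf.expectation M (\<lambda>f. exp (h f))" for h :: "('a \<Rightarrow> bool) \<Rightarrow> real"
  proof -
    obtain f0 where "f0 \<in> set_pmf M" using set_pmf_not_empty[of M] by blast
    then show ?thesis
      by (subst integral_measure_pmf_real[OF fM])
        (auto intro!: sum_pos2[OF fM \<open>f0 \<in> set_pmf M\<close>] simp: pmf_positive)
  qed
  have "measure_pmf.expectation N \<phi> * measure_pmf.expectation N \<psi> \<le> exp (s\<^sup>2 * n) * exp (s\<^sup>2)"
  proof (rule expectation_mult_expectation_le[OF fN])
    show "0 < \<phi> g" "0 < \<psi> g" for g by (auto simp: \<phi>_def \<psi>_def posE)
    show "\<phi> g * \<psi> g \<le> exp (s\<^sup>2 * n)" for g
      unfolding \<phi>_def \<psi>_def M_def A_def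
    proof (rule Suc.IH)
      fix i and x y :: "'a \<Rightarrow> bool"
      assume i: "i < n" and xy: "\<And>e. e \<notin> B i \<Longrightarrow> x e = y e"
      show "\<bar>Z (mg (x, g)) - Z (mg (y, g))\<bar> \<le> 1"
        by (rule Suc.prems[of i]) (use i xy in \<open>auto simp: mg_def\<close>)
    qed
    show "\<phi> g \<le> exp s * \<phi> h" if gh: "g \<in> set_pmf N" "h \<in> set_pmf N" for g h
    proof -
      have "\<phi> g \<le> measure_pmf.expectation M (\<lambda>f. exp s * exp (s * Z (mg (f, h))))"
        unfolding \<phi>_def
      proof (rule integral_mono[OF int int])
        fix f
        have "\<bar>Z (mg (f, g)) - Z (mg (f, h))\<bar> \<le> 1"
        proof (rule Suc.prems[of n])
          fix e assume "e \<notin> B n"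
          \<comment> \<open>Outside \<open>B n\<close> both functions take the default value of
            \<open>Pi_pmf\<close>, so the merged configurations differ only on the last
            block.\<close>
          then have "g e = False" "h e = False"
            using gh set_Pi_pmf_subset[OF fin[of n], of False Q] by (auto simp: N_def)
          then show "mg (f, g) e = mg (f, h) e" by (simp add: mg_def)
        qed simp
        then have "s * Z (mg (f, g)) \<le> s * (1 + Z (mg (f, h)))"
          using s by (intro mult_left_mono) auto
        then show "exp (s * Z (mg (f, g))) \<le> exp s * exp (s * Z (mg (f, h)))"
          by (simp add: algebra_simps flip: exp_add)
      qed
      then show ?thesis by (simp add: \<phi>_def)
    qed
  qed
  then show ?case
    unfolding Pi by (simp add: expectation_pair_pmf_finite[OF fM fN] \<phi>_def \<psi>_def algebra_simps flip: exp_add)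
qed
lemma exp_Markov_pmf:
  fixes Z :: "'a \<Rightarrow> real"
  assumes "finite (set_pmf M)"
  shows "measure_pmf.prob M {x. a \<le> Z x} * exp a \<le> measure_pmf.expectation M (\<lambda>x. exp (Z x))"
proof -
  have int: "integrable (measure_pmf M) h" for h :: "'a \<Rightarrow> real"
    by (rule integrable_measure_pmf_finite) (rule assms)
  have "measure_pmf.prob M {x. a \<le> Z x} * exp a
      = measure_pmf.expectation M (\<lambda>x. indicator {x. a \<le> Z x} x * exp a)"
    by simp
  also have "\<dots> \<le> measure_pmf.expectation M (\<lambda>x. exp (Z x))"
    by (intro integral_mono int) (auto simp: indicator_def)
  finally show ?thesis .
qed

text \<open>Multiplying the exponential Markov bounds for the two tails brings in the two
  exponential moments as a product. A lower bound for one tail thereby becomes an upper bound for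
  the other.\<close>

lemma Pi_pmf_two_tails_bounded_differences:
  fixes Z :: "('a \<Rightarrow> bool) \<Rightarrow> real" and B :: "nat \<Rightarrow> 'a set"
    and Q :: "'a \<Rightarrow> bool pmf"
  assumes fin: "\<And>i. finite (B i)"
    and disj: "\<And>i j. i \<noteq> j \<Longrightarrow> B i \<inter> B j = {}"
    and lip: "\<And>i x y. i < n \<Longrightarrow> (\<And>e. e \<notin> B i \<Longrightarrow> x e = y e) \<Longrightarrow> \<bar>Z x - Z y\<bar> \<le> 1"
    and n: "0 < n" and ba: "b \<le> a"
  defines "M \<equiv> Pi_pmf (\<Union>i<n. B i) False Q"
  shows "measure_pmf.prob M {x. a \<le> Z x} * measure_pmf.prob M {x. Z x \<le> b} \<le> exp (- (a - b)\<^sup>2 / (4 * n))"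
proof -
  \<comment> \<open>The minimiser of the resulting exponent
    \<open>s\<^sup>2 * n - s * (a - b)\<close>.\<close>
  define s where "s = (a - b) / (2 * n)"
  have s: "0 \<le> s" using ba by (simp add: s_def)
  have finU: "finite (\<Union>i<n. B i)" using fin by auto
  have fM: "finite (set_pmf M)"
    unfolding M_def by (rule finite_set_Pi_pmf_bool[OF finU])
  have 1: "measure_pmf.prob M {x. a \<le> Z x} * exp (s * a) \<le> measure_pmf.expectation M (\<lambda>x. exp (s * Z x))"
    using exp_Markov_pmf[OF fM, of "s * a" "\<lambda>x. s * Z x"]
      measure_pmf.finite_measure_mono[of "{x. a \<le> Z x}" "{x. s * a \<le> s * Z x}" M]
      mult_left_mono[OF _ s, of a]
    by (smt (verit) Collect_mono UNIV_I exp_ge_zero mult_right_mono sets_measure_pmf)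
  have 2: "measure_pmf.prob M {x. Z x \<le> b} * exp (- s * b) \<le> measure_pmf.expectation M (\<lambda>x. exp (- s * Z x))"
    using exp_Markov_pmf[OF fM, of "- s * b" "\<lambda>x. - s * Z x"]
      measure_pmf.finite_measure_mono[of "{x. Z x \<le> b}" "{x. - s * b \<le> - s * Z x}" M]
      mult_left_mono[OF _ s, of _ b]
    by (smt (verit) Collect_mono UNIV_I exp_ge_zero mult_right_mono sets_measure_pmf mult_minus_left)
  have "(measure_pmf.prob M {x. a \<le> Z x} * exp (s * a)) * (measure_pmf.prob M {x. Z x \<le> b} * exp (- s * b))
      \<le> exp (s\<^sup>2 * n)"
    by (rule order_trans[OF mult_mono[OF 1 2]])
      (use Pi_pmf_exp_moments_bounded_differences[where Z = Z and n = n, OF fin disj s lip] in \<open>auto simp: M_def\<close>)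
  moreover have "exp (s * (a - b)) = exp (s * a) * exp (- s * b)"
    by (simp add: algebra_simps flip: exp_add)
  ultimately have "measure_pmf.prob M {x. a \<le> Z x} * measure_pmf.prob M {x. Z x \<le> b} * exp (s * (a - b))
      \<le> exp (s\<^sup>2 * n)"
    by (simp only: mult_ac)
  then have "measure_pmf.prob M {x. a \<le> Z x} * measure_pmf.prob M {x. Z x \<le> b}
      \<le> exp (s\<^sup>2 * n - s * (a - b))"
    by (simp add: exp_diff exp_add field_simps)
  also have "s\<^sup>2 * n - s * (a - b) = - (a - b)\<^sup>2 / (4 * n)"
    using n by (simp add: s_def field_simps power2_eq_square)
  finally show ?thesis .
qed

section \<open>Embeddings of rooted forests and the second moment\<close>

abbreviation edge_pmf :: "'a set \<Rightarrow> real \<Rightarrow> ('a set \<Rightarrow> bool) pmf" where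
  "edge_pmf V p \<equiv> Pi_pmf (vpairs V) False (\<lambda>_. bernoulli_pmf p)"

definition tuples :: "'a set \<Rightarrow> nat \<Rightarrow> 'a list set" where
  "tuples V k = {xs. length xs = k \<and> distinct xs \<and> set xs \<subseteq> V}"

text \<open>A rooted forest on \<open>{0..<k}\<close> is given by a parent function \<open>P\<close>, where \<open>P j = j\<close> marks a root;
  a list of \<open>k\<close> distinct vertices then represents a copy of the forest.\<close>

definition fedges :: "(nat \<Rightarrow> nat) \<Rightarrow> 'a list \<Rightarrow> 'a set set" where
  "fedges P xs = (\<lambda>j. {xs ! P j, xs ! j}) ` {j. j < length xs \<and> P j < j}"

definition emb :: "(nat \<Rightarrow> nat) \<Rightarrow> ('a set \<Rightarrow> bool) \<Rightarrow> 'a list \<Rightarrow> bool" where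
  "emb P X xs \<longleftrightarrow> (\<forall>e\<in>vpairs (set xs). X e \<longleftrightarrow> e \<in> fedges P xs)"

section \<open>Pairs, tuples and the probability of one embedding\<close>

lemma finite_vpairs [simp]: "finite V \<Longrightarrow> finite (vpairs V)"
  by (rule finite_subset[of _ "Pow V"]) (auto simp: vpairs_def)

lemma card_vpairs: "finite V \<Longrightarrow> card (vpairs V) = card V choose 2"
  by (simp add: vpairs_def n_subsets)

lemma vpairs_mono: "S \<subseteq> V \<Longrightarrow> vpairs S \<subseteq> vpairs V"
  by (auto simp: vpairs_def)

lemma vpairs_Int: "vpairs S \<inter> vpairs V = vpairs (S \<inter> V)"
  by (auto simp: vpairs_def)

lemma finite_tuples [simp]: "finite V \<Longrightarrow> finite (tuples V k)"
  by (rule finite_subset[OF _ finite_lists_length_eq[of V k]]) (auto simp: tuples_def)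

lemma card_tuples:
  assumes "finite V" "k \<le> card V"
  shows "card (tuples V k) = (\<Prod>j<k. card V - j)"
proof -
  have "\<Prod>{card V - k + 1..card V} = (\<Prod>j<k. card V - j)"
    by (rule prod.reindex_bij_witness[of _ "\<lambda>j. card V - j" "\<lambda>j. card V - j"])
      (use assms in auto)
  then show ?thesis
    using card_lists_distinct_length_eq[OF assms] by (simp add: tuples_def)
qed

lemma nth_pair_eq_iff:
  assumes "distinct xs" "i < j" "j < length xs" "i' < j'" "j' < length xs"
  shows "{xs ! i, xs ! j} = {xs ! i', xs ! j'} \<longleftrightarrow> i = i' \<and> j = j'"
  using assms by (auto simp: doubleton_eq_iff nth_eq_iff_index_eq)

lemma nth_pair_in_fedges_iff:
  assumes "distinct xs" "i < j" "j < length xs"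
  shows "{xs ! i, xs ! j} \<in> fedges P xs \<longleftrightarrow> P j = i"
proof
  assume "{xs ! i, xs ! j} \<in> fedges P xs"
  then obtain j' where "j' < length xs" "P j' < j'" "{xs ! i, xs ! j} = {xs ! P j', xs ! j'}"
    by (auto simp: fedges_def)
  then show "P j = i" using nth_pair_eq_iff[OF assms] by metis
qed (use assms in \<open>auto simp: fedges_def\<close>)

lemma vpairs_set_conv:
  assumes "distinct xs"
  shows "vpairs (set xs) = {{xs ! i, xs ! j} | i j. i < j \<and> j < length xs}"
proof (intro set_eqI iffI)
  fix e assume "e \<in> vpairs (set xs)"
  then obtain u v where uv: "e = {u, v}" "u \<noteq> v" "u \<in> set xs" "v \<in> set xs"
    by (auto simp: vpairs_def card_2_iff)
  then obtain i j where ij: "u = xs ! i" "v = xs ! j" "i < length xs" "j < length xs"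
    by (auto simp: in_set_conv_nth)
  with uv have "i < j \<or> j < i" by (metis linorder_neqE_nat)
  then show "e \<in> {{xs ! i, xs ! j} | i j. i < j \<and> j < length xs}"
    using uv ij by (auto simp: insert_commute)
next
  fix e assume "e \<in> {{xs ! i, xs ! j} | i j. i < j \<and> j < length xs}"
  then obtain i j where "e = {xs ! i, xs ! j}" "i < j" "j < length xs" by blast
  then show "e \<in> vpairs (set xs)"
    using assms by (simp add: vpairs_def nth_eq_iff_index_eq)
qed

lemma emb_iff:
  assumes "distinct xs"
  shows "emb P X xs \<longleftrightarrow> (\<forall>j<length xs. \<forall>i<j. X {xs ! i, xs ! j} \<longleftrightarrow> P j = i)"
proof -
  have "emb P X xs \<longleftrightarrow> (\<forall>j<length xs. \<forall>i<j. X {xs ! i, xs ! j} \<longleftrightarrow> {xs ! i, xs ! j} \<in> fedges P xs)"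
    unfolding emb_def vpairs_set_conv[OF assms] by blast
  then show ?thesis using nth_pair_in_fedges_iff[OF assms] by blast
qed

lemma fedges_subset: "distinct xs \<Longrightarrow> fedges P xs \<subseteq> vpairs (set xs)"
  by (auto simp: vpairs_set_conv fedges_def)

lemma inj_on_fedges: "distinct xs \<Longrightarrow> inj_on (\<lambda>j. {xs ! P j, xs ! j}) {j. j < length xs \<and> P j < j}"
  by (rule inj_onI) (use nth_pair_eq_iff in blast)

lemma card_fedges: "distinct xs \<Longrightarrow> card (fedges P xs) = card {j. j < length xs \<and> P j < j}"
  unfolding fedges_def by (rule card_image[OF inj_on_fedges])

lemma prob_edge_pattern:
  assumes "finite V" "D \<subseteq> vpairs V" "0 \<le> p" "p \<le> 1"
  shows "measure_pmf.prob (edge_pmf V p) {X. \<forall>e\<in>D. X e \<longleftrightarrow> e \<in> A} = (\<Prod>e\<in>D. if e \<in> A then p else 1 - p)"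
proof -
  define B where "B = (\<lambda>e. if e \<in> D then {e \<in> A} else UNIV)"
  have "{X. \<forall>e\<in>D. X e \<longleftrightarrow> e \<in> A} = Pi (vpairs V) B"
    using assms(2) by (auto simp: B_def Pi_def split: if_splits)
  then have "measure_pmf.prob (edge_pmf V p) {X. \<forall>e\<in>D. X e \<longleftrightarrow> e \<in> A} =
      (\<Prod>e\<in>vpairs V. measure_pmf.prob (bernoulli_pmf p) (B e))"
    by (simp add: measure_Pi_pmf_Pi assms(1))
  also have "\<dots> = (\<Prod>e\<in>D. measure_pmf.prob (bernoulli_pmf p) (B e))"
    by (rule prod.mono_neutral_right) (use assms in \<open>auto simp: B_def\<close>)
  also have "\<dots> = (\<Prod>e\<in>D. if e \<in> A then p else 1 - p)"
    using assms(3,4) by (intro prod.cong refl) (auto simp: B_def measure_pmf_single)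
  finally show ?thesis .
qed

definition emb_prob :: "(nat \<Rightarrow> nat) \<Rightarrow> nat \<Rightarrow> real \<Rightarrow> real" where
  "emb_prob P k p = p ^ card {j. j < k \<and> P j < j} * (1 - p) ^ ((k choose 2) - card {j. j < k \<and> P j < j})"

lemma prod_pattern_emb:
  fixes p :: real
  assumes "distinct xs"
  shows "(\<Prod>e\<in>vpairs (set xs). if e \<in> fedges P xs then p else 1 - p) = emb_prob P (length xs) p"
proof -
  have fin: "finite (vpairs (set xs))" by simp
  have sub: "fedges P xs \<subseteq> vpairs (set xs)" by (rule fedges_subset[OF assms])
  have "(\<Prod>e\<in>vpairs (set xs). if e \<in> fedges P xs then p else 1 - p) =
      p ^ card (vpairs (set xs) \<inter> fedges P xs) * (1 - p) ^ card (vpairs (set xs) - fedges P xs)"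
    by (simp add: prod.If_cases[OF fin] Diff_eq)
  also have "vpairs (set xs) \<inter> fedges P xs = fedges P xs" using sub by auto
  also have "card (vpairs (set xs) - fedges P xs) = card (vpairs (set xs)) - card (fedges P xs)"
    using sub fin by (meson card_Diff_subset finite_subset)
  finally show ?thesis
    using assms by (simp add: card_fedges card_vpairs distinct_card emb_prob_def)
qed

lemma prob_emb:
  assumes "finite V" "xs \<in> tuples V k" "0 \<le> p" "p \<le> 1"
  shows "measure_pmf.prob (edge_pmf V p) {X. emb P X xs} = emb_prob P k p"
  using prob_edge_pattern[OF assms(1) vpairs_mono assms(3,4), of "set xs" "fedges P xs"]
    prod_pattern_emb[of xs] assms(2) by (auto simp: emb_def tuples_def)

text \<open>Both events together force the pattern \<open>A \<union> A'\<close> on all pairs inside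
  xs or inside ys, so the weight of this pattern bounds the joint probability. It is the product of
  the two single weights divided by the weight of the pairs counted twice. Consistency is asked in
  one direction: if instead an edge of xs is a non-edge of ys, the joint event is empty and the
  bound still holds.\<close>

lemma prob_two_embs_le:
  fixes xs ys :: "'a list"
  assumes V: "finite V" and xs: "xs \<in> tuples V k" and ys: "ys \<in> tuples V k" and p: "0 < p" "p < 1"
    and cons: "fedges P ys \<inter> vpairs (set xs) \<subseteq> fedges P xs"
  shows "measure_pmf.prob (edge_pmf V p) {X. emb P X xs \<and> emb P X ys} \<le>
    (emb_prob P k p)\<^sup>2 * (1 / p) ^ card (fedges P ys \<inter> vpairs (set xs)) *
      (1 / (1 - p)) ^ (card (set xs \<inter> set ys) choose 2)"
proof -
  define D where "D = vpairs (set xs)"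
  define D' where "D' = vpairs (set ys)"
  define A where "A = fedges P xs"
  define A' where "A' = fedges P ys"
  define w where "w = (\<lambda>A (e :: 'a set). if e \<in> A then p else 1 - p :: real)"
  have dist: "distinct xs" "distinct ys" and len: "length xs = k" "length ys = k"
    using xs ys by (auto simp: tuples_def)
  have sub: "A \<subseteq> D" "A' \<subseteq> D'"
    unfolding A_def A'_def D_def D'_def using fedges_subset dist by blast+
  have fin: "finite D" "finite D'" by (auto simp: D_def D'_def)
  have DV: "D \<union> D' \<subseteq> vpairs V"
    using xs ys by (simp add: tuples_def D_def D'_def vpairs_mono)
  have pos: "0 < w S e" for S e using p by (auto simp: w_def)
  have I: "(\<Prod>e\<in>D. w A e) = emb_prob P k p" "(\<Prod>e\<in>D'. w A' e) = emb_prob P k p"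
    using prod_pattern_emb[OF dist(1)] prod_pattern_emb[OF dist(2)]
    by (auto simp: w_def D_def D'_def A_def A'_def len)
  have "measure_pmf.prob (edge_pmf V p) {X. emb P X xs \<and> emb P X ys} \<le>
      measure_pmf.prob (edge_pmf V p) {X. \<forall>e\<in>D \<union> D'. X e \<longleftrightarrow> e \<in> A \<union> A'}"
  proof (rule measure_pmf.finite_measure_mono)
    have "X e = (e \<in> A \<union> A')" if "\<forall>e\<in>D. X e = (e \<in> A)" "\<forall>e\<in>D'. X e = (e \<in> A')" "e \<in> D \<union> D'" for X e
      using that sub by blast
    then show "{X. emb P X xs \<and> emb P X ys} \<subseteq> {X. \<forall>e\<in>D \<union> D'. X e \<longleftrightarrow> e \<in> A \<union> A'}"
      by (auto simp: emb_def D_def D'_def A_def A'_def)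
  qed simp
  also have "\<dots> = (\<Prod>e\<in>D \<union> D'. w (A \<union> A') e)"
    unfolding w_def by (rule prob_edge_pattern) (use V DV p in auto)
  also have "\<dots> = (\<Prod>e\<in>D. w (A \<union> A') e) * (\<Prod>e\<in>D' - D. w (A \<union> A') e)"
    using fin by (subst prod.union_disjoint[symmetric]) (auto simp: Un_Diff_cancel)
  also have "(\<Prod>e\<in>D. w (A \<union> A') e) = (\<Prod>e\<in>D. w A e)"
    using cons by (intro prod.cong refl) (auto simp: w_def D_def A_def A'_def)
  also have "(\<Prod>e\<in>D' - D. w (A \<union> A') e) = (\<Prod>e\<in>D' - D. w A' e)"
    using sub by (intro prod.cong refl) (auto simp: w_def)
  also have "(\<Prod>e\<in>D' - D. w A' e) = emb_prob P k p / (\<Prod>e\<in>D' \<inter> D. w A' e)"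
  proof -
    have "(\<Prod>e\<in>D'. w A' e) = (\<Prod>e\<in>D' \<inter> D. w A' e) * (\<Prod>e\<in>D' - D. w A' e)"
      using prod.Int_Diff[OF fin(2)] .
    moreover have "(\<Prod>e\<in>D' \<inter> D. w A' e) > 0" by (intro prod_pos) (use pos in auto)
    ultimately show ?thesis using I by (simp add: field_simps)
  qed
  also have "(\<Prod>e\<in>D. w A e) * (emb_prob P k p / (\<Prod>e\<in>D' \<inter> D. w A' e)) =
     (emb_prob P k p)\<^sup>2 * (1 / (\<Prod>e\<in>D' \<inter> D. w A' e))"
    by (simp add: I power2_eq_square)
  \<comment> \<open>Common pairs that are edges of ys cost exactly 1/p each. The others cost 1/(1-p)
    each, and their number is bounded by that of all common pairs.\<close>
  also have "\<dots> \<le> (emb_prob P k p)\<^sup>2 * (1 / (p ^ card (A' \<inter> D) * (1 - p) ^ card (D \<inter> D')))"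
  proof (intro mult_left_mono divide_left_mono)
    have "(\<Prod>e\<in>D' \<inter> D. w A' e) = p ^ card (D' \<inter> D \<inter> A') * (1 - p) ^ card (D' \<inter> D - A')"
      unfolding w_def using fin by (subst prod.If_cases) (auto simp: Diff_eq)
    moreover have "D' \<inter> D \<inter> A' = A' \<inter> D" using sub by auto
    moreover have "card (D' \<inter> D - A') \<le> card (D \<inter> D')" using fin by (intro card_mono) auto
    ultimately show "p ^ card (A' \<inter> D) * (1 - p) ^ card (D \<inter> D') \<le> (\<Prod>e\<in>D' \<inter> D. w A' e)"
      using p by (auto intro!: mult_left_mono power_decreasing)
    show "0 < (\<Prod>e\<in>D' \<inter> D. w A' e) * (p ^ card (A' \<inter> D) * (1 - p) ^ card (D \<inter> D'))"
      using p pos by (intro mult_pos_pos prod_pos) auto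
  qed (use p in auto)
  also have "card (D \<inter> D') = card (set xs \<inter> set ys) choose 2"
    by (simp add: D_def D'_def vpairs_Int card_vpairs)
  finally show ?thesis by (simp add: A'_def D_def power_one_over divide_simps)
qed

text \<open>A division-free proof of P(N > 0) \<ge> (E N)^2 / E(N^2): expand E (N - c 1_W)^2 \<ge>
  0, where N 1_W = N because W is the event N > 0.\<close>

lemma second_moment_Un:
  fixes M :: "'a pmf" and A :: "'b \<Rightarrow> 'a set"
  assumes "finite (set_pmf M)" "finite I" "I \<noteq> {}" "0 < \<mu>" "0 < R"
    and "\<And>i. i \<in> I \<Longrightarrow> measure_pmf.prob M (A i) = \<mu>"
    and "\<And>i. i \<in> I \<Longrightarrow> (\<Sum>j\<in>I. measure_pmf.prob M (A i \<inter> A j)) \<le> \<mu>\<^sup>2 * card I * R"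
  shows "1 / R \<le> measure_pmf.prob M (\<Union>i\<in>I. A i)"
proof -
  define N where "N = (\<lambda>x. \<Sum>i\<in>I. indicator (A i) x :: real)"
  define W where "W = (\<Union>i\<in>I. A i)"
  define m where "m = card I * \<mu>"
  have m: "0 < m" using assms by (simp add: m_def card_gt_0_iff)
  have int: "integrable (measure_pmf M) h" for h :: "'a \<Rightarrow> real"
    by (rule integrable_measure_pmf_finite) (rule assms)
  have E1: "measure_pmf.expectation M N = m"
    unfolding N_def m_def by (subst Bochner_Integration.integral_sum[OF int]) (simp add: assms(6))
  have "measure_pmf.expectation M (\<lambda>x. (N x)\<^sup>2) =
      measure_pmf.expectation M (\<lambda>x. \<Sum>i\<in>I. \<Sum>j\<in>I. indicator (A i \<inter> A j) x)"
    by (simp add: N_def power2_eq_square sum_product indicator_inter_arith)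
  also have "\<dots> = (\<Sum>i\<in>I. \<Sum>j\<in>I. measure_pmf.prob M (A i \<inter> A j))"
    by (subst Bochner_Integration.integral_sum[OF int], intro sum.cong refl,
        subst Bochner_Integration.integral_sum[OF int]) simp
  also have "\<dots> \<le> (\<Sum>i\<in>I. \<mu>\<^sup>2 * card I * R)" by (intro sum_mono assms(7))
  also have "\<dots> = m\<^sup>2 * R" by (simp add: m_def power2_eq_square)
  finally have E2: "measure_pmf.expectation M (\<lambda>x. (N x)\<^sup>2) \<le> m\<^sup>2 * R" .
  \<comment> \<open>An upper bound for E(N^2) / E N; with this c the expanded square becomes m^2 R
    (R P(W) - 1) \<ge> 0.\<close>
  define c where "c = m * R"
  have NW: "N x * indicator W x = N x" for x
    by (auto simp: N_def W_def indicator_def intro!: sum.neutral)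
  have "0 \<le> measure_pmf.expectation M (\<lambda>x. (N x - c * indicator W x)\<^sup>2)"
    by simp
  also have "\<dots> = measure_pmf.expectation M (\<lambda>x. (N x)\<^sup>2 - 2 * c * N x + c\<^sup>2 * indicator W x)"
  proof (intro Bochner_Integration.integral_cong refl)
    fix x
    have "(N x - c * indicator W x)\<^sup>2 = (N x)\<^sup>2 - 2 * c * (N x * indicator W x) + c\<^sup>2 * (indicator W x * indicator W x)"
      by (simp add: power2_eq_square algebra_simps)
    then show "(N x - c * indicator W x)\<^sup>2 = (N x)\<^sup>2 - 2 * c * N x + c\<^sup>2 * indicator W x"
      unfolding NW by (simp add: indicator_def)
  qed
  also have "\<dots> = measure_pmf.expectation M (\<lambda>x. (N x)\<^sup>2) - 2 * c * m + c\<^sup>2 * measure_pmf.prob M W"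
    by (simp add: int E1)
  also have "\<dots> \<le> m\<^sup>2 * R - 2 * c * m + c\<^sup>2 * measure_pmf.prob M W" using E2 by simp
  finally have "m\<^sup>2 * R \<le> m\<^sup>2 * R * (R * measure_pmf.prob M W)"
    by (simp add: c_def power2_eq_square algebra_simps)
  then have "1 \<le> R * measure_pmf.prob M W"
    using m assms(5) by (simp add: mult_le_cancel_left1)
  then show ?thesis using assms(5) by (simp add: W_def field_simps)
qed

text \<open>Conditions on a prefix of length j, so that lists can be counted by revealing one entry
  after another. The set U is only required to lie inside the overlap with xs, hence a list
  compatible with a set is compatible with every subset of it.\<close>

definition compat :: "(nat \<Rightarrow> nat) \<Rightarrow> 'a set \<Rightarrow> 'a list \<Rightarrow> nat set \<Rightarrow> nat \<Rightarrow> 'a list set" where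
  "compat P V xs U j = {ys \<in> tuples V j. \<forall>i<j. i \<in> U \<longrightarrow> ys ! i \<in> set xs \<and>
     (P i < i \<and> P i \<in> U \<longrightarrow> {ys ! P i, ys ! i} \<in> fedges P xs)}"

text \<open>A vertex has at most one parent besides its fewer than \<Delta> children.\<close>

lemma card_fedges_neighbours_le:
  assumes "distinct xs" "\<And>i. card {j. j < length xs \<and> i < j \<and> P j = i} < \<Delta>"
  shows "card {v. {u, v} \<in> fedges P xs} \<le> \<Delta>"
proof (cases "u \<in> set xs")
  case True
  then obtain i where i: "u = xs ! i" "i < length xs" by (auto simp: in_set_conv_nth)
  define J where "J = {j. j < length xs \<and> i < j \<and> P j = i}"
  have "{v. {u, v} \<in> fedges P xs} \<subseteq> insert (xs ! P i) ((!) xs ` J)"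
  proof
    fix v assume "v \<in> {v. {u, v} \<in> fedges P xs}"
    then obtain j where j: "j < length xs" "P j < j" "{u, v} = {xs ! P j, xs ! j}"
      by (auto simp: fedges_def)
    then consider "u = xs ! P j" "v = xs ! j" | "u = xs ! j" "v = xs ! P j"
      by (auto simp: doubleton_eq_iff)
    then show "v \<in> insert (xs ! P i) ((!) xs ` J)"
    proof cases
      case 1
      then have "P j = i" using i j assms(1) by (simp add: nth_eq_iff_index_eq)
      then show ?thesis using 1 j by (auto simp: J_def)
    next
      case 2
      then have "j = i" using i j assms(1) by (simp add: nth_eq_iff_index_eq)
      then show ?thesis using 2 by simp
    qed
  qed
  then have "card {v. {u, v} \<in> fedges P xs} \<le> card (insert (xs ! P i) ((!) xs ` J))"
    by (rule card_mono[rotated]) (auto simp: J_def)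
  also have "\<dots> \<le> Suc (card J)"
    by (simp add: card_insert_if le_SucI card_image_le J_def)
  also have "\<dots> \<le> \<Delta>" using assms(2)[of i] by (simp add: J_def)
  finally show ?thesis .
next
  case False
  then have "{v. {u, v} \<in> fedges P xs} = {}"
    using fedges_subset[OF assms(1)] by (fastforce simp: vpairs_def)
  then show ?thesis by simp
qed

lemma card_compat_Suc_le:
  assumes V: "finite V" and xs: "xs \<in> tuples V k"
    and deg: "\<And>i. card {j. j < k \<and> i < j \<and> P j = i} < \<Delta>"
  shows "card (compat P V xs U (Suc j)) \<le> card (compat P V xs U j) *
    (if j \<notin> U then card V - j else if P j < j \<and> P j \<in> U then \<Delta> else k)"
    (is "_ \<le> _ * ?b")
proof -
  have xs': "distinct xs" "length xs = k" using xs by (auto simp: tuples_def)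
  \<comment> \<open>The values still open for entry j. A parent precedes its child, so the entry at
    the parent index is already known and restricts entry j to its neighbours in the copy on
    xs.\<close>
  define C where "C = (\<lambda>ys. if j \<notin> U then V - set ys else
    if P j < j \<and> P j \<in> U then {v. {ys ! P j, v} \<in> fedges P xs} else set xs)"
  have fe: "finite {v. {u, v} \<in> fedges P xs}" for u
    by (rule finite_subset[of _ "set xs"]) (use fedges_subset[OF xs'(1)] in \<open>force simp: vpairs_def\<close>, simp)
  have C: "card (C ys) \<le> ?b" "finite (C ys)" if "ys \<in> compat P V xs U j" for ys
  proof -
    have "distinct ys" "length ys = j" "set ys \<subseteq> V" using that by (auto simp: compat_def tuples_def)
    then have "card (V - set ys) = card V - j" using V by (simp add: card_Diff_subset distinct_card)
    then show "card (C ys) \<le> ?b"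
      using card_fedges_neighbours_le[of xs P \<Delta> "ys ! P j"] deg xs' by (auto simp: C_def distinct_card)
    show "finite (C ys)" using V fe by (auto simp: C_def)
  qed
  have fin: "finite (compat P V xs U j)" using V by (simp add: compat_def)
  have "compat P V xs U (Suc j) \<subseteq> (\<Union>ys\<in>compat P V xs U j. (\<lambda>v. ys @ [v]) ` C ys)"
  proof
    fix zs assume zs: "zs \<in> compat P V xs U (Suc j)"
    then have "length zs = Suc j" by (auto simp: compat_def tuples_def)
    then obtain ys v where z: "zs = ys @ [v]" "length ys = j" by (metis length_Suc_conv_rev)
    have Z: "i \<in> U \<Longrightarrow> zs ! i \<in> set xs" "i \<in> U \<Longrightarrow> P i < i \<Longrightarrow> P i \<in> U \<Longrightarrow> {zs ! P i, zs ! i} \<in> fedges P xs"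
      if "i < Suc j" for i using zs that by (auto simp: compat_def)
    have "ys \<in> compat P V xs U j"
      unfolding compat_def
    proof (intro CollectI conjI allI impI)
      show "ys \<in> tuples V j" using zs z by (auto simp: compat_def tuples_def)
      fix i assume i: "i < j" "i \<in> U"
      then show "ys ! i \<in> set xs" using Z(1)[of i] z by (simp add: nth_append)
      assume "P i < i \<and> P i \<in> U"
      then show "{ys ! P i, ys ! i} \<in> fedges P xs" using Z(2)[of i] z i by (simp add: nth_append)
    qed
    moreover have "v \<in> C ys"
      using zs Z[of j] z by (auto simp: C_def compat_def tuples_def nth_append)
    ultimately show "zs \<in> (\<Union>ys\<in>compat P V xs U j. (\<lambda>v. ys @ [v]) ` C ys)" using z by auto
  qed
  then have "card (compat P V xs U (Suc j)) \<le> card (\<Union>ys\<in>compat P V xs U j. (\<lambda>v. ys @ [v]) ` C ys)"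
    by (rule card_mono[rotated]) (use fin C in auto)
  also have "\<dots> \<le> (\<Sum>ys\<in>compat P V xs U j. card ((\<lambda>v. ys @ [v]) ` C ys))"
    by (rule card_UN_le[OF fin])
  also have "\<dots> \<le> (\<Sum>ys\<in>compat P V xs U j. ?b)"
    by (intro sum_mono order_trans[OF card_image_le]) (use C in auto)
  finally show ?thesis by simp
qed

text \<open>For U the set of indices at which ys meets xs, this counts the edges of the copy on ys
  that lie inside xs: the exponent of 1/p in the joint probability.\<close>

definition inner_edges :: "(nat \<Rightarrow> nat) \<Rightarrow> nat \<Rightarrow> nat set \<Rightarrow> nat" where
  "inner_edges P k U = card {j. j < k \<and> j \<in> U \<and> P j < j \<and> P j \<in> U}"

text \<open>An index in U exchanges a factor \<open>card V - j\<close>, which is at least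
  \<open>card V / 2\<close>, for k, or for \<Delta> together with the 1/p of the edge to its parent.
  The two hypotheses on \<alpha>, with their factors 2 absorbing the halving, make either exchange
  cost at most \<alpha>.\<close>

lemma card_compat_le:
  fixes p \<alpha> :: real
  assumes V: "finite V" and xs: "xs \<in> tuples V k" and U: "U \<subseteq> {..<k}"
    and deg: "\<And>i. card {j. j < k \<and> i < j \<and> P j = i} < \<Delta>"
    and p: "0 < p" "2 * k \<le> card V"
    and \<alpha>: "2 * real k \<le> \<alpha> * card V" "2 * real \<Delta> \<le> \<alpha> * (card V * p)"
  shows "real (card (compat P V xs U k)) * (1 / p) ^ inner_edges P k U \<le> card (tuples V k) * \<alpha> ^ card U"
proof -
  define b where "b = (\<lambda>j. if j \<notin> U then card V - j else if P j < j \<and> P j \<in> U then \<Delta> else k)"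
  have "card (compat P V xs U l) \<le> (\<Prod>j<l. b j)" for l
  proof (induction l)
    case 0
    have "compat P V xs U 0 = {[]}" by (auto simp: compat_def tuples_def)
    then show ?case by simp
  next
    case (Suc l)
    show ?case
      using order_trans[OF card_compat_Suc_le[OF V xs deg, of U l] mult_right_mono[OF Suc]]
      by (auto simp: b_def mult.commute)
  qed
  then have 1: "real (card (compat P V xs U k)) \<le> (\<Prod>j<k. real (b j))"
    by (metis of_nat_le_iff of_nat_prod)
  have fin: "finite {..<k}" by simp
  have "(1 / p) ^ inner_edges P k U = (\<Prod>j<k. if j \<in> U \<and> P j < j \<and> P j \<in> U then 1 / p else 1)"
    unfolding inner_edges_def by (subst prod.If_cases[OF fin]) (auto intro!: arg_cong[where f = "\<lambda>A. (1 / p) ^ card A"])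
  then have "real (card (compat P V xs U k)) * (1 / p) ^ inner_edges P k U \<le>
      (\<Prod>j<k. real (b j)) * (\<Prod>j<k. if j \<in> U \<and> P j < j \<and> P j \<in> U then 1 / p else 1)"
    using 1 p by (auto intro: mult_right_mono simp: prod_nonneg)
  also have "\<dots> = (\<Prod>j<k. real (b j) * (if j \<in> U \<and> P j < j \<and> P j \<in> U then 1 / p else 1))"
    by (simp add: prod.distrib)
  also have "\<dots> \<le> (\<Prod>j<k. real (card V - j) * (if j \<in> U then \<alpha> else 1))"
  proof (intro prod_mono conjI)
    fix j assume "j \<in> {..<k}"
    then have h: "real (card V) / 2 \<le> real (card V - j)" "0 < real (card V)" using p by auto
    have \<alpha>0: "0 \<le> \<alpha>"
      using \<alpha>(1) h(2) by (smt (verit) mult_nonneg_nonneg mult_neg_pos of_nat_0_le_iff)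
    have "real k \<le> \<alpha> * (card V / 2)" "real \<Delta> / p \<le> \<alpha> * (card V / 2)"
      using \<alpha> p by (auto simp: field_simps)
    moreover have "\<alpha> * (card V / 2) \<le> \<alpha> * real (card V - j)"
      using h \<alpha>0 by (intro mult_left_mono) auto
    ultimately have "real k \<le> \<alpha> * real (card V - j)" "real \<Delta> / p \<le> \<alpha> * real (card V - j)"
      by linarith+
    then show "real (b j) * (if j \<in> U \<and> P j < j \<and> P j \<in> U then 1 / p else 1) \<le>
        real (card V - j) * (if j \<in> U then \<alpha> else 1)"
      by (auto simp: b_def mult.commute)
  qed (use p in auto)
  also have "\<dots> = card (tuples V k) * \<alpha> ^ card U"
  proof -
    have "(\<Prod>j<k. if j \<in> U then \<alpha> else 1) = \<alpha> ^ card U"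
      using U by (subst prod.If_cases[OF fin]) (auto simp: Int_absorb1)
    moreover have "(\<Prod>j<k. real (card V - j)) = card (tuples V k)"
      using p by (subst card_tuples[OF V]) auto
    ultimately show ?thesis by (simp add: prod.distrib)
  qed
  finally show ?thesis .
qed

definition no_isolated :: "(nat \<Rightarrow> nat) \<Rightarrow> nat \<Rightarrow> nat set set" where
  "no_isolated P k = {U. U \<subseteq> {..<k} \<and>
     (\<forall>i\<in>U. (P i < i \<and> P i \<in> U) \<or> (\<exists>j\<in>U. i < j \<and> P j = i))}"

text \<open>A parent lies in the block of its child, so a set without isolated indices meets each
  block in no element or in at least two. Thus \<open>\<alpha> ^ card U\<close> is at most
  \<alpha>^2 per block met; each block offers at most 2^t subsets, and summing over the sets of
  blocks met is the binomial theorem.\<close>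

lemma sum_no_isolated_le:
  fixes \<alpha> :: real
  assumes \<alpha>: "0 \<le> \<alpha>" "\<alpha> \<le> 1" and t: "0 < t" and blk: "\<And>i. P i div t = i div t"
  shows "(\<Sum>U\<in>no_isolated P (m * t). \<alpha> ^ card U) \<le> (1 + 2 ^ t * \<alpha>\<^sup>2) ^ m"
proof -
  define k where "k = m * t"
  define blocks where "blocks = (\<lambda>J. {i. i < k \<and> i div t \<in> J})"
  have finNI: "finite (no_isolated P k)"
    by (rule finite_subset[of _ "Pow {..<k}"]) (auto simp: no_isolated_def)
  have card_blocks: "card (blocks J) = card J * t" if "J \<subseteq> {..<m}" for J
  proof -
    have "bij_betw (\<lambda>(b, r). b * t + r) (J \<times> {..<t}) (blocks J)"
    proof (rule bij_betw_byWitness[where f' = "\<lambda>i. (i div t, i mod t)"])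
      show "(\<lambda>(b, r). b * t + r) ` (J \<times> {..<t}) \<subseteq> blocks J"
      proof clarify
        fix b r assume br: "b \<in> J" "r < t"
        then have "b * t + r < Suc b * t" by simp
        also have "\<dots> \<le> m * t" using br that by (intro mult_right_mono) auto
        finally show "b * t + r \<in> blocks J" using br t by (simp add: blocks_def k_def)
      qed
    qed (use t in \<open>auto simp: blocks_def\<close>)
    then show ?thesis by (metis bij_betw_same_card card_cartesian_product card_lessThan)
  qed
  have two: "2 * card ((\<lambda>i. i div t) ` U) \<le> card U" if U: "U \<in> no_isolated P k" for U
  proof -
    define J where "J = (\<lambda>i. i div t) ` U"
    have finU: "finite U" using U finite_subset by (auto simp: no_isolated_def)
    have ge2: "2 \<le> card {i \<in> U. i div t = b}" if b: "b \<in> J" for b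
    proof -
      obtain i where i: "i \<in> U" "i div t = b" using b unfolding J_def by blast
      then consider "P i < i" "P i \<in> U" | j where "j \<in> U" "i < j" "P j = i"
        using U by (auto simp: no_isolated_def)
      then have "\<exists>j\<in>U. j \<noteq> i \<and> j div t = b"
      proof cases
        case 1
        then show ?thesis using blk[of i] i by (intro bexI[of _ "P i"]) auto
      next
        case 2
        then show ?thesis using blk[of j] i by (intro bexI[of _ j]) auto
      qed
      then obtain j where "j \<in> U" "j \<noteq> i" "j div t = b" by blast
      then have "card {i, j} \<le> card {i \<in> U. i div t = b}"
        using i finU by (intro card_mono) auto
      then show ?thesis using \<open>j \<noteq> i\<close> by simp
    qed
    have "U = (\<Union>b\<in>J. {i \<in> U. i div t = b})" by (auto simp: J_def)
    then have "card U = card (\<Union>b\<in>J. {i \<in> U. i div t = b})" by (rule arg_cong)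
    also have "\<dots> = (\<Sum>b\<in>J. card {i \<in> U. i div t = b})"
      by (rule card_UN_disjoint) (use finU in \<open>auto simp: J_def\<close>)
    also have "\<dots> \<ge> (\<Sum>b\<in>J. 2)" by (intro sum_mono ge2)
    finally show ?thesis by (simp add: J_def)
  qed
  have "(\<Sum>U\<in>no_isolated P k. \<alpha> ^ card U) \<le> (\<Sum>U\<in>no_isolated P k. (\<alpha>\<^sup>2) ^ card ((\<lambda>i. i div t) ` U))"
    unfolding power_mult[symmetric] by (intro sum_mono power_decreasing two \<alpha>)
  also have "\<dots> = (\<Sum>J\<in>Pow {..<m}. \<Sum>U\<in>{U\<in>no_isolated P k. (\<lambda>i. i div t) ` U = J}. (\<alpha>\<^sup>2) ^ card ((\<lambda>i. i div t) ` U))"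
    by (rule sum.group[symmetric])
      (use finNI t in \<open>auto simp: no_isolated_def k_def less_mult_imp_div_less\<close>)
  also have "\<dots> \<le> (\<Sum>J\<in>Pow {..<m}. (2 ^ t * \<alpha>\<^sup>2) ^ card J)"
  proof (intro sum_mono)
    fix J assume J: "J \<in> Pow {..<m}"
    define N where "N = {U\<in>no_isolated P k. (\<lambda>i. i div t) ` U = J}"
    have "N \<subseteq> Pow (blocks J)" by (auto simp: N_def no_isolated_def blocks_def)
    moreover have "finite (blocks J)" by (simp add: blocks_def)
    ultimately have "card N \<le> card (Pow (blocks J))" by (intro card_mono) auto
    also have "\<dots> = 2 ^ (t * card J)"
      using J card_blocks by (subst card_Pow) (auto simp: blocks_def mult.commute)
    finally have "real (card N) \<le> (2 ^ t) ^ card J"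
      by (metis of_nat_le_iff of_nat_numeral of_nat_power power_mult)
    then have "(\<Sum>U\<in>N. (\<alpha>\<^sup>2) ^ card ((\<lambda>i. i div t) ` U)) \<le> (2 ^ t) ^ card J * (\<alpha>\<^sup>2) ^ card J"
      by (auto simp: N_def intro: mult_right_mono)
    then show "(\<Sum>U\<in>{U\<in>no_isolated P k. (\<lambda>i. i div t) ` U = J}. (\<alpha>\<^sup>2) ^ card ((\<lambda>i. i div t) ` U))
        \<le> (2 ^ t * \<alpha>\<^sup>2) ^ card J"
      by (simp add: N_def power_mult_distrib)
  qed
  also have "\<dots> = (1 + 2 ^ t * \<alpha>\<^sup>2) ^ m"
    using prod_add[of "{..<m}" "\<lambda>_. 2 ^ t * \<alpha>\<^sup>2" "\<lambda>_. 1"] by (simp add: add.commute)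
  finally show ?thesis by (simp add: k_def)
qed

section \<open>The second-moment ratio of the number of embeddings\<close>

lemma sum_subsets_by_card:
  fixes g :: "nat \<Rightarrow> real"
  assumes "finite A"
  shows "(\<Sum>U | U \<subseteq> A \<and> l1 < card U. g (card U)) = (\<Sum>l\<in>{l1<..card A}. real (card A choose l) * g l)"
proof -
  define \<U> where "\<U> = {U. U \<subseteq> A \<and> l1 < card U}"
  have fin: "finite \<U>" by (rule finite_subset[of _ "Pow A"]) (use assms in \<open>auto simp: \<U>_def\<close>)
  have "(\<Sum>U\<in>\<U>. g (card U)) = (\<Sum>l\<in>{l1<..card A}. \<Sum>U\<in>{U \<in> \<U>. card U = l}. g (card U))"
    by (rule sum.group[symmetric]) (use fin assms in \<open>auto simp: \<U>_def card_mono\<close>)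
  also have "\<dots> = (\<Sum>l\<in>{l1<..card A}. real (card A choose l) * g l)"
  proof (intro sum.cong refl)
    fix l assume "l \<in> {l1<..card A}"
    then have "{U \<in> \<U>. card U = l} = {U. U \<subseteq> A \<and> card U = l}" by (auto simp: \<U>_def)
    then show "(\<Sum>U\<in>{U \<in> \<U>. card U = l}. g (card U)) = real (card A choose l) * g l"
      using n_subsets[OF assms, of l] by simp
  qed
  finally show ?thesis by (simp add: \<U>_def)
qed

text \<open>An upper bound for \<open>E X\<^sup>2 / (E X)\<^sup>2\<close>, where \<open>X\<close> counts the embeddings; \<open>\<alpha>\<close> is the cost of one
  shared vertex, and \<open>l1\<close> is the overlap size from which on the isolated common vertices are also counted.\<close>

definition pair_ratio :: "nat \<Rightarrow> nat \<Rightarrow> real \<Rightarrow> real \<Rightarrow> nat \<Rightarrow> real" where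
  "pair_ratio m t p \<alpha> l1 = (1 / (1 - p)) ^ (l1 choose 2) * (1 + 2 ^ t * \<alpha>\<^sup>2) ^ m +
     (\<Sum>l\<in>{l1<..m * t}. real ((m * t) choose l) * (\<alpha> ^ l * (1 / (1 - p)) ^ (l choose 2)))"

text \<open>Only one term of one of the two sums is used for a given ys. Writing it as a sum of
  indicators over all U, independent of the true overlap, prepares the exchange of the sums over ys
  and U.\<close>

lemma prob_two_embs_le_sum:
  fixes p :: real
  assumes V: "finite V" and xs: "xs \<in> tuples V k" and ys: "ys \<in> tuples V k" and p: "0 < p" "p < 1"
  shows "measure_pmf.prob (edge_pmf V p) {X. emb P X xs \<and> emb P X ys} \<le> (emb_prob P k p)\<^sup>2 *
    ((1 / (1 - p)) ^ (l1 choose 2) *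
       (\<Sum>U\<in>no_isolated P k. indicator (compat P V xs U k) ys * (1 / p) ^ inner_edges P k U) +
     (\<Sum>U | U \<subseteq> {..<k} \<and> l1 < card U. indicator (compat P V xs U k) ys *
       (1 / p) ^ inner_edges P k U * (1 / (1 - p)) ^ (card U choose 2)))"
    (is "?pr \<le> _ * (?Q * ?S1 + ?S2)")
proof (cases "fedges P ys \<inter> vpairs (set xs) \<subseteq> fedges P xs")
  case False
  then obtain e where "e \<in> fedges P ys" "e \<in> vpairs (set xs)" "e \<notin> fedges P xs" by blast
  moreover have "distinct ys" using ys by (simp add: tuples_def)
  ultimately have "{X. emb P X xs \<and> emb P X ys} = {}"
    using fedges_subset[of ys P] by (auto simp: emb_def)
  then have "?pr = 0" by (simp only: measure_empty)
  also have "0 \<le> (emb_prob P k p)\<^sup>2 * (?Q * ?S1 + ?S2)"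
    using p by (intro mult_nonneg_nonneg add_nonneg_nonneg sum_nonneg) auto
  finally show ?thesis .
next
  case True
  define U where "U = {i. i < k \<and> ys ! i \<in> set xs}"
  have d: "distinct xs" "distinct ys" "length xs = k" "length ys = k" using xs ys by (auto simp: tuples_def)
  have finNI: "finite (no_isolated P k)"
    by (rule finite_subset[of _ "Pow {..<k}"]) (auto simp: no_isolated_def)
  have finU: "finite {U. U \<subseteq> {..<k} \<and> l1 < card U}"
    by (rule finite_subset[of _ "Pow {..<k}"]) auto
  have cU: "card (set xs \<inter> set ys) = card U"
  proof -
    have "set ys = (!) ys ` {..<k}" by (auto simp: set_conv_nth d)
    then have "set xs \<inter> set ys = (!) ys ` U" by (auto simp: U_def)
    moreover have "inj_on ((!) ys) U" using d by (auto simp: U_def inj_on_def nth_eq_iff_index_eq)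
    ultimately show ?thesis by (simp add: card_image)
  qed
  have "fedges P ys \<inter> vpairs (set xs) =
      (\<lambda>j. {ys ! P j, ys ! j}) ` {j. j < k \<and> j \<in> U \<and> P j < j \<and> P j \<in> U}" (is "_ = ?f ` ?J")
  proof (intro equalityI subsetI)
    fix e assume e: "e \<in> fedges P ys \<inter> vpairs (set xs)"
    then obtain j where j: "e = {ys ! P j, ys ! j}" "j < k" "P j < j" by (auto simp: fedges_def d)
    with e have "ys ! P j \<in> set xs" "ys ! j \<in> set xs" by (auto simp: vpairs_def)
    with j show "e \<in> ?f ` ?J" by (auto simp: U_def)
  next
    fix e assume "e \<in> ?f ` ?J"
    then obtain j where j: "e = {ys ! P j, ys ! j}" "j < k" "P j < j" "j \<in> U" "P j \<in> U" by auto
    then have "e \<in> fedges P ys" by (auto simp: fedges_def d)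
    moreover have "e \<subseteq> set xs" using j by (auto simp: U_def)
    ultimately show "e \<in> fedges P ys \<inter> vpairs (set xs)"
      using fedges_subset[OF d(2), of P] by (auto simp: vpairs_def)
  qed
  moreover have "inj_on ?f ?J"
    by (rule inj_on_subset[OF inj_on_fedges[OF d(2)]]) (auto simp: d)
  ultimately have ce: "card (fedges P ys \<inter> vpairs (set xs)) = inner_edges P k U"
    by (simp add: card_image inner_edges_def)
  have compU: "ys \<in> compat P V xs W k" if "W \<subseteq> U" for W
    unfolding compat_def
  proof (intro CollectI conjI allI impI ys)
    fix i assume i: "i < k" "i \<in> W"
    then show "ys ! i \<in> set xs" using that by (auto simp: U_def)
    assume P: "P i < i \<and> P i \<in> W"
    then have "{ys ! P i, ys ! i} \<in> fedges P ys" using i d by (auto simp: fedges_def)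
    moreover have "{ys ! P i, ys ! i} \<subseteq> set xs" using i P that by (auto simp: U_def)
    ultimately show "{ys ! P i, ys ! i} \<in> fedges P xs"
      using True fedges_subset[OF d(2), of P] by (auto simp: vpairs_def)
  qed
  have nn: "0 \<le> ?Q * ?S1" "0 \<le> ?S2" using p by (auto intro!: mult_nonneg_nonneg sum_nonneg)
  have "?pr \<le> (emb_prob P k p)\<^sup>2 * (1 / p) ^ inner_edges P k U * (1 / (1 - p)) ^ (card U choose 2)"
    using prob_two_embs_le[OF V xs ys p True] by (simp add: ce cU)
  also have "\<dots> = (emb_prob P k p)\<^sup>2 * ((1 / p) ^ inner_edges P k U * (1 / (1 - p)) ^ (card U choose 2))"
    by (simp add: mult.assoc)
  also have "(1 / p) ^ inner_edges P k U * (1 / (1 - p)) ^ (card U choose 2) \<le> ?Q * ?S1 + ?S2"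
  proof (cases "card U \<le> l1")
    case True
    \<comment> \<open>The overlap without its isolated indices. Both ends of an inner edge survive,
      so the number of inner edges is unchanged, and every witness of non-isolation in U is itself
      in W.\<close>
    define W where "W = {i \<in> U. (P i < i \<and> P i \<in> U) \<or> (\<exists>j\<in>U. i < j \<and> P j = i)}"
    have "W \<in> no_isolated P k" by (auto simp: no_isolated_def W_def U_def)
    moreover have "inner_edges P k U = inner_edges P k W"
      unfolding inner_edges_def by (intro arg_cong[where f = card]) (auto simp: W_def)
    moreover have "ys \<in> compat P V xs W k" by (rule compU) (auto simp: W_def)
    ultimately have "(1 / p) ^ inner_edges P k U \<le> ?S1"
      using finNI p by (intro order_trans[OF _ member_le_sum[of W]]) auto
    moreover have "(1 / (1 - p)) ^ (card U choose 2) \<le> ?Q"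
      using p True by (intro power_increasing binomial_right_mono) auto
    ultimately have "(1 / p) ^ inner_edges P k U * (1 / (1 - p)) ^ (card U choose 2) \<le> ?S1 * ?Q"
      using p by (intro mult_mono) (auto intro!: sum_nonneg)
    then show ?thesis using nn by (simp add: mult.commute)
  next
    case False
    then have "(1 / p) ^ inner_edges P k U * (1 / (1 - p)) ^ (card U choose 2) \<le> ?S2"
      using finU p compU[of U] by (intro order_trans[OF _ member_le_sum[of U]]) (auto simp: U_def)
    then show ?thesis using nn by simp
  qed
  finally show ?thesis by (simp add: mult_left_mono)
qed

text \<open>Summing over ys first turns each indicator into a number of compatible lists, which
  \<open>card_compat_le\<close> bounds by \<open>\<alpha> ^ card U\<close> times the number of all
  lists.\<close>

lemma sum_prob_two_embs_le:
  fixes p \<alpha> :: real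
  assumes V: "finite V" and xs: "xs \<in> tuples V (m * t)" and p: "0 < p" "p < 1"
    and t: "0 < t" and blk: "\<And>i. P i div t = i div t"
    and deg: "\<And>i. card {j. j < m * t \<and> i < j \<and> P j = i} < t"
    and \<alpha>: "0 \<le> \<alpha>" "\<alpha> \<le> 1" "2 * real (m * t) \<le> \<alpha> * card V" "2 * real t \<le> \<alpha> * (card V * p)"
    and k: "2 * (m * t) \<le> card V"
  shows "(\<Sum>ys\<in>tuples V (m * t). measure_pmf.prob (edge_pmf V p) {X. emb P X xs \<and> emb P X ys}) \<le>
    (emb_prob P (m * t) p)\<^sup>2 * card (tuples V (m * t)) * pair_ratio m t p \<alpha> l1"
proof -
  define k where "k = m * t"
  define q where "q = 1 / (1 - p)"
  define \<U> where "\<U> = {U. U \<subseteq> {..<k} \<and> l1 < card U}"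
  define h where "h = (\<lambda>U. (1 / p) ^ inner_edges P k U)"
  define C where "C = (\<lambda>U. compat P V xs U k)"
  define N where "N = real (card (tuples V k))"
  have q: "1 \<le> q" using p by (simp add: q_def)
  have finT: "finite (tuples V k)" using V by simp
  have sumC: "(\<Sum>ys\<in>tuples V k. indicator (C U) ys :: real) = card (C U)" for U
  proof -
    have "C U \<subseteq> tuples V k" by (auto simp: C_def compat_def)
    then show ?thesis using finT by (simp add: indicator_def sum.If_cases Int_absorb1)
  qed
  have cnt: "real (card (C U)) * h U \<le> N * \<alpha> ^ card U" if "U \<subseteq> {..<k}" for U
    unfolding C_def h_def N_def k_def
    by (rule card_compat_le[OF V xs]) (use that deg p \<alpha> k in \<open>auto simp: k_def\<close>)
  have "(\<Sum>ys\<in>tuples V k. measure_pmf.prob (edge_pmf V p) {X. emb P X xs \<and> emb P X ys}) \<le>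
    (\<Sum>ys\<in>tuples V k. (emb_prob P k p)\<^sup>2 * (q ^ (l1 choose 2) * (\<Sum>U\<in>no_isolated P k. indicator (C U) ys * h U) +
       (\<Sum>U\<in>\<U>. indicator (C U) ys * h U * q ^ (card U choose 2))))"
    unfolding C_def h_def \<U>_def q_def using xs V p
    by (intro sum_mono prob_two_embs_le_sum) (auto simp: k_def)
  also have "\<dots> = (emb_prob P k p)\<^sup>2 * (q ^ (l1 choose 2) * (\<Sum>U\<in>no_isolated P k. card (C U) * h U) +
       (\<Sum>U\<in>\<U>. card (C U) * h U * q ^ (card U choose 2)))"
    unfolding sum_distrib_left[symmetric] sum.distrib sumC[symmetric]
    by (subst (1 2) sum.swap) (simp add: sum_distrib_right)
  also have "\<dots> \<le> (emb_prob P k p)\<^sup>2 * (q ^ (l1 choose 2) * (\<Sum>U\<in>no_isolated P k. N * \<alpha> ^ card U) +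
       (\<Sum>U\<in>\<U>. N * \<alpha> ^ card U * q ^ (card U choose 2)))"
    using q by (intro mult_left_mono add_mono sum_mono mult_right_mono cnt)
      (auto simp: no_isolated_def \<U>_def)
  also have "\<dots> = (emb_prob P k p)\<^sup>2 * N * (q ^ (l1 choose 2) * (\<Sum>U\<in>no_isolated P k. \<alpha> ^ card U) +
       (\<Sum>U\<in>\<U>. \<alpha> ^ card U * q ^ (card U choose 2)))"
    by (simp add: algebra_simps sum_distrib_left)
  also have "\<dots> \<le> (emb_prob P k p)\<^sup>2 * N * (q ^ (l1 choose 2) * (1 + 2 ^ t * \<alpha>\<^sup>2) ^ m +
       (\<Sum>U\<in>\<U>. \<alpha> ^ card U * q ^ (card U choose 2)))"
    unfolding k_def using q sum_no_isolated_le[of \<alpha> t P m] \<alpha> t blk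
    by (intro mult_left_mono add_mono) (auto simp: N_def)
  also have "(\<Sum>U\<in>\<U>. \<alpha> ^ card U * q ^ (card U choose 2)) =
      (\<Sum>l\<in>{l1<..k}. real (k choose l) * (\<alpha> ^ l * q ^ (l choose 2)))"
    unfolding \<U>_def using sum_subsets_by_card[of "{..<k}", where ?l1.0 = l1 and g = "\<lambda>l. \<alpha> ^ l * q ^ (l choose 2)"] by simp
  finally show ?thesis by (simp add: pair_ratio_def N_def k_def q_def)
qed

lemma prob_ex_emb_ge:
  fixes p \<alpha> :: real and V :: "'a set"
  assumes V: "finite V" and p: "0 < p" "p < 1"
    and t: "0 < t" and blk: "\<And>i. P i div t = i div t"
    and deg: "\<And>i. card {j. j < m * t \<and> i < j \<and> P j = i} < t"
    and \<alpha>: "0 \<le> \<alpha>" "\<alpha> \<le> 1" "2 * real (m * t) \<le> \<alpha> * card V" "2 * real t \<le> \<alpha> * (card V * p)"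
    and k: "2 * (m * t) \<le> card V"
  shows "1 / pair_ratio m t p \<alpha> l1 \<le>
    measure_pmf.prob (edge_pmf V p) {X. \<exists>xs\<in>tuples V (m * t). emb P X xs}"
proof -
  define A where "A = (\<lambda>xs :: 'a list. {X. emb P X xs})"
  have A: "{X. \<exists>xs\<in>tuples V (m * t). emb P X xs} = (\<Union>xs\<in>tuples V (m * t). A xs)"
    by (auto simp: A_def)
  have fin: "finite (set_pmf (edge_pmf V p))"
    using V by (intro finite_set_Pi_pmf_bool) simp
  have "card (tuples V (m * t)) > 0"
    using k by (subst card_tuples[OF V]) auto
  then have ne: "tuples V (m * t) \<noteq> {}" by auto
  have pr: "0 < pair_ratio m t p \<alpha> l1"
    unfolding pair_ratio_def using p \<alpha> by (intro add_pos_nonneg mult_pos_pos sum_nonneg) (auto simp: add_pos_nonneg)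
  show ?thesis
    unfolding A
  proof (rule second_moment_Un[OF fin _ ne _ pr])
    show "0 < emb_prob P (m * t) p" using p by (simp add: emb_prob_def)
    show "measure_pmf.prob (edge_pmf V p) (A xs) = emb_prob P (m * t) p" if "xs \<in> tuples V (m * t)" for xs
      using prob_emb[OF V that] p by (simp add: A_def)
    show "(\<Sum>ys\<in>tuples V (m * t). measure_pmf.prob (edge_pmf V p) (A xs \<inter> A ys)) \<le>
      (emb_prob P (m * t) p)\<^sup>2 * real (card (tuples V (m * t))) * pair_ratio m t p \<alpha> l1"
      if "xs \<in> tuples V (m * t)" for xs
      using sum_prob_two_embs_le[OF V that p t blk deg \<alpha> k] by (simp add: A_def Int_def)
  qed (use V in simp)
qed

section \<open>Disjoint copies of a tree\<close>

text \<open>A tree on \<open>{0..<t}\<close> whose edges are \<open>{par j, j}\<close> for \<open>0 < j < t\<close>; \<open>forest_par\<close> is the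
  parent function of infinitely many disjoint copies of it, placed on consecutive blocks of length \<open>t\<close>.\<close>

locale tree_order =
  fixes t :: nat and par :: "nat \<Rightarrow> nat"
  assumes t_pos: "0 < t" and par_0: "par 0 = 0" and par_less: "0 < j \<Longrightarrow> j < t \<Longrightarrow> par j < j"
begin

definition forest_par :: "nat \<Rightarrow> nat" where
  "forest_par j = (j div t) * t + par (j mod t)"

lemma par_lt: "r < t \<Longrightarrow> par r < t"
  using par_0 par_less[of r] t_pos by (cases "r = 0") auto

lemma block_div [simp]: "r < t \<Longrightarrow> (b * t + r) div t = b"
  and block_mod [simp]: "r < t \<Longrightarrow> (b * t + r) mod t = r"
  using t_pos by auto

lemma block_less: "r < t \<Longrightarrow> b < m \<Longrightarrow> b * t + r < m * t"
proof -
  assume "r < t" "b < m"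
  then have "b * t + r < Suc b * t" by simp
  also have "\<dots> \<le> m * t" using \<open>b < m\<close> by (intro mult_right_mono) auto
  finally show ?thesis .
qed

lemma forest_par_block: "r < t \<Longrightarrow> forest_par (b * t + r) = b * t + par r"
  by (simp add: forest_par_def)

lemma forest_par_div [simp]: "forest_par j div t = j div t"
  and forest_par_mod: "forest_par j mod t = par (j mod t)"
  using par_lt[of "j mod t"] t_pos by (auto simp: forest_par_def)

lemma forest_par_less_iff: "forest_par j < j \<longleftrightarrow> j mod t \<noteq> 0"
  and forest_par_le: "forest_par j \<le> j"
proof -
  obtain a b where j: "j = a * t + b" "b < t"
    using t_pos by (metis div_mult_mod_eq mod_less_divisor)
  show "forest_par j < j \<longleftrightarrow> j mod t \<noteq> 0" "forest_par j \<le> j"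
    using j par_0 par_less[of b] forest_par_block[of b a] by (cases "b = 0"; auto)+
qed

text \<open>The children of i come after i in the block of i, which leaves at most t - 1
  positions.\<close>

lemma card_children_less: "card {j. j < k \<and> i < j \<and> forest_par j = i} < t"
proof -
  have "{j. j < k \<and> i < j \<and> forest_par j = i} \<subseteq> {i<..<(i div t + 1) * t}"
  proof
    fix j assume "j \<in> {j. j < k \<and> i < j \<and> forest_par j = i}"
    then have j: "i < j" "forest_par j = i" by auto
    then have "j div t = i div t" using forest_par_div[of j] by simp
    then have "j = (i div t) * t + j mod t" using div_mult_mod_eq[of j t] by simp
    moreover have "j mod t < t" using t_pos by simp
    ultimately show "j \<in> {i<..<(i div t + 1) * t}" using j by (simp only: greaterThanLessThan_iff) (simp; linarith)
  qed
  then have "card {j. j < k \<and> i < j \<and> forest_par j = i} \<le> card {i<..<(i div t + 1) * t}"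
    by (rule card_mono[OF finite_greaterThanLessThan])
  also have "\<dots> = (i div t + 1) * t - Suc i" by simp
  also have "\<dots> < t" using t_pos div_mult_mod_eq[of i t] by (simp; linarith)
  finally show ?thesis .
qed

lemma card_nonroots: "card {j. j < m * t \<and> forest_par j < j} = m * t - m"
proof -
  have "{j. j < m * t \<and> forest_par j < j} = {..<m * t} - (\<lambda>b. b * t) ` {..<m}"
  proof (intro set_eqI iffI)
    fix j assume "j \<in> {j. j < m * t \<and> forest_par j < j}"
    then show "j \<in> {..<m * t} - (\<lambda>b. b * t) ` {..<m}" by (auto simp: forest_par_less_iff)
  next
    fix j assume j: "j \<in> {..<m * t} - (\<lambda>b. b * t) ` {..<m}"
    then have "j div t < m" by (simp add: less_mult_imp_div_less)
    then have "j mod t \<noteq> 0" using j div_mult_mod_eq[of j t] by (metis DiffE add.right_neutral image_eqI lessThan_iff)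
    then show "j \<in> {j. j < m * t \<and> forest_par j < j}" using j by (auto simp: forest_par_less_iff)
  qed
  moreover have "(\<lambda>b. b * t) ` {..<m} \<subseteq> {..<m * t}" using t_pos by auto
  moreover have "card ((\<lambda>b. b * t) ` {..<m}) = m"
    using t_pos by (subst card_image) (auto simp: inj_on_def)
  ultimately show ?thesis by (simp add: card_Diff_subset)
qed

text \<open>This form does not refer to the order of the two indices, so it can be transported along
  permutations of the blocks.\<close>

lemma emb_iff_sym:
  assumes "distinct xs"
  shows "emb forest_par X xs \<longleftrightarrow> (\<forall>i<length xs. \<forall>j<length xs. i \<noteq> j \<longrightarrow>
    (X {xs ! i, xs ! j} \<longleftrightarrow> forest_par i = j \<or> forest_par j = i))" (is "_ \<longleftrightarrow> ?R")
proof
  assume emb: "emb forest_par X xs"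
  have lt: "X {xs ! i, xs ! j} \<longleftrightarrow> forest_par i = j \<or> forest_par j = i"
    if "i < length xs" "j < length xs" "i < j" for i j
    using emb that forest_par_le[of i] unfolding emb_iff[OF assms] by auto
  have "X {xs ! i, xs ! j} \<longleftrightarrow> forest_par i = j \<or> forest_par j = i"
    if "i < length xs" "j < length xs" "i \<noteq> j" for i j
    using lt[of i j] lt[of j i] that by (cases "i < j") (auto simp: insert_commute)
  then show ?R by blast
next
  assume R: ?R
  have "X {xs ! i, xs ! j} \<longleftrightarrow> forest_par j = i" if "i < j" "j < length xs" for i j
    using R that forest_par_le[of i] by auto
  then show "emb forest_par X xs" unfolding emb_iff[OF assms] by blast
qed

text \<open>Here m is the number of blocks of the result, and \<sigma> says from which block of xs
  each is copied. A permutation \<sigma> yields the m! lists of one matching, and an injection that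
  misses b deletes block b.\<close>

definition rearrange :: "nat \<Rightarrow> (nat \<Rightarrow> nat) \<Rightarrow> 'a list \<Rightarrow> 'a list" where
  "rearrange m \<sigma> xs = map (\<lambda>i. xs ! (\<sigma> (i div t) * t + i mod t)) [0..<m * t]"

lemma rearrange_emb:
  assumes "xs \<in> tuples V (m * t)" "emb forest_par X xs"
    and \<sigma>: "inj_on \<sigma> {..<l}" "\<sigma> ` {..<l} \<subseteq> {..<m}"
  shows "rearrange l \<sigma> xs \<in> tuples V (l * t)" "emb forest_par X (rearrange l \<sigma> xs)"
proof -
  define \<tau> where "\<tau> = (\<lambda>i. \<sigma> (i div t) * t + i mod t)"
  define ys where "ys = rearrange l \<sigma> xs"
  have xs: "distinct xs" "length xs = m * t" "set xs \<subseteq> V" using assms(1) by (auto simp: tuples_def)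
  have \<tau>_lt: "\<tau> i < m * t" if "i < l * t" for i
  proof -
    have "i div t < l" using that by (simp add: less_mult_imp_div_less)
    then have "\<sigma> (i div t) < m" using \<sigma>(2) by blast
    then show ?thesis unfolding \<tau>_def using t_pos by (intro block_less) auto
  qed
  have \<tau>_div: "\<tau> i div t = \<sigma> (i div t)" and \<tau>_mod: "\<tau> i mod t = i mod t" for i
    using t_pos by (auto simp: \<tau>_def)
  have inj: "i = j" if "\<tau> i = \<tau> j" "i < l * t" "j < l * t" for i j
  proof -
    have "\<sigma> (i div t) = \<sigma> (j div t)" "i mod t = j mod t" using that \<tau>_div \<tau>_mod by metis+
    moreover from this have "i div t = j div t"
      using \<sigma>(1) that(2,3) by (auto simp: less_mult_imp_div_less dest: inj_onD)
    ultimately show ?thesis by (metis div_mult_mod_eq)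
  qed
  \<comment> \<open>Whole blocks are moved and positions inside them kept, so \<tau> commutes with
    the parent function.\<close>
  have fp: "forest_par (\<tau> i) = \<tau> (forest_par i)" for i
    by (simp add: forest_par_def[of "\<tau> i"] \<tau>_div \<tau>_mod) (simp add: \<tau>_def forest_par_mod)
  have ys: "length ys = l * t" "\<And>i. i < l * t \<Longrightarrow> ys ! i = xs ! \<tau> i"
    by (auto simp: ys_def rearrange_def \<tau>_def)
  have dys: "distinct ys"
    unfolding distinct_conv_nth ys(1) using ys(2) \<tau>_lt inj xs by (metis nth_eq_iff_index_eq)
  show "rearrange l \<sigma> xs \<in> tuples V (l * t)"
    using dys ys \<tau>_lt xs unfolding ys_def[symmetric] by (force simp: tuples_def set_conv_nth)
  have "X {ys ! i, ys ! j} \<longleftrightarrow> forest_par i = j \<or> forest_par j = i"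
    if ij: "i < l * t" "j < l * t" "i \<noteq> j" for i j
  proof -
    have lt: "forest_par i < l * t" "forest_par j < l * t"
      using forest_par_le[of i] forest_par_le[of j] ij by auto
    have "X {xs ! \<tau> i, xs ! \<tau> j} \<longleftrightarrow> forest_par (\<tau> i) = \<tau> j \<or> forest_par (\<tau> j) = \<tau> i"
      using assms(2) \<tau>_lt[OF ij(1)] \<tau>_lt[OF ij(2)] inj[OF _ ij(1,2)] ij(3) xs
      unfolding emb_iff_sym[OF xs(1)] by metis
    also have "\<dots> \<longleftrightarrow> forest_par i = j \<or> forest_par j = i"
      unfolding fp using inj[OF _ lt(1) ij(2)] inj[OF _ lt(2) ij(1)] by metis
    finally show ?thesis using ys ij by simp
  qed
  then show "emb forest_par X (rearrange l \<sigma> xs)"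
    unfolding ys_def[symmetric] emb_iff_sym[OF dys] ys(1) by blast
qed

lemma rearrange_avoids_block:
  assumes "distinct xs" "length xs = m * t" "b * t + r < m * t" "r < t"
    and "b \<notin> \<sigma> ` {..<l}" "\<sigma> ` {..<l} \<subseteq> {..<m}"
  shows "xs ! (b * t + r) \<notin> set (rearrange l \<sigma> xs)"
proof
  assume "xs ! (b * t + r) \<in> set (rearrange l \<sigma> xs)"
  then obtain i where i: "i < l * t" "xs ! (b * t + r) = xs ! (\<sigma> (i div t) * t + i mod t)"
    by (auto simp: rearrange_def)
  have "i div t < l" using i(1) by (simp add: less_mult_imp_div_less)
  then have \<sigma>: "\<sigma> (i div t) < m" "\<sigma> (i div t) \<noteq> b" using assms(5,6) by auto
  then have "\<sigma> (i div t) * t + i mod t < m * t" using t_pos by (intro block_less) auto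
  then have "b * t + r = \<sigma> (i div t) * t + i mod t"
    using i(2) assms(1-3) by (simp add: nth_eq_iff_index_eq)
  then have "b = \<sigma> (i div t)" using assms(4) t_pos by (metis block_div mod_less_divisor)
  then show False using \<sigma> by simp
qed

text \<open>Every permutation of the blocks gives another list for the same copy, and the entries at
  the block starts recover the permutation.\<close>

lemma card_emb_ge_fact:
  assumes V: "finite V" and "xs \<in> tuples V (m * t)" "emb forest_par X xs"
  shows "fact m \<le> card {ys \<in> tuples V (m * t). emb forest_par X ys}"
proof -
  define S where "S = {\<sigma>. \<sigma> permutes {..<m}}"
  have xs: "distinct xs" "length xs = m * t" using assms(2) by (auto simp: tuples_def)
  have "inj_on (\<lambda>\<sigma>. rearrange m \<sigma> xs) S"
  proof (rule inj_onI)
    fix \<sigma> \<tau> assume st: "\<sigma> \<in> S" "\<tau> \<in> S" "rearrange m \<sigma> xs = rearrange m \<tau> xs"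
    show "\<sigma> = \<tau>"
    proof
      fix b show "\<sigma> b = \<tau> b"
      proof (cases "b < m")
        case True
        have lt: "\<sigma> b * t < m * t" "\<tau> b * t < m * t" "b * t < m * t"
          using st True t_pos permutes_in_image[of \<sigma> "{..<m}" b] permutes_in_image[of \<tau> "{..<m}" b]
          by (auto simp: S_def)
        have "rearrange m \<sigma> xs ! (b * t) = rearrange m \<tau> xs ! (b * t)" using st by simp
        then have "xs ! (\<sigma> b * t) = xs ! (\<tau> b * t)"
          using lt t_pos by (simp add: rearrange_def del: mult_less_cancel2)
        then show ?thesis using lt xs t_pos by (simp add: nth_eq_iff_index_eq del: mult_less_cancel2)
      next
        case False
        then show ?thesis using st by (simp add: S_def permutes_not_in)
      qed
    qed
  qed
  then have "card S = card ((\<lambda>\<sigma>. rearrange m \<sigma> xs) ` S)" by (simp add: card_image)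
  also have "\<dots> \<le> card {ys \<in> tuples V (m * t). emb forest_par X ys}"
    using rearrange_emb[OF assms(2,3) permutes_inj_on eq_refl[OF permutes_image]] V
    by (intro card_mono) (auto simp: S_def)
  also have "card S = fact m" unfolding S_def by (rule card_permutations) auto
  finally show ?thesis .
qed

text \<open>Markov's inequality at level m!: the number of embeddings is at least m! as soon as it
  is nonzero.\<close>

lemma prob_ex_emb_le:
  assumes V: "finite V" and p: "0 \<le> p" "p \<le> 1"
  shows "measure_pmf.prob (edge_pmf V p) {X. \<exists>xs\<in>tuples V (m * t). emb forest_par X xs} \<le>
    real (card V) ^ (m * t) / fact m * (p ^ (m * t - m) * (1 - p) ^ ((m * t choose 2) - (m * t - m)))"
proof -
  define k where "k = m * t"
  define M where "M = edge_pmf V p"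
  define W where "W = {X. \<exists>xs\<in>tuples V k. emb forest_par X xs}"
  have fin: "finite (set_pmf M)"
    unfolding M_def using V by (intro finite_set_Pi_pmf_bool) simp
  have int: "integrable (measure_pmf M) h" for h :: "('a set \<Rightarrow> bool) \<Rightarrow> real"
    by (rule integrable_measure_pmf_finite) (rule fin)
  have pt: "indicator W X * fact m \<le> (\<Sum>xs\<in>tuples V k. indicator {X. emb forest_par X xs} X :: real)" for X
  proof (cases "X \<in> W")
    case True
    then obtain xs where "xs \<in> tuples V k" "emb forest_par X xs" by (auto simp: W_def)
    then have "fact m \<le> card {ys \<in> tuples V k. emb forest_par X ys}"
      unfolding k_def by (rule card_emb_ge_fact[OF V])
    then have "fact m \<le> real (card {ys \<in> tuples V k. emb forest_par X ys})"
      by (metis of_nat_fact of_nat_le_iff)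
    also have "\<dots> = (\<Sum>xs\<in>tuples V k. indicator {X. emb forest_par X xs} X :: real)"
      using V by (simp add: indicator_def sum.If_cases Int_def)
    finally show ?thesis using True by simp
  qed (auto intro: sum_nonneg)
  have "measure_pmf.prob M W * fact m = measure_pmf.expectation M (\<lambda>X. indicator W X * fact m)" by simp
  also have "\<dots> \<le> measure_pmf.expectation M (\<lambda>X. \<Sum>xs\<in>tuples V k. indicator {X. emb forest_par X xs} X)"
    by (intro integral_mono int pt)
  also have "\<dots> = (\<Sum>xs\<in>tuples V k. measure_pmf.prob M {X. emb forest_par X xs})"
    by (subst Bochner_Integration.integral_sum[OF int]) simp
  also have "\<dots> = (\<Sum>xs\<in>tuples V k. emb_prob forest_par k p)"
    unfolding M_def by (intro sum.cong refl prob_emb V p)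
  also have "\<dots> = card (tuples V k) * emb_prob forest_par k p" by simp
  also have "\<dots> \<le> real (card V ^ k) * emb_prob forest_par k p"
  proof (intro mult_right_mono)
    have "card (tuples V k) \<le> card {xs. set xs \<subseteq> V \<and> length xs = k}"
      using V by (intro card_mono finite_lists_length_eq) (auto simp: tuples_def)
    then show "real (card (tuples V k)) \<le> real (card V ^ k)"
      using V by (simp add: card_lists_length_eq)
  qed (use p in \<open>simp add: emb_prob_def\<close>)
  finally show ?thesis
    using card_nonroots[of m] by (simp add: emb_prob_def M_def W_def k_def field_simps)
qed

end

section \<open>Walks, components and isomorphisms\<close>

lemma adj_commute: "adj G u v = adj G v u"
  by (simp add: adj_def insert_commute)

text \<open>The closure form supplies the inductions behind symmetry, transitivity and invariance of
  closed sets.\<close>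

lemma joined_iff_rtranclp:
  "joined G u v \<longleftrightarrow> u \<in> verts G \<and> (\<lambda>x y. adj G x y \<and> x \<in> verts G \<and> y \<in> verts G)\<^sup>*\<^sup>* u v"
    (is "_ \<longleftrightarrow> _ \<and> ?R\<^sup>*\<^sup>* u v")
proof
  assume "joined G u v"
  then obtain xs where "walk G xs" "hd xs = u" "last xs = v" by (auto simp: joined_def)
  then show "u \<in> verts G \<and> ?R\<^sup>*\<^sup>* u v"
  proof (induction xs arbitrary: u)
    case (Cons x xs)
    show ?case
    proof (cases "xs = []")
      case True
      then show ?thesis using Cons.prems by (auto simp: walk_def)
    next
      case False
      then obtain y ys where xs: "xs = y # ys" by (meson list.exhaust)
      with Cons.prems have "walk G xs" "last xs = v" by (auto simp: walk_def)
      with Cons.IH[of y] xs have "?R\<^sup>*\<^sup>* y v" by auto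
      moreover have "?R x y" using Cons.prems xs by (auto simp: walk_def)
      ultimately show ?thesis using Cons.prems by (auto simp: walk_def intro: converse_rtranclp_into_rtranclp)
    qed
  qed (simp add: walk_def)
next
  assume "u \<in> verts G \<and> ?R\<^sup>*\<^sup>* u v"
  then have u: "u \<in> verts G" and "?R\<^sup>*\<^sup>* u v" by auto
  from this(2) show "joined G u v"
  proof (induction rule: rtranclp_induct)
    case base
    show ?case unfolding joined_def by (rule exI[of _ "[u]"]) (use u in \<open>auto simp: walk_def\<close>)
  next
    case (step y z)
    then obtain xs where "walk G xs" "hd xs = u" "last xs = y" by (auto simp: joined_def)
    then have "walk G (xs @ [z])" "hd (xs @ [z]) = u" "last (xs @ [z]) = z"
      using step by (auto simp: walk_def successively_append_iff)
    then show ?case unfolding joined_def by blast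
  qed
qed

lemma joined_refl: "u \<in> verts G \<Longrightarrow> joined G u u"
  by (simp add: joined_iff_rtranclp)

lemma joined_verts: "joined G u v \<Longrightarrow> u \<in> verts G \<and> v \<in> verts G"
  unfolding joined_iff_rtranclp by (auto elim: rtranclp.cases)

lemma joined_trans: "joined G u v \<Longrightarrow> joined G v w \<Longrightarrow> joined G u w"
  unfolding joined_iff_rtranclp by (auto intro: rtranclp_trans)

lemma joined_sym:
  assumes "joined G u v"
  shows "joined G v u"
proof -
  have "symp (\<lambda>x y. adj G x y \<and> x \<in> verts G \<and> y \<in> verts G)"
    by (auto simp: symp_def adj_commute)
  then show ?thesis
    using assms joined_verts[OF assms] unfolding joined_iff_rtranclp
    by (meson symp_rtranclp sympD)
qed

lemma joined_adj: "adj G u v \<Longrightarrow> u \<in> verts G \<Longrightarrow> v \<in> verts G \<Longrightarrow> joined G u v"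
  unfolding joined_iff_rtranclp by auto

lemma joined_closed:
  assumes "joined G u v" "u \<in> S"
    and "\<And>x y. adj G x y \<Longrightarrow> x \<in> verts G \<Longrightarrow> y \<in> verts G \<Longrightarrow> x \<in> S \<Longrightarrow> y \<in> S"
  shows "v \<in> S"
proof -
  have "(\<lambda>x y. adj G x y \<and> x \<in> verts G \<and> y \<in> verts G)\<^sup>*\<^sup>* u v"
    using assms(1) by (simp add: joined_iff_rtranclp)
  then show ?thesis by (induction rule: rtranclp_induct) (use assms in auto)
qed

text \<open>When a simple walk is extended by z, either it stays simple or z already lies on it, and
  then it is truncated at z.\<close>

lemma joined_imp_distinct_walk:
  assumes "joined G u v"
  shows "\<exists>xs. walk G xs \<and> distinct xs \<and> hd xs = u \<and> last xs = v"
proof -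
  have "u \<in> verts G" "(\<lambda>x y. adj G x y \<and> x \<in> verts G \<and> y \<in> verts G)\<^sup>*\<^sup>* u v"
    using assms by (auto simp: joined_iff_rtranclp)
  from this(2) show ?thesis
  proof (induction rule: rtranclp_induct)
    case base
    show ?case by (rule exI[of _ "[u]"]) (use \<open>u \<in> verts G\<close> in \<open>auto simp: walk_def\<close>)
  next
    case (step y z)
    then obtain xs where xs: "walk G xs" "distinct xs" "hd xs = u" "last xs = y" by blast
    show ?case
    proof (cases "z \<in> set xs")
      case True
      then obtain as bs where "xs = as @ z # bs" by (meson split_list)
      then have "xs = (as @ [z]) @ bs" by simp
      with xs have "walk G (as @ [z])" "distinct (as @ [z])" "hd (as @ [z]) = u"
        unfolding walk_def by (auto simp: successively_append_iff hd_append split: if_splits)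
      then show ?thesis by (metis last_snoc)
    next
      case False
      then have "walk G (xs @ [z])" "distinct (xs @ [z])" "hd (xs @ [z]) = u"
        using step xs by (auto simp: walk_def successively_append_iff)
      then show ?thesis by (metis last_snoc)
    qed
  qed
qed

section \<open>Induced subgraphs and isomorphisms as vertex enumerations\<close>

lemma adj_induced: "u \<in> S \<Longrightarrow> v \<in> S \<Longrightarrow> adj (induced G S) u v \<longleftrightarrow> adj G u v"
  by (auto simp: adj_def induced_def)

lemma adj_induced_imp: "adj (induced G S) u v \<Longrightarrow> adj G u v \<and> u \<in> S \<and> v \<in> S"
  by (auto simp: adj_def induced_def)

lemma verts_induced [simp]: "verts (induced G S) = verts G \<inter> S"
  by (simp add: induced_def)

lemma graph_iso_nthI:
  assumes "distinct us" "set us = verts G" "distinct vs" "set vs = verts H" "length us = length vs"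
    and "\<And>i j. i < length vs \<Longrightarrow> j < length vs \<Longrightarrow> adj G (us ! i) (us ! j) \<longleftrightarrow> adj H (vs ! i) (vs ! j)"
  shows "graph_iso G H"
proof -
  have bu: "bij_betw ((!) us) {..<length vs} (verts G)"
    using bij_betw_nth[of us "{..<length vs}" "verts G"] assms by auto
  have bv: "bij_betw ((!) vs) {..<length vs} (verts H)"
    using bij_betw_nth[of vs "{..<length vs}" "verts H"] assms by auto
  define f where "f = (!) vs \<circ> the_inv_into {..<length vs} ((!) us)"
  have f: "f (us ! i) = vs ! i" if "i < length vs" for i
    using the_inv_into_f_f[of "(!) us" "{..<length vs}" i] bu that by (auto simp: f_def bij_betw_def)
  have "bij_betw f (verts G) (verts H)"
    unfolding f_def by (rule bij_betw_trans[OF bij_betw_the_inv_into[OF bu] bv])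
  moreover have "adj G u v \<longleftrightarrow> adj H (f u) (f v)" if uv: "u \<in> verts G" "v \<in> verts G" for u v
  proof -
    obtain i j where "u = us ! i" "v = us ! j" "i < length vs" "j < length vs"
      using uv assms(2,5) by (metis in_set_conv_nth)
    then show ?thesis using f assms(6) by simp
  qed
  ultimately show ?thesis by (auto simp: graph_iso_def)
qed

lemma graph_iso_nthE:
  assumes "graph_iso G H" "distinct vs" "set vs = verts H"
  obtains us where "distinct us" "set us = verts G" "length us = length vs"
    "\<And>i j. i < length vs \<Longrightarrow> j < length vs \<Longrightarrow> adj G (us ! i) (us ! j) \<longleftrightarrow> adj H (vs ! i) (vs ! j)"
proof -
  obtain f where f: "bij_betw f (verts G) (verts H)"
    "\<And>u v. u \<in> verts G \<Longrightarrow> v \<in> verts G \<Longrightarrow> adj G u v \<longleftrightarrow> adj H (f u) (f v)"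
    using assms(1) by (auto simp: graph_iso_def)
  define g where "g = the_inv_into (verts G) f"
  have g: "bij_betw g (verts H) (verts G)" unfolding g_def by (rule bij_betw_the_inv_into[OF f(1)])
  have fg: "f (g v) = v" if "v \<in> verts H" for v
    using that f(1) f_the_inv_into_f[of f "verts G" v] by (auto simp: g_def bij_betw_def)
  show ?thesis
  proof (rule that[of "map g vs"])
    show "distinct (map g vs)" using assms g by (simp add: distinct_map bij_betw_def)
    show "set (map g vs) = verts G" using assms g by (simp add: bij_betw_def)
    fix i j assume ij: "i < length vs" "j < length vs"
    then have "vs ! i \<in> verts H" "vs ! j \<in> verts H" using assms(3) nth_mem by blast+
    then show "adj G (map g vs ! i) (map g vs ! j) \<longleftrightarrow> adj H (vs ! i) (vs ! j)"
      using f(2)[of "g (vs ! i)" "g (vs ! j)"] ij fg bij_betwE[OF g] by simp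
  qed simp
qed

section \<open>Tree orderings and induced matchings\<close>

text \<open>Connectedness gives an edge leaving \<open>set vs\<close>, say to v. If v had two
  neighbours in \<open>vs\<close>, their chains of parents would join them to the first vertex
  inside \<open>set vs\<close>; a simple path between them within \<open>set vs\<close> would then
  close to a cycle through v.\<close>

lemma is_tree_ordering_extend:
  assumes T: "is_tree T" and vs: "distinct vs" "set vs \<subset> verts T"
    and ord: "tree_order (length vs) par"
    and adj: "\<And>i j. i < j \<Longrightarrow> j < length vs \<Longrightarrow> adj T (vs ! i) (vs ! j) \<longleftrightarrow> par j = i"
  shows "\<exists>v i. v \<in> verts T - set vs \<and> i < length vs \<and>
    (\<forall>j<length vs. adj T (vs ! j) v \<longleftrightarrow> j = i)"
proof -
  interpret tree_order "length vs" par by (rule ord)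
  have conn: "joined T u v" if "u \<in> verts T" "v \<in> verts T" for u v
    using T that by (auto simp: is_tree_def connected_graph_def)
  obtain w where w: "w \<in> verts T" "w \<notin> set vs" using vs by blast
  have v0: "vs ! 0 \<in> set vs" using t_pos by simp
  have "\<exists>x y. adj T x y \<and> x \<in> set vs \<and> y \<in> verts T - set vs"
  proof (rule ccontr)
    assume "\<not> ?thesis"
    then have "w \<in> set vs"
      using joined_closed[OF conn v0, of w] v0 vs w by blast
    then show False using w by simp
  qed
  then obtain i v where v: "v \<in> verts T - set vs" and i: "i < length vs" "adj T (vs ! i) v"
    by (auto simp: in_set_conv_nth)
  have "j = i" if j: "j < length vs" "adj T (vs ! j) v" for j
  proof (rule ccontr)
    assume "j \<noteq> i"
    define H where "H = induced T (set vs)"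
    have VH: "verts H = set vs" using vs by (auto simp: H_def)
    have root: "joined H (vs ! l) (vs ! 0)" if "l < length vs" for l
      using that
    proof (induction l rule: less_induct)
      case (less l)
      show ?case
      proof (cases "l = 0")
        case False
        then have p: "par l < l" using par_less less.prems by simp
        then have "adj H (vs ! par l) (vs ! l)"
          using adj[of "par l" l] less.prems by (simp add: H_def adj_induced)
        then have "joined H (vs ! l) (vs ! par l)"
          using less.prems p by (intro joined_adj) (auto simp: adj_commute VH)
        with less.IH[OF p] less.prems p show ?thesis by (auto intro: joined_trans)
      qed (use less.prems in \<open>auto intro!: joined_refl simp: VH\<close>)
    qed
    have "joined H (vs ! i) (vs ! j)" using root i j by (meson joined_trans joined_sym)
    from joined_imp_distinct_walk[OF this]
    obtain xs where xs: "walk H xs" "distinct xs" "hd xs = vs ! i" "last xs = vs ! j"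
      by (elim exE conjE)
    have sub: "set xs \<subseteq> set vs" "xs \<noteq> []" using xs(1) by (auto simp: walk_def VH)
    have "successively (adj T) xs"
      using xs(1) unfolding walk_def H_def by (metis (mono_tags, lifting) adj_induced_imp successively_mono)
    then have "walk T (v # xs)"
      using sub vs v i xs(3) by (cases xs) (auto simp: walk_def adj_commute)
    moreover have "distinct (v # xs)" using xs(2) sub v by auto
    moreover have "length (v # xs) \<ge> 3"
    proof -
      have "hd xs \<noteq> last xs" using xs \<open>j \<noteq> i\<close> i j vs(1) by (simp add: nth_eq_iff_index_eq)
      then show ?thesis using sub(2) by (cases xs rule: remdups_adj.cases) auto
    qed
    moreover have "adj T (last (v # xs)) (hd (v # xs))" using xs sub j by simp
    ultimately have "graph_cycle T (v # xs)" unfolding graph_cycle_def by blast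
    then show False using T by (auto simp: is_tree_def)
  qed
  then show ?thesis using v i by blast
qed

lemma is_tree_ordering:
  assumes T: "is_tree T"
  shows "\<exists>vs par. distinct vs \<and> set vs = verts T \<and> tree_order (length vs) par \<and>
    (\<forall>j<length vs. \<forall>i<j. adj T (vs ! i) (vs ! j) \<longleftrightarrow> par j = i)"
proof -
  have fin: "finite (verts T)" and ne: "verts T \<noteq> {}"
    using T by (auto simp: is_tree_def connected_graph_def)
  have "\<exists>vs par. length vs = s \<and> distinct vs \<and> set vs \<subseteq> verts T \<and> tree_order s par \<and>
    (\<forall>j<s. \<forall>i<j. adj T (vs ! i) (vs ! j) \<longleftrightarrow> par j = i)" if "1 \<le> s" "s \<le> card (verts T)" for s
    using that
  proof (induction s rule: dec_induct)
    case base
    obtain v where "v \<in> verts T" using ne by blast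
    then show ?case
      by (intro exI[of _ "[v]"] exI[of _ "\<lambda>_. 0"]) (auto simp: tree_order_def)
  next
    case (step s)
    then obtain vs par where IH: "length vs = s" "distinct vs" "set vs \<subseteq> verts T" "tree_order s par"
      "\<And>j i. j < s \<Longrightarrow> i < j \<Longrightarrow> adj T (vs ! i) (vs ! j) \<longleftrightarrow> par j = i" by auto
    have "set vs \<noteq> verts T" using IH step.prems distinct_card[of vs] by auto
    then obtain v i where v: "v \<in> verts T - set vs" "i < s" "\<And>j. j < s \<Longrightarrow> adj T (vs ! j) v \<longleftrightarrow> j = i"
      using is_tree_ordering_extend[OF T IH(2), of par] IH by blast
    show ?case
    proof (intro exI[of _ "vs @ [v]"] exI[of _ "par(s := i)"] conjI allI impI)
      show "tree_order (Suc s) (par(s := i))"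
        using IH(4) v(2) by (auto simp: tree_order_def less_Suc_eq)
      fix j k assume jk: "j < Suc s" "k < j"
      show "adj T ((vs @ [v]) ! k) ((vs @ [v]) ! j) \<longleftrightarrow> (par(s := i)) j = k"
        using jk IH(1,5) v(3) by (cases "j = s") (auto simp: nth_append)
    qed (use IH v in auto)
  qed
  from this[of "card (verts T)"] fin ne obtain vs par where
    h: "length vs = card (verts T)" "distinct vs" "set vs \<subseteq> verts T" "tree_order (card (verts T)) par"
    "\<forall>j<card (verts T). \<forall>i<j. adj T (vs ! i) (vs ! j) \<longleftrightarrow> par j = i"
    by (auto simp: Suc_le_eq card_gt_0_iff)
  then have "set vs = verts T" using fin by (metis card_subset_eq distinct_card)
  with h show ?thesis by metis
qed

text \<open>On \<open>{1..n}\<close> this is the map by which \<open>gnp\<close> arises from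
  independent edge indicators; all estimates are made on that product space.\<close>

definition graph_of :: "'a set \<Rightarrow> ('a set \<Rightarrow> bool) \<Rightarrow> 'a sgraph" where
  "graph_of V X = (V, {e \<in> vpairs V. X e})"

lemma verts_graph_of [simp]: "verts (graph_of V X) = V"
  by (simp add: graph_of_def)

lemma adj_graph_of: "u \<in> V \<Longrightarrow> v \<in> V \<Longrightarrow> adj (graph_of V X) u v \<longleftrightarrow> u \<noteq> v \<and> X {u, v}"
  by (auto simp: adj_def graph_of_def vpairs_def)

locale tree_rep = tree_order t par for t :: nat and par :: "nat \<Rightarrow> nat" +
  fixes T :: "'b sgraph" and vs :: "'b list"
  assumes simple: "simple_graph T"
    and vs: "distinct vs" "set vs = verts T" "length vs = t"
    and adj_vs: "\<And>i j. i < j \<Longrightarrow> j < t \<Longrightarrow> adj T (vs ! i) (vs ! j) \<longleftrightarrow> par j = i"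
begin

lemma adj_vs_sym:
  assumes "i < t" "j < t"
  shows "adj T (vs ! i) (vs ! j) \<longleftrightarrow> i \<noteq> j \<and> (par i = j \<or> par j = i)"
proof -
  have nadj: "\<not> adj T u u" for u using simple by (auto simp: adj_def simple_graph_def vpairs_def)
  have le: "par l \<le> l" if "l < t" for l using that par_0 par_less[of l] by (cases "l = 0") auto
  consider "i < j" | "j < i" | "i = j" by linarith
  then show ?thesis
    using adj_vs[of i j] adj_vs[of j i] assms nadj le[of i] le[of j] adj_commute[of T]
    by cases auto
qed

text \<open>The components are exactly the blocks: chains of parents join each entry to the first
  one of its block, and no edge leaves a block because \<open>forest_par\<close> preserves the
  quotient by t.\<close>

lemma emb_imp_induced_matching:
  assumes xs: "xs \<in> tuples V (m * t)" and emb: "emb forest_par X xs"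
  shows "induced_matching T (graph_of V X) (set xs)"
proof -
  have d: "distinct xs" "length xs = m * t" "set xs \<subseteq> V" using xs by (auto simp: tuples_def)
  define H where "H = induced (graph_of V X) (set xs)"
  have VH: "verts H = set xs" using d by (auto simp: H_def)
  have adjH: "adj H (xs ! i) (xs ! j) \<longleftrightarrow> i \<noteq> j \<and> (forest_par i = j \<or> forest_par j = i)"
    if ij: "i < m * t" "j < m * t" for i j
  proof -
    have "xs ! i \<in> set xs" "xs ! j \<in> set xs" using ij d by auto
    then have "adj H (xs ! i) (xs ! j) \<longleftrightarrow> xs ! i \<noteq> xs ! j \<and> X {xs ! i, xs ! j}"
      using d(3) by (simp add: H_def adj_induced adj_graph_of subset_iff)
    then show ?thesis using emb ij d by (simp add: emb_iff_sym nth_eq_iff_index_eq) blast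
  qed
  have "graph_iso C T" if C: "C \<in> components H" for C
  proof -
    obtain u where u: "u \<in> set xs" "C = induced H {v. joined H u v}"
      using C by (auto simp: components_def VH)
    then obtain i where i: "i < m * t" "u = xs ! i" using d by (auto simp: in_set_conv_nth)
    define b where "b = i div t"
    have b: "b < m" using i by (simp add: b_def less_mult_imp_div_less)
    define us where "us = map (\<lambda>r. xs ! (b * t + r)) [0..<t]"
    have lt: "b * t + r < m * t" if "r < t" for r using that b by (rule block_less)
    have us: "length us = t" "\<And>r. r < t \<Longrightarrow> us ! r = xs ! (b * t + r)" by (auto simp: us_def)
    have sub: "set us \<subseteq> set xs" using lt d by (auto simp: us_def)
    have "xs ! j \<in> set us" if "j div t = b" for j
    proof -
      have "xs ! j = us ! (j mod t)" using us(2)[of "j mod t"] t_pos that by auto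
      then show ?thesis using us(1) t_pos by simp
    qed
    note in_us = this
    have root: "joined H (us ! r) (us ! 0)" if "r < t" for r
      using that
    proof (induction r rule: less_induct)
      case (less r)
      show ?case
      proof (cases "r = 0")
        case False
        then have p: "par r < r" using par_less less.prems by simp
        then have "adj H (us ! r) (us ! par r)"
          using less.prems lt us forest_par_block[of r b] by (simp add: adjH)
        then have "joined H (us ! r) (us ! par r)"
          using less.prems p sub us(1) by (intro joined_adj) (auto simp: VH)
        with less.IH[OF p] less.prems p show ?thesis by (auto intro: joined_trans)
      next
        case True
        have "us ! 0 \<in> set xs" using sub us(1) t_pos nth_mem by blast
        then show ?thesis using True by (simp add: joined_refl VH)
      qed
    qed
    have "u \<in> set us" using in_us[of i] by (simp add: i b_def)
    have comp: "{v. joined H u v} = set us"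
    proof (intro equalityI subsetI)
      fix v assume "v \<in> {v. joined H u v}"
      then have "joined H u v" by simp
      then show "v \<in> set us"
      proof (rule joined_closed[OF _ \<open>u \<in> set us\<close>])
        fix x y assume "adj H x y" "x \<in> verts H" "y \<in> verts H" "x \<in> set us"
        then obtain r j where r: "r < t" "x = xs ! (b * t + r)" and j: "j < m * t" "y = xs ! j"
          using us d by (auto simp: in_set_conv_nth VH)
        then have "forest_par (b * t + r) = j \<or> forest_par j = b * t + r"
          using \<open>adj H x y\<close> adjH[OF lt[OF r(1)] j(1)] by simp
        then have "j div t = b"
          using forest_par_div[of j] forest_par_div[of "b * t + r"] block_div[OF r(1), of b] by metis
        then show "y \<in> set us" using in_us j by simp
      qed
    next
      fix v assume "v \<in> set us"
      then show "v \<in> {v. joined H u v}"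
        using root \<open>u \<in> set us\<close> us(1) by (auto simp: in_set_conv_nth intro: joined_trans joined_sym)
    qed
    show "graph_iso C T"
    proof (rule graph_iso_nthI[of us _ vs])
      show "distinct us"
        unfolding distinct_conv_nth us(1) using us(2) lt d by (simp add: nth_eq_iff_index_eq)
      show "set us = verts C" using u sub by (auto simp: comp VH)
      fix r r' assume "r < length vs" "r' < length vs"
      then have r: "r < t" "r' < t" using vs by auto
      have "adj C (us ! r) (us ! r') \<longleftrightarrow> adj H (us ! r) (us ! r')"
        using r us(1) u(2) comp by (simp add: adj_induced)
      also have "\<dots> \<longleftrightarrow> adj T (vs ! r) (vs ! r')"
        using r lt by (simp add: us(2) adjH adj_vs_sym forest_par_block)
      finally show "adj C (us ! r) (us ! r') \<longleftrightarrow> adj T (vs ! r) (vs ! r')" .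
    qed (use vs us in auto)
  qed
  then show ?thesis using d by (simp add: induced_matching_def matching_def H_def)
qed

end

section \<open>The partition of a graph into components\<close>

lemma components_disjoint:
  assumes "C \<in> components H" "C' \<in> components H" "w \<in> verts C" "w \<in> verts C'"
  shows "C = C'"
proof -
  obtain u u' where u: "C = induced H {v. joined H u v}" "C' = induced H {v. joined H u' v}"
    using assms(1,2) by (auto simp: components_def)
  then have "joined H u w" "joined H u' w" using assms by auto
  then have "joined H u u'" "joined H u' u" by (metis joined_trans joined_sym)+
  then have "{v. joined H u v} = {v. joined H u' v}" by (auto intro: joined_trans)
  then show ?thesis using u by simp
qed

lemma adj_imp_same_component:
  assumes "C \<in> components H" "w \<in> verts C" "x \<in> verts H" "adj H w x"
  shows "x \<in> verts C"
proof -
  obtain u where u: "C = induced H {v. joined H u v}" using assms(1) by (auto simp: components_def)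
  have "joined H u w" "w \<in> verts H" using assms(2) u by auto
  moreover have "joined H w x" using assms calculation by (intro joined_adj)
  ultimately show ?thesis using u assms(3) by (auto intro: joined_trans)
qed

lemma adj_component:
  assumes "C \<in> components H" "w \<in> verts C" "x \<in> verts C"
  shows "adj C w x \<longleftrightarrow> adj H w x"
proof -
  obtain u where "C = induced H {v. joined H u v}" using assms(1) by (auto simp: components_def)
  then show ?thesis using assms(2,3) by (auto simp: adj_induced)
qed

lemma UN_components: "(\<Union>C\<in>components H. verts C) = verts H"
proof (intro equalityI subsetI)
  fix v assume "v \<in> verts H"
  then have "induced H {w. joined H v w} \<in> components H" "v \<in> verts (induced H {w. joined H v w})"
    by (auto simp: components_def joined_refl)
  then show "v \<in> (\<Union>C\<in>components H. verts C)" by blast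
next
  fix v assume "v \<in> (\<Union>C\<in>components H. verts C)"
  then obtain u where "v \<in> verts (induced H {w. joined H u w})" unfolding components_def by blast
  then show "v \<in> verts H" by simp
qed

context tree_rep
begin

text \<open>The components are listed one after another, each in the order that its isomorphism with
  T carries over from \<open>vs\<close>. Inside a block adjacency is then that of T, and distinct
  components are not adjacent.\<close>

lemma induced_matching_imp_emb:
  assumes V: "finite V" and S: "induced_matching T (graph_of V X) S"
  shows "\<exists>m. \<exists>xs\<in>tuples V (m * t). emb forest_par X xs \<and> set xs = S"
proof -
  define H where "H = induced (graph_of V X) S"
  have SV: "S \<subseteq> V" using S by (simp add: induced_matching_def)
  have VH: "verts H = S" using SV by (auto simp: H_def)
  have "finite S" using SV V finite_subset by blast
  then have "finite (components H)" by (auto simp: components_def VH)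
  then obtain Cs where Cs: "set Cs = components H" "distinct Cs" using finite_distinct_list by blast
  define m where "m = length Cs"
  have iso: "graph_iso C T" if "C \<in> components H" for C
    using S that by (simp add: induced_matching_def matching_def H_def)
  have "\<exists>us. distinct us \<and> set us = verts C \<and> length us = t \<and>
      (\<forall>i<t. \<forall>j<t. adj C (us ! i) (us ! j) \<longleftrightarrow> adj T (vs ! i) (vs ! j))" if "C \<in> components H" for C
    using graph_iso_nthE[OF iso[OF that] vs(1,2)] unfolding vs(3) by metis
  then obtain us where us: "\<And>C. C \<in> components H \<Longrightarrow> distinct (us C)"
    "\<And>C. C \<in> components H \<Longrightarrow> set (us C) = verts C" "\<And>C. C \<in> components H \<Longrightarrow> length (us C) = t"
    "\<And>C i j. C \<in> components H \<Longrightarrow> i < t \<Longrightarrow> j < t \<Longrightarrow>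
      adj C (us C ! i) (us C ! j) \<longleftrightarrow> adj T (vs ! i) (vs ! j)"
    by metis
  define D where "D = (\<lambda>i. Cs ! (i div t))"
  define xs where "xs = map (\<lambda>i. us (D i) ! (i mod t)) [0..<m * t]"
  have xs: "length xs = m * t" "\<And>i. i < m * t \<Longrightarrow> xs ! i = us (D i) ! (i mod t)"
    by (auto simp: xs_def)
  have D: "D i \<in> components H" if "i < m * t" for i
    using that Cs(1) by (auto simp: D_def m_def less_mult_imp_div_less intro!: nth_mem)
  have D_eq: "D i = D j \<longleftrightarrow> i div t = j div t" if "i < m * t" "j < m * t" for i j
    using that Cs(2) by (auto simp: D_def m_def less_mult_imp_div_less nth_eq_iff_index_eq)
  have xs_in: "xs ! i \<in> verts (D i)" if "i < m * t" for i
    using us(2,3)[OF D[OF that]] xs(2)[OF that] t_pos by (metis mod_less_divisor nth_mem)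
  have vD: "verts (D i) \<subseteq> S" if "i < m * t" for i
    using D[OF that] UN_components[of H] VH by blast
  have dxs: "distinct xs"
    unfolding distinct_conv_nth xs(1)
  proof (intro allI impI notI)
    fix i j assume ij: "i < m * t" "j < m * t" "i \<noteq> j" "xs ! i = xs ! j"
    then have DD: "D i = D j" using components_disjoint[OF D D] xs_in by metis
    then have "i mod t = j mod t"
      using ij xs(2) us(1,3)[OF D[OF ij(1)]] t_pos by (metis mod_less_divisor nth_eq_iff_index_eq)
    moreover have "i div t = j div t" using DD D_eq ij by simp
    ultimately show False using ij(3) by (metis div_mult_mod_eq)
  qed
  have set_xs: "set xs = S"
  proof (intro equalityI subsetI)
    fix v assume "v \<in> set xs"
    then obtain i where "i < m * t" "v = xs ! i" using xs(1) by (metis in_set_conv_nth)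
    then show "v \<in> S" using xs_in vD by blast
  next
    fix v assume "v \<in> S"
    then obtain C where C: "C \<in> components H" "v \<in> verts C" using UN_components[of H] VH by blast
    then obtain b r where b: "b < m" "C = Cs ! b" and r: "r < t" "v = us C ! r"
      using us(2,3)[OF C(1)] Cs(1) by (metis in_set_conv_nth m_def)
    then have "xs ! (b * t + r) = v" using block_less[OF r(1) b(1)] by (simp add: xs(2) D_def)
    then show "v \<in> set xs" using block_less[OF r(1) b(1)] xs(1) by (metis nth_mem)
  qed
  have "X {xs ! i, xs ! j} \<longleftrightarrow> forest_par i = j \<or> forest_par j = i"
    if ij: "i < m * t" "j < m * t" "i \<noteq> j" for i j
  proof -
    have S': "xs ! i \<in> S" "xs ! j \<in> S" using ij xs_in vD by blast+
    have ne: "xs ! i \<noteq> xs ! j" using dxs ij xs(1) by (simp add: nth_eq_iff_index_eq)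
    have "X {xs ! i, xs ! j} \<longleftrightarrow> adj H (xs ! i) (xs ! j)"
      using S' SV ne by (simp add: H_def adj_induced adj_graph_of subset_iff)
    also have "\<dots> \<longleftrightarrow> forest_par i = j \<or> forest_par j = i"
    proof (cases "i div t = j div t")
      case True
      then have DD: "D i = D j" using D_eq ij by simp
      have mods: "i mod t < t" "j mod t < t" using t_pos by auto
      have "i mod t \<noteq> j mod t" using True ij(3) by (metis div_mult_mod_eq)
      have "adj H (xs ! i) (xs ! j) \<longleftrightarrow> adj (D i) (xs ! i) (xs ! j)"
        using adj_component[OF D[OF ij(1)] xs_in[OF ij(1)], of "xs ! j"] xs_in[OF ij(2)] DD by simp
      also have "\<dots> \<longleftrightarrow> adj T (vs ! (i mod t)) (vs ! (j mod t))"
        using us(4)[OF D[OF ij(1)] mods] xs(2) ij DD by simp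
      also have "\<dots> \<longleftrightarrow> par (i mod t) = j mod t \<or> par (j mod t) = i mod t"
        using adj_vs_sym[OF mods] \<open>i mod t \<noteq> j mod t\<close> by simp
      also have "\<dots> \<longleftrightarrow> forest_par i = j \<or> forest_par j = i"
        using True by (metis div_mult_mod_eq forest_par_div forest_par_mod)
      finally show ?thesis .
    next
      case False
      have "\<not> adj H (xs ! i) (xs ! j)"
      proof
        assume "adj H (xs ! i) (xs ! j)"
        then have "xs ! j \<in> verts (D i)"
          using adj_imp_same_component[OF D[OF ij(1)] xs_in[OF ij(1)]] S' VH by blast
        then have "D i = D j" using components_disjoint[OF D D] xs_in ij by metis
        then show False using False D_eq ij by simp
      qed
      moreover have "\<not> (forest_par i = j \<or> forest_par j = i)" using False forest_par_div by metis
      ultimately show ?thesis by simp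
    qed
    finally show ?thesis .
  qed
  then have "emb forest_par X xs" unfolding emb_iff_sym[OF dxs] xs(1) by blast
  moreover have "xs \<in> tuples V (m * t)" using dxs xs(1) set_xs SV by (simp add: tuples_def)
  ultimately show ?thesis using set_xs by blast
qed

section \<open>The maximum: attainment and dependence on one vertex\<close>

lemma finite_card_induced_matchings:
  assumes "finite V"
  shows "finite {card S | S. induced_matching T (graph_of V X) S}"
  by (rule finite_subset[of _ "{..card V}"]) (use assms in \<open>auto simp: induced_matching_def card_mono\<close>)

lemma le_max_induced_matching:
  assumes V: "finite V" and "xs \<in> tuples V (m * t)" "emb forest_par X xs"
  shows "m * t \<le> max_induced_matching T (graph_of V X)"
  unfolding max_induced_matching_def
proof (rule Max_ge[OF finite_card_induced_matchings[OF V]])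
  show "m * t \<in> {card S | S. induced_matching T (graph_of V X) S}"
    using emb_imp_induced_matching[OF assms(2,3)] assms(2)
    by (auto simp: tuples_def distinct_card intro!: exI[of _ "set xs"])
qed

lemma max_induced_matching_attained:
  assumes V: "finite V"
  shows "\<exists>m. \<exists>xs\<in>tuples V (m * t). emb forest_par X xs \<and> max_induced_matching T (graph_of V X) = m * t"
proof -
  \<comment> \<open>The empty matching ensures that \<open>Max\<close> is taken over a nonempty
    set.\<close>
  have "[] \<in> tuples V (0 * t)" "emb forest_par X []" by (auto simp: tuples_def emb_iff_sym)
  then have "induced_matching T (graph_of V X) {}" using emb_imp_induced_matching by fastforce
  then have "{card S | S. induced_matching T (graph_of V X) S} \<noteq> {}" by blast
  then have "max_induced_matching T (graph_of V X) \<in> {card S | S. induced_matching T (graph_of V X) S}"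
    unfolding max_induced_matching_def using Max_in finite_card_induced_matchings[OF V] by blast
  then obtain S where S: "max_induced_matching T (graph_of V X) = card S"
    "induced_matching T (graph_of V X) S" by blast
  obtain m xs where xs: "xs \<in> tuples V (m * t)" "emb forest_par X xs" "set xs = S"
    using induced_matching_imp_emb[OF V S(2)] by blast
  then have "card S = m * t" using distinct_card[of xs] by (auto simp: tuples_def)
  then show ?thesis using xs S(1) by auto
qed

text \<open>A matching that avoids v is the same for X and Y. Otherwise v lies in a single block of
  an optimal list, and deleting that block costs t vertices.\<close>

lemma max_induced_matching_change_at_vertex:
  assumes V: "finite V" and XY: "\<And>e. v \<notin> e \<Longrightarrow> X e = Y e"
  shows "max_induced_matching T (graph_of V X) \<le> max_induced_matching T (graph_of V Y) + t"
proof -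
  obtain m xs where xs: "xs \<in> tuples V (m * t)" "emb forest_par X xs"
    and max: "max_induced_matching T (graph_of V X) = m * t"
    using max_induced_matching_attained[OF V] by blast
  have transfer: "emb forest_par Y zs" if "emb forest_par X zs" "v \<notin> set zs" for zs
    using that XY by (auto simp: emb_def vpairs_def)
  show ?thesis
  proof (cases "v \<in> set xs")
    case False
    then have "m * t \<le> max_induced_matching T (graph_of V Y)"
      using le_max_induced_matching[OF V xs(1)] transfer[OF xs(2)] by blast
    then show ?thesis using max by simp
  next
    case True
    have d: "distinct xs" "length xs = m * t" using xs by (auto simp: tuples_def)
    obtain i where i: "i < m * t" "v = xs ! i" using True d by (auto simp: in_set_conv_nth)
    define b where "b = i div t"
    have b: "b < m" using i by (simp add: b_def less_mult_imp_div_less)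
    \<comment> \<open>Enumerates all block numbers except b.\<close>
    define \<sigma> where "\<sigma> = (\<lambda>c. if c < b then c else Suc c)"
    have \<sigma>: "inj_on \<sigma> {..<m - 1}" "\<sigma> ` {..<m - 1} \<subseteq> {..<m}" "b \<notin> \<sigma> ` {..<m - 1}"
      using b by (auto simp: \<sigma>_def inj_on_def split: if_splits)
    have "xs ! (b * t + i mod t) \<notin> set (rearrange (m - 1) \<sigma> xs)"
      by (rule rearrange_avoids_block[OF d _ _ \<sigma>(3,2)]) (use i t_pos in \<open>auto simp: b_def\<close>)
    then have "emb forest_par Y (rearrange (m - 1) \<sigma> xs)"
      using rearrange_emb(2)[OF xs \<sigma>(1,2)] transfer by (simp add: b_def i)
    then have "(m - 1) * t \<le> max_induced_matching T (graph_of V Y)"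
      using le_max_induced_matching[OF V rearrange_emb(1)[OF xs \<sigma>(1,2)]] by blast
    moreover have "m * t = (m - 1) * t + t" using b by (cases m) auto
    ultimately show ?thesis using max by simp
  qed
qed

end

section \<open>Probability bounds for the maximum induced matching\<close>

text \<open>Grouping pairs by their larger endpoint yields n independent groups, each consisting of
  pairs through one vertex. The concentration exponent thus has n in the denominator and not the
  number of pairs.\<close>

lemma UN_vpairs_by_Max: "(\<Union>i<n. {e \<in> vpairs {1..n}. Max e = Suc i}) = vpairs {1..n}"
proof (intro equalityI subsetI)
  fix e assume e: "e \<in> vpairs {1..n}"
  then have "e \<noteq> {}" "finite e" "e \<subseteq> {1..n}" by (auto simp: vpairs_def intro: card_ge_0_finite)
  then have "Max e \<in> {1..n}" using Max_in by blast
  then have "Max e = Suc (Max e - 1)" "Max e - 1 < n" by auto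
  then show "e \<in> (\<Union>i<n. {e \<in> vpairs {1..n}. Max e = Suc i})" using e by blast
qed auto

lemma gnp_eq: "gnp n p = map_pmf (graph_of {1..n}) (edge_pmf {1..n} p)"
  unfolding gnp_def graph_of_def by simp

lemma exp_ge_power_div_fact: "0 \<le> x \<Longrightarrow> x ^ n / fact n \<le> exp (x :: real)"
  using sum_le_suminf[OF summable_exp[of x], of "{n}"] by (simp add: exp_def divide_inverse mult.commute)

lemma binomial_le_exp_power:
  assumes "0 < l"
  shows "real (k choose l) \<le> (exp 1 * real k / real l) ^ l"
proof -
  have "real (k choose l) * fact l \<le> real k ^ l"
    using binomial_fact_pow[of k l] by (metis of_nat_fact of_nat_le_iff of_nat_mult of_nat_power)
  then have "real (k choose l) \<le> real k ^ l / fact l" by (simp add: field_simps)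
  also have "\<dots> = (real k / real l) ^ l * (real l ^ l / fact l)" using assms by (simp add: power_divide)
  also have "\<dots> \<le> (real k / real l) ^ l * exp (real l)"
    by (intro mult_left_mono exp_ge_power_div_fact) auto
  also have "\<dots> = (exp 1 * real k / real l) ^ l"
    by (simp add: power_divide power_mult_distrib flip: exp_of_nat_mult)
  finally show ?thesis .
qed

context tree_rep
begin

lemma two_tails_max_induced_matching:
  fixes a b :: real and n :: nat
  assumes "0 < n" "b \<le> a"
  defines "Y \<equiv> \<lambda>X. real (max_induced_matching T (graph_of {1..n} X))"
  shows "measure_pmf.prob (edge_pmf {1..n} p) {X. t * a \<le> Y X} *
    measure_pmf.prob (edge_pmf {1..n} p) {X. Y X \<le> t * b} \<le> exp (- (a - b)\<^sup>2 / (4 * n))"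
proof -
  define B where "B = (\<lambda>i. {e \<in> vpairs {1..n}. Max e = Suc i})"
  have UB: "(\<Union>i<n. B i) = vpairs {1..n}" unfolding B_def by (rule UN_vpairs_by_Max)
  have half: "Y x \<le> Y y + t" if "\<And>e. e \<notin> B i \<Longrightarrow> x e = y e" for i x y
  proof -
    have "x e = y e" if "Suc i \<notin> e" for e
    proof (rule \<open>\<And>e. e \<notin> B i \<Longrightarrow> x e = y e\<close>)
      show "e \<notin> B i"
      proof
        assume "e \<in> B i"
        then have "e \<noteq> {}" "finite e" "Max e = Suc i"
          by (auto simp: B_def vpairs_def intro: card_ge_0_finite)
        then show False using that Max_in by metis
      qed
    qed
    then have "max_induced_matching T (graph_of {1..n} x) \<le> max_induced_matching T (graph_of {1..n} y) + t"
      by (intro max_induced_matching_change_at_vertex) auto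
    then show ?thesis unfolding Y_def by linarith
  qed
  \<comment> \<open>Division by t scales the effect of one group down to 1.\<close>
  have "measure_pmf.prob (edge_pmf {1..n} p) {X. a \<le> Y X / t} *
      measure_pmf.prob (edge_pmf {1..n} p) {X. Y X / t \<le> b} \<le> exp (- (a - b)\<^sup>2 / (4 * n))"
    unfolding UB[symmetric]
  proof (rule Pi_pmf_two_tails_bounded_differences[OF _ _ _ assms(1,2)])
    fix i and x y :: "nat set \<Rightarrow> bool"
    assume xy: "\<And>e. e \<notin> B i \<Longrightarrow> x e = y e"
    have "Y x \<le> Y y + t" "Y y \<le> Y x + t" using half[of i x y] half[of i y x] xy by auto
    then have "Y x / t \<le> Y y / t + 1" "Y y / t \<le> Y x / t + 1" using t_pos by (auto simp: field_simps)
    then show "\<bar>Y x / t - Y y / t\<bar> \<le> 1" by linarith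
  qed (auto simp: B_def)
  then show ?thesis using t_pos by (simp add: field_simps)
qed

lemma prob_max_induced_matching_ge:
  fixes n :: nat and p \<alpha> :: real
  assumes p: "0 < p" "p < 1" and \<alpha>: "0 \<le> \<alpha>" "\<alpha> \<le> 1" "2 * real (m * t) \<le> \<alpha> * n" "2 * real t \<le> \<alpha> * (n * p)"
    and k: "2 * (m * t) \<le> n"
  shows "1 / pair_ratio m t p \<alpha> l1 \<le> measure_pmf.prob (edge_pmf {1..n} p)
     {X. real (m * t) \<le> real (max_induced_matching T (graph_of {1..n} X))}"
proof -
  have "1 / pair_ratio m t p \<alpha> l1 \<le>
      measure_pmf.prob (edge_pmf {1..n} p) {X. \<exists>xs\<in>tuples {1..n} (m * t). emb forest_par X xs}"
    by (rule prob_ex_emb_ge) (use p \<alpha> k t_pos card_children_less in auto)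
  also have "\<dots> \<le> measure_pmf.prob (edge_pmf {1..n} p)
     {X. real (m * t) \<le> real (max_induced_matching T (graph_of {1..n} X))}"
    using le_max_induced_matching[of "{1..n}"]
    by (intro measure_pmf.finite_measure_mono) (auto simp flip: of_nat_mult)
  finally show ?thesis .
qed

text \<open>The maximum is attained by a list of m blocks with m \<le> n, so a value above u forces
  such a list for some m > u / t. The union bound is a geometric series from the ceiling of u / t
  on.\<close>

lemma prob_max_induced_matching_gt:
  fixes p u :: real and n :: nat
  assumes p: "0 \<le> p" "p \<le> 1"
    and bound: "\<And>m. m \<le> n \<Longrightarrow> u < m * t \<Longrightarrow>
      real n ^ (m * t) / fact m * (p ^ (m * t - m) * (1 - p) ^ ((m * t choose 2) - (m * t - m))) \<le> (1 / 2) ^ m"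
  shows "measure_pmf.prob (edge_pmf {1..n} p)
     {X. u < real (max_induced_matching T (graph_of {1..n} X))} \<le> 2 * (1 / 2) powr (u / t)"
proof -
  define M where "M = {m. m \<le> n \<and> u < m * t}"
  define W where "W = (\<lambda>m. {X. \<exists>xs\<in>tuples {1..n} (m * t). emb forest_par X xs})"
  have "measure_pmf.prob (edge_pmf {1..n} p) {X. u < real (max_induced_matching T (graph_of {1..n} X))}
      \<le> measure_pmf.prob (edge_pmf {1..n} p) (\<Union>m\<in>M. W m)"
  proof (rule measure_pmf.finite_measure_mono)
    show "{X. u < real (max_induced_matching T (graph_of {1..n} X))} \<subseteq> (\<Union>m\<in>M. W m)"
    proof
      fix X assume X: "X \<in> {X. u < real (max_induced_matching T (graph_of {1..n} X))}"
      obtain m xs where xs: "xs \<in> tuples {1..n} (m * t)" "emb forest_par X xs"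
        "max_induced_matching T (graph_of {1..n} X) = m * t"
        using max_induced_matching_attained[of "{1..n}" X] by blast
      then have "m * t \<le> n"
        using card_mono[of "{1..n}" "set xs"] distinct_card[of xs] by (auto simp: tuples_def)
      moreover have "m \<le> m * t" using t_pos by simp
      ultimately have "m \<le> n" by linarith
      then have "m \<in> M" using X xs(3) by (simp add: M_def)
      then show "X \<in> (\<Union>m\<in>M. W m)" using xs by (auto simp: W_def)
    qed
  qed simp
  also have "\<dots> \<le> (\<Sum>m\<in>M. measure_pmf.prob (edge_pmf {1..n} p) (W m))"
    by (rule measure_pmf.finite_measure_subadditive_finite) (auto simp: M_def)
  also have "\<dots> \<le> (\<Sum>m\<in>M. (1 / 2) ^ m)"
    using prob_ex_emb_le[OF _ p, of "{1..n}"] bound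
    by (intro sum_mono) (fastforce simp: M_def W_def intro: order_trans)
  also have "\<dots> \<le> (\<Sum>m\<in>{nat \<lceil>u / t\<rceil>..n}. (1 / 2) ^ m)"
  proof (intro sum_mono2)
    show "M \<subseteq> {nat \<lceil>u / t\<rceil>..n}"
    proof
      fix m assume "m \<in> M"
      then have "m \<le> n" "u / t \<le> real m" using t_pos by (auto simp: M_def field_simps)
      then show "m \<in> {nat \<lceil>u / t\<rceil>..n}" by (simp add: ceiling_le_iff nat_le_iff)
    qed
  qed auto
  also have "\<dots> \<le> 2 * (1 / 2 :: real) ^ nat \<lceil>u / t\<rceil>"
  proof (cases "nat \<lceil>u / t\<rceil> \<le> n")
    case True
    have "(\<Sum>m\<in>{l..n}. (1 / 2 :: real) ^ m) = 2 * ((1 / 2) ^ l - (1 / 2) ^ Suc n)" if "l \<le> n" for l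
      using that by (subst sum_gp) auto
    then show ?thesis using True by simp
  qed simp
  also have "\<dots> \<le> 2 * (1 / 2) powr (u / t)"
  proof -
    have "u / t \<le> real (nat \<lceil>u / t\<rceil>)" by (simp add: real_nat_ceiling_ge)
    then have "(1 / 2 :: real) powr real (nat \<lceil>u / t\<rceil>) \<le> (1 / 2) powr (u / t)"
      by (intro powr_mono') auto
    then show ?thesis by (simp add: powr_realpow)
  qed
  finally show ?thesis .
qed

end

section \<open>Asymptotic estimates\<close>

text \<open>The factor 100 is 1 / (1 - p) at p = 0.99. These bounds exchange ln q and p up to
  constants, so dense and sparse graphs can be treated by the same formulas.\<close>

lemma ln_inverse_one_minus_bounds:
  fixes p :: real
  assumes "0 < p" "p \<le> 0.99"
  shows "p \<le> ln (1 / (1 - p))" "ln (1 / (1 - p)) \<le> 100 * p"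
proof -
  have "ln (1 - p) \<le> - p" using ln_le_minus_one[of "1 - p"] assms by simp
  then show "p \<le> ln (1 / (1 - p))" using assms by (simp add: ln_div)
  have "ln (1 / (1 - p)) \<le> 1 / (1 - p) - 1" using assms by (intro ln_le_minus_one) auto
  also have "\<dots> = p * (1 / (1 - p))" using assms by (simp add: field_simps)
  also have "\<dots> \<le> p * 100" using assms by (intro mult_left_mono) (auto simp: field_simps)
  finally show "ln (1 / (1 - p)) \<le> 100 * p" by simp
qed

text \<open>After taking logarithms the term splits into k (ln d + 3\<kappa>/2 - \<kappa>k/2), at
  most -k because k exceeds 2 (ln d) / \<kappa> by a factor 1 + \<epsilon>/2, and m (1 - ln (p m)),
  in which 1/m! has met p^(-m).\<close>

lemma first_moment_term_le:
  fixes p \<epsilon> \<kappa> d :: real and n m t k :: nat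
  defines "k \<equiv> m * t" and "\<kappa> \<equiv> ln (1 / (1 - p))" and "d \<equiv> n * p"
  assumes p: "0 < p" "p \<le> 0.99" and t: "0 < t" and d: "1 \<le> d" "150 * t \<le> ln d" "300 \<le> \<epsilon> * ln d"
    and \<epsilon>: "0 < \<epsilon>" and k: "(2 + \<epsilon>) * ln d \<le> \<kappa> * k"
  shows "real n ^ k / fact m * (p ^ (k - m) * (1 - p) ^ ((k choose 2) - (k - m))) \<le> (1 / 2) ^ m"
proof -
  have \<kappa>: "0 < \<kappa>" "\<kappa> \<le> 100 * p" "\<kappa> \<le> 99"
    using ln_inverse_one_minus_bounds[OF p] p by (auto simp: \<kappa>_def)
  have n: "0 < n" using d p by (cases n) (auto simp: d_def)
  have lnd: "ln d = ln n + ln p" using n p by (simp add: d_def ln_mult)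
  have "0 < ln d" using d(2) t by (smt (verit) mult_pos_pos of_nat_0_less_iff zero_less_numeral)
  then have "0 < \<kappa> * k" using k \<epsilon> by (smt (verit) mult_pos_pos)
  then have "k \<noteq> 0" by (intro notI) simp
  then have k0: "0 < k" and m: "0 < m" by (auto simp: k_def)
  have mk: "m \<le> k" using t by (simp add: k_def)
  \<comment> \<open>From \<kappa> k \<ge> 2 ln d \<ge> 300 t, \<kappa> \<le> 100 p and k = m t
    follows p m \<ge> 3 > e.\<close>
  have pm: "1 \<le> ln p + ln m"
  proof -
    have "2 * ln d \<le> (2 + \<epsilon>) * ln d" using \<epsilon> \<open>0 < ln d\<close> by simp
    then have "2 * (150 * t) \<le> \<kappa> * k" using k d(2) by linarith
    also have "\<dots> \<le> 100 * p * k" using \<kappa> by (intro mult_right_mono) auto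
    also have "\<dots> = (100 * (p * m)) * t" by (simp add: k_def)
    finally have "300 * real t \<le> (100 * (p * m)) * t" by simp
    then have "3 \<le> p * m" using t by simp
    then have "exp 1 \<le> p * m" using exp_le by linarith
    then have "1 \<le> ln (p * m)" using p m by (subst ln_ge_iff) auto
    then show ?thesis using p m by (simp add: ln_mult)
  qed
  have 1: "real n ^ k = exp (k * ln n)" using n by (simp add: exp_of_nat_mult)
  have 2: "1 / fact m \<le> exp (m - m * ln m)"
  proof -
    have "real m ^ m / fact m \<le> exp m" by (rule exp_ge_power_div_fact) simp
    moreover have "real m ^ m = exp (m * ln m)" using m by (simp add: exp_of_nat_mult)
    ultimately show ?thesis by (simp add: exp_diff field_simps)
  qed
  have 3: "p ^ (k - m) = exp ((real k - m) * ln p)"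
    using p mk by (simp add: exp_of_nat_mult flip: of_nat_diff)
  \<comment> \<open>The number of non-edges is at least k(k-1)/2 - k = k(k-3)/2.\<close>
  have 4: "(1 - p) ^ ((k choose 2) - (k - m)) \<le> exp (- \<kappa> * (real k * (real k - 3) / 2))"
  proof -
    have "real (k choose 2) = real k * (real k - 1) / 2"
      using k0 by (simp add: choose_two real_of_nat_div even_mult_iff of_nat_diff)
    then have "real k * (real k - 3) / 2 \<le> real ((k choose 2) - (k - m))"
      by (simp add: algebra_simps)
    then have "\<kappa> * (real k * (real k - 3) / 2) \<le> \<kappa> * real ((k choose 2) - (k - m))"
      using \<kappa> by (intro mult_left_mono) auto
    moreover have "(1 - p) ^ ((k choose 2) - (k - m)) = exp (- \<kappa> * real ((k choose 2) - (k - m)))"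
    proof -
      have "1 - p = exp (- \<kappa>)" using p by (simp add: \<kappa>_def ln_div)
      then show ?thesis by (simp add: exp_of_nat_mult[symmetric] mult.commute)
    qed
    ultimately show ?thesis by simp
  qed
  have "real n ^ k / fact m * (p ^ (k - m) * (1 - p) ^ ((k choose 2) - (k - m))) =
    exp (k * ln n) * (1 / fact m) * (exp ((real k - m) * ln p) * (1 - p) ^ ((k choose 2) - (k - m)))"
    by (simp add: 1 3)
  also have "\<dots> \<le> exp (k * ln n) * exp (m - m * ln m) *
     (exp ((real k - m) * ln p) * exp (- \<kappa> * (real k * (real k - 3) / 2)))"
    using p 2 4 by (intro mult_mono) auto
  also have "\<dots> = exp (k * ln d + m * (1 - (ln p + ln m)) + k * (3 / 2 * \<kappa> - \<kappa> * k / 2))"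
  proof -
    have "k * ln n + (m - m * ln m) + ((real k - m) * ln p + - \<kappa> * (real k * (real k - 3) / 2)) =
        k * ln d + m * (1 - (ln p + ln m)) + k * (3 / 2 * \<kappa> - \<kappa> * k / 2)"
      unfolding lnd by (simp add: field_simps)
    then show ?thesis by (simp only: exp_add[symmetric])
  qed
  also have "\<dots> \<le> exp (- m * ln 2)"
  proof -
    have "m * (1 - (ln p + ln m)) \<le> 0" using pm by (simp add: mult_nonneg_nonpos)
    \<comment> \<open>The loss 3\<kappa>/2 is at most 148.5, whereas \<epsilon> ln d / 2 is at least
      150; this is the origin of the 300 in the hypotheses.\<close>
    moreover have "k * ln d + k * (3 / 2 * \<kappa> - \<kappa> * k / 2) \<le> real k * (- 1)"
    proof -
      have "(1 + \<epsilon> / 2) * ln d \<le> \<kappa> * k / 2" using k by (simp add: algebra_simps)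
      then have "ln d + (3 / 2 * \<kappa> - \<kappa> * k / 2) \<le> - 1"
        using d(3) \<kappa>(3) by (simp add: algebra_simps)
      then have "k * (ln d + (3 / 2 * \<kappa> - \<kappa> * k / 2)) \<le> real k * (- 1)" by (intro mult_left_mono) auto
      then show ?thesis by (simp only: distrib_left)
    qed
    moreover have "real m * ln 2 \<le> real k * 1"
      using mk ln_2_less_1 by (intro mult_mono) auto
    ultimately show ?thesis by simp
  qed
  also have "\<dots> = (1 / 2) ^ m"
    by (simp add: exp_minus exp_of_nat_mult power_one_over inverse_eq_divide)
  finally show ?thesis .
qed

text \<open>The quantity bounded is the l-th root of the estimate for the l-th tail term. By
  \<kappa> k \<le> (2 - \<epsilon>) ln d, the factor exp (\<kappa> l / 2) is at most d^((1 -
  \<epsilon>/2) l/k), which stays below the denominator d even at l = k; here the constant 2 is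
  critical. For l < k/4 it is at most d^(1/4), and l > y controls k/l instead.\<close>

lemma pair_ratio_tail_base_le:
  fixes d \<kappa> \<epsilon> y \<beta> :: real and k l :: nat
  assumes d: "1 \<le> d" and \<epsilon>: "0 < \<epsilon>" "\<epsilon> \<le> 1" and y: "0 < y" "y < l" and l: "0 < l" "l \<le> k"
    and k: "\<kappa> * k \<le> (2 - \<epsilon>) * ln d"
    and \<beta>1: "4 * exp 1 * ln d * d powr (- 3 / 4) * k \<le> \<beta> * y"
    and \<beta>2: "16 * exp 1 * ln d * d powr (- \<epsilon> / 2) \<le> \<beta>"
  shows "exp 1 * real k / real l * (4 * ln d / d) * exp (\<kappa> * l / 2) \<le> \<beta>"
proof -
  define x where "x = real l / k"
  have x: "0 < x" "x \<le> 1" using l by (auto simp: x_def)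
  have "\<kappa> * l / 2 = \<kappa> * k * x / 2" using l by (simp add: x_def)
  also have "\<dots> \<le> (2 - \<epsilon>) * ln d * x / 2" using k x by (intro divide_right_mono mult_right_mono) auto
  also have "\<dots> = (1 - \<epsilon> / 2) * x * ln d" by (simp add: field_simps)
  finally have "exp (\<kappa> * l / 2) \<le> exp ((1 - \<epsilon> / 2) * x * ln d)" by simp
  also have "\<dots> = d powr ((1 - \<epsilon> / 2) * x)" using d by (simp add: powr_def)
  finally have e: "exp (\<kappa> * l / 2) \<le> d powr ((1 - \<epsilon> / 2) * x)" .
  have lnd: "0 \<le> ln d" using d by simp
  show ?thesis
  proof (cases "x \<ge> 1 / 4")
    case True
    have "(1 - \<epsilon> / 2) * x \<le> 1 - \<epsilon> / 2" using x \<epsilon> by (simp add: mult_left_le)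
    then have "d powr ((1 - \<epsilon> / 2) * x) \<le> d powr (1 - \<epsilon> / 2)" using d by (intro powr_mono) auto
    also have "\<dots> = d * d powr (- \<epsilon> / 2)" using d powr_add[of d 1 "- \<epsilon> / 2"] by simp
    finally have "exp (\<kappa> * l / 2) \<le> d * d powr (- \<epsilon> / 2)" using e by linarith
    moreover have "exp 1 * real k / real l \<le> 4 * exp 1" using True l by (simp add: x_def field_simps)
    ultimately have "exp 1 * real k / real l * (4 * ln d / d) * exp (\<kappa> * l / 2) \<le>
        4 * exp 1 * (4 * ln d / d) * (d * d powr (- \<epsilon> / 2))"
      using d lnd by (intro mult_mono) auto
    also have "\<dots> = 16 * exp 1 * ln d * d powr (- \<epsilon> / 2)" using d by simp
    finally show ?thesis using \<beta>2 by linarith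
  next
    case False
    have "(1 - \<epsilon> / 2) * x \<le> 1 * x" using x \<epsilon> by (intro mult_right_mono) auto
    then have "d powr ((1 - \<epsilon> / 2) * x) \<le> d powr (1 / 4)" using d False by (intro powr_mono) auto
    then have "exp (\<kappa> * l / 2) \<le> d powr (1 / 4)" using e by linarith
    then have "exp 1 * real k / real l * (4 * ln d / d) * exp (\<kappa> * l / 2) \<le>
        exp 1 * real k / real l * (4 * ln d / d) * d powr (1 / 4)"
      using d lnd by (intro mult_left_mono) auto
    also have "d powr (1 / 4) = d * d powr (- 3 / 4)" using d powr_add[of d 1 "- 3 / 4"] by simp
    also have "exp 1 * real k / real l * (4 * ln d / d) * (d * d powr (- 3 / 4)) =
        (4 * exp 1 * ln d * d powr (- 3 / 4) * k) / l"
      using d by simp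
    also have "\<dots> \<le> \<beta> * y / l" using \<beta>1 by (intro divide_right_mono) auto
    also have "\<dots> \<le> \<beta>"
    proof -
      have "0 \<le> 16 * exp 1 * ln d * d powr (- \<epsilon> / 2)" using lnd by simp
      then have "\<beta> * y \<le> \<beta> * l" using \<beta>2 y by (intro mult_left_mono) linarith+
      then show ?thesis using l by (simp add: field_simps)
    qed
    finally show ?thesis .
  qed
qed

lemma pair_ratio_le:
  fixes p d \<epsilon> y \<beta> \<kappa> :: real and m t :: nat
  defines "\<kappa> \<equiv> ln (1 / (1 - p))"
  assumes p: "0 < p" "p < 1" and d: "1 \<le> d" and \<epsilon>: "0 < \<epsilon>" "\<epsilon> \<le> 1" and y: "0 < y"
    and k: "\<kappa> * (m * t) \<le> (2 - \<epsilon>) * ln d" and \<beta>: "\<beta> \<le> 1 / 2"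
    and \<beta>1: "4 * exp 1 * ln d * d powr (- 3 / 4) * (m * t) \<le> \<beta> * y"
    and \<beta>2: "16 * exp 1 * ln d * d powr (- \<epsilon> / 2) \<le> \<beta>"
  shows "pair_ratio m t p (4 * ln d / d) (nat \<lfloor>y\<rfloor>) \<le>
    exp (\<kappa> * y\<^sup>2 / 2 + m * (2 ^ t * (4 * ln d / d)\<^sup>2)) + 2 * \<beta>"
proof -
  define q where "q = 1 / (1 - p)"
  define l1 where "l1 = nat \<lfloor>y\<rfloor>"
  define \<alpha> where "\<alpha> = 4 * ln d / d"
  define K where "K = m * t"
  have \<kappa>: "0 < \<kappa>" using p by (simp add: \<kappa>_def ln_gt_zero)
  have \<alpha>: "0 \<le> \<alpha>" using d by (simp add: \<alpha>_def)
  have qpow: "q ^ j = exp (\<kappa> * j)" for j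
    using p by (simp add: q_def \<kappa>_def exp_of_nat_mult[symmetric] exp_of_nat2_mult mult.commute[of _ "real j"])
      (simp add: exp_of_nat_mult)
  have choose2: "real (j choose 2) \<le> real j * real j / 2" for j
  proof (cases j)
    case (Suc i)
    then show ?thesis by (simp add: choose_two real_of_nat_div field_simps)
  qed simp
  have \<beta>0: "0 \<le> \<beta>"
  proof -
    have "0 \<le> 16 * exp 1 * ln d * d powr (- \<epsilon> / 2)" using d by simp
    then show ?thesis using \<beta>2 by linarith
  qed
  \<comment> \<open>Every integer above l1 exceeds y itself, as the tail estimate demands.\<close>
  have l1: "real l1 \<le> y" "y < Suc l1" using y by (auto simp: l1_def) linarith
  have head: "q ^ (l1 choose 2) * (1 + 2 ^ t * \<alpha>\<^sup>2) ^ m \<le> exp (\<kappa> * y\<^sup>2 / 2 + m * (2 ^ t * \<alpha>\<^sup>2))"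
  proof -
    have "real l1 * real l1 \<le> y * y" using l1 y by (intro mult_mono) auto
    then have "\<kappa> * real (l1 choose 2) \<le> \<kappa> * (y\<^sup>2 / 2)"
      using choose2[of l1] \<kappa> by (intro mult_left_mono) (auto simp: power2_eq_square)
    then have "q ^ (l1 choose 2) \<le> exp (\<kappa> * y\<^sup>2 / 2)" by (simp add: qpow)
    moreover have "(1 + 2 ^ t * \<alpha>\<^sup>2) ^ m \<le> exp (2 ^ t * \<alpha>\<^sup>2) ^ m"
      by (intro power_mono exp_ge_add_one_self) (simp add: add_nonneg_nonneg)
    ultimately have "q ^ (l1 choose 2) * (1 + 2 ^ t * \<alpha>\<^sup>2) ^ m \<le> exp (\<kappa> * y\<^sup>2 / 2) * exp (2 ^ t * \<alpha>\<^sup>2) ^ m"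
      by (intro mult_mono) auto
    then show ?thesis by (simp add: exp_add exp_of_nat_mult)
  qed
  have tail: "real (K choose l) * (\<alpha> ^ l * q ^ (l choose 2)) \<le> \<beta> ^ l" if l: "l \<in> {l1<..K}" for l
  proof -
    have l0: "0 < l" "l \<le> K" "y < l" using l l1 by auto
    have "q ^ (l choose 2) \<le> exp (\<kappa> * l / 2) ^ l"
    proof -
      have "\<kappa> * real (l choose 2) \<le> \<kappa> * (real l * real l / 2)" using choose2 \<kappa> by (intro mult_left_mono) auto
      then show ?thesis by (simp add: qpow mult_ac flip: exp_of_nat_mult)
    qed
    then have "real (K choose l) * (\<alpha> ^ l * q ^ (l choose 2)) \<le>
        (exp 1 * real K / real l) ^ l * (\<alpha> ^ l * exp (\<kappa> * l / 2) ^ l)"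
      using binomial_le_exp_power[OF l0(1)] \<alpha> p
      by (intro mult_mono mult_left_mono) (auto simp: q_def)
    also have "\<dots> = (exp 1 * real K / real l * \<alpha> * exp (\<kappa> * l / 2)) ^ l"
      by (simp only: power_mult_distrib mult.assoc)
    also have "\<dots> \<le> \<beta> ^ l"
      unfolding \<alpha>_def using l0 k \<beta>1 \<beta>2 d \<epsilon> y
      by (intro power_mono pair_ratio_tail_base_le) (auto simp: K_def)
    finally show ?thesis .
  qed
  have "(\<Sum>l\<in>{l1<..K}. real (K choose l) * (\<alpha> ^ l * q ^ (l choose 2))) \<le> (\<Sum>l\<in>{l1<..K}. \<beta> ^ l)"
    by (intro sum_mono tail)
  also have "\<dots> \<le> (\<Sum>l\<in>{1..K}. \<beta> ^ l)" using \<beta>0 by (intro sum_mono2) auto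
  also have "\<dots> \<le> 2 * \<beta>"
  proof -
    have "(\<Sum>l\<in>{1..K}. \<beta> ^ l) \<le> 2 * \<beta> - 2 * \<beta> ^ Suc K"
    proof (induction K)
      case (Suc K)
      have "2 * \<beta> ^ Suc (Suc K) \<le> \<beta> ^ Suc K" using \<beta> \<beta>0 mult_right_mono[of "2 * \<beta>" 1 "\<beta> ^ Suc K"] by simp
      then show ?case using Suc by simp
    qed (use \<beta>0 in simp)
    then show ?thesis using \<beta>0 by (smt (verit) zero_le_power)
  qed
  finally show ?thesis using head by (simp add: pair_ratio_def q_def l1_def \<alpha>_def K_def)
qed

text \<open>The third bound rests on (ln x)/x decreasing beyond e, applied to d \<le> n. It makes L
  tend to infinity uniformly in p, even when d stays bounded.\<close>

lemma log_bounds: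
  fixes n :: nat and p :: real
  defines "d \<equiv> n * p"
  assumes p: "0 < p" "p \<le> 0.99" and d: "1 \<le> d"
  shows "ln d / (100 * p) \<le> log (1 / (1 - p)) d" "log (1 / (1 - p)) d \<le> ln d / p"
    "exp 1 \<le> d \<Longrightarrow> ln n / 100 \<le> log (1 / (1 - p)) d"
proof -
  note \<kappa> = ln_inverse_one_minus_bounds[OF p]
  have lnd: "0 \<le> ln d" using d by simp
  show 1: "ln d / (100 * p) \<le> log (1 / (1 - p)) d"
    unfolding log_def using \<kappa> p lnd by (intro divide_left_mono) auto
  show "log (1 / (1 - p)) d \<le> ln d / p"
    unfolding log_def using \<kappa> p lnd by (intro divide_left_mono) (auto intro: mult_pos_pos)
  assume e: "exp 1 \<le> d"
  have n: "0 < n" using d p by (cases n) (auto simp: d_def)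
  have "d \<le> n" using p by (simp add: d_def mult_left_le)
  then have "ln n / n \<le> ln d / d" by (intro ln_x_over_x_mono) (use e in auto)
  then have "ln n \<le> ln d / d * n" using n by (simp add: field_simps)
  also have "\<dots> = ln d / p" using p n by (simp add: d_def)
  finally show "ln n / 100 \<le> log (1 / (1 - p)) d" using 1 by simp
qed

section \<open>Tail bounds for the maximum in terms of d and L\<close>

context tree_rep
begin

lemma upper_tail:
  fixes n :: nat and p \<epsilon> d :: real
  defines "d \<equiv> n * p"
  assumes p: "0 < p" "p \<le> 0.99" and \<epsilon>: "0 < \<epsilon>"
    and d: "exp 1 \<le> d" "150 * t \<le> ln d" "300 \<le> \<epsilon> * ln d"
  shows "measure_pmf.prob (edge_pmf {1..n} p)
     {X. (2 + \<epsilon>) * log (1 / (1 - p)) d < real (max_induced_matching T (graph_of {1..n} X))}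
     \<le> 2 * (1 / 2) powr (ln n / (100 * t))"
proof -
  have d1: "1 \<le> d" using d(1) by (smt (verit) one_le_exp_iff)
  have \<kappa>: "0 < ln (1 / (1 - p))" using p by (simp add: ln_gt_zero)
  have "measure_pmf.prob (edge_pmf {1..n} p)
     {X. (2 + \<epsilon>) * log (1 / (1 - p)) d < real (max_induced_matching T (graph_of {1..n} X))}
     \<le> 2 * (1 / 2) powr ((2 + \<epsilon>) * log (1 / (1 - p)) d / t)"
  proof (rule prob_max_induced_matching_gt)
    fix m assume m: "(2 + \<epsilon>) * log (1 / (1 - p)) d < m * t"
    then have "(2 + \<epsilon>) * ln d \<le> ln (1 / (1 - p)) * real (m * t)"
      using \<kappa> by (simp add: log_def field_simps)
    then show "real n ^ (m * t) / fact m * (p ^ (m * t - m) * (1 - p) ^ ((m * t choose 2) - (m * t - m)))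
        \<le> (1 / 2) ^ m"
      using p t_pos d d1 \<epsilon> unfolding d_def by (intro first_moment_term_le[where \<epsilon> = \<epsilon>]) auto
  qed (use p in auto)
  also have "\<dots> \<le> 2 * (1 / 2) powr (ln n / (100 * t))"
  proof -
    have "ln n / 100 \<le> log (1 / (1 - p)) d" using log_bounds(3)[OF p] d d1 by (simp add: d_def)
    moreover have "0 \<le> log (1 / (1 - p)) d" using \<kappa> d1 by (simp add: log_def)
    moreover have "1 * log (1 / (1 - p)) d \<le> (2 + \<epsilon>) * log (1 / (1 - p)) d"
      using \<epsilon> calculation by (intro mult_right_mono) auto
    ultimately have "ln n / 100 \<le> (2 + \<epsilon>) * log (1 / (1 - p)) d" by linarith
    then have "ln n / 100 / t \<le> (2 + \<epsilon>) * log (1 / (1 - p)) d / t"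
      by (intro divide_right_mono) auto
    then have "(1 / 2 :: real) powr ((2 + \<epsilon>) * log (1 / (1 - p)) d / t) \<le> (1 / 2) powr (ln n / 100 / t)"
      by (intro powr_mono') auto
    then show ?thesis by simp
  qed
  finally show ?thesis .
qed

text \<open>Here \<alpha> = 4 (ln d) / d. The list has k \<le> 2 L \<le> 2 (ln d) / p entries, so 2
  k \<le> \<alpha> n, while 2 t \<le> \<alpha> n p is the hypothesis t \<le> 2 ln d.\<close>

lemma prob_max_induced_matching_ge':
  fixes n m :: nat and p \<epsilon> y \<beta> d L :: real
  defines "d \<equiv> n * p" and "L \<equiv> log (1 / (1 - p)) d"
  assumes p: "0 < p" "p \<le> 0.99" and \<epsilon>: "0 < \<epsilon>" "\<epsilon> \<le> 1"
    and d: "1 \<le> d" "4 * ln d \<le> d" "t \<le> 2 * ln d"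
    and m: "m * t \<le> (2 - \<epsilon> / 2) * L"
    and y: "0 < y" and \<beta>: "\<beta> \<le> 1 / 2"
    and \<beta>1: "8 * exp 1 * ln d * d powr (- 3 / 4) * L \<le> \<beta> * y"
    and \<beta>2: "16 * exp 1 * ln d * d powr (- \<epsilon> / 4) \<le> \<beta>"
  shows "1 / (exp (50 * p * y\<^sup>2 + 32 * 2 ^ t * (ln d)\<^sup>2 / d\<^sup>2 * L) + 2 * \<beta>) \<le>
    measure_pmf.prob (edge_pmf {1..n} p)
     {X. real (m * t) \<le> real (max_induced_matching T (graph_of {1..n} X))}"
proof -
  define \<kappa> where "\<kappa> = ln (1 / (1 - p))"
  define R where "R = pair_ratio m t p (4 * ln d / d) (nat \<lfloor>y\<rfloor>)"
  have \<kappa>: "0 < \<kappa>" "\<kappa> \<le> 100 * p" using ln_inverse_one_minus_bounds[OF p] p by (auto simp: \<kappa>_def)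
  have lnd: "0 \<le> ln d" using d by simp
  have L: "0 \<le> L" "L \<le> ln d / p" "\<kappa> * L = ln d"
    using log_bounds(2)[OF p] d \<kappa> lnd by (auto simp: L_def d_def log_def \<kappa>_def)
  have mt: "real (m * t) \<le> 2 * L"
  proof -
    have "(2 - \<epsilon> / 2) * L \<le> 2 * L" using \<epsilon> L by (intro mult_right_mono) auto
    then show ?thesis using m by linarith
  qed
  have n: "0 < n" using d p by (cases n) (auto simp: d_def)
  have \<alpha>n: "4 * ln d / d * n = 2 * (2 * (ln d / p))" using n p by (simp add: d_def)
  have \<alpha>1: "4 * ln d / d \<le> 1" using d by simp
  have k1: "2 * real (m * t) \<le> 4 * ln d / d * n" unfolding \<alpha>n using mt L by linarith
  have k2: "2 * real (m * t) \<le> n" using k1 mult_right_mono[OF \<alpha>1, of n] by linarith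
  have "1 / R \<le> measure_pmf.prob (edge_pmf {1..n} p)
     {X. real (m * t) \<le> real (max_induced_matching T (graph_of {1..n} X))}"
    unfolding R_def
  proof (rule prob_max_induced_matching_ge)
    show "2 * real t \<le> 4 * ln d / d * (n * p)" using d by (simp flip: d_def)
    show "2 * (m * t) \<le> n" using k2 by linarith
  qed (use p lnd d \<alpha>1 k1 in auto)
  moreover have "R \<le> exp (50 * p * y\<^sup>2 + 32 * 2 ^ t * (ln d)\<^sup>2 / d\<^sup>2 * L) + 2 * \<beta>"
  proof -
    have "\<kappa> * real (m * t) \<le> (2 - \<epsilon> / 2) * (\<kappa> * L)"
      using mult_left_mono[OF m, of \<kappa>] \<kappa> by (simp add: mult_ac)
    then have k3: "ln (1 / (1 - p)) * real (m * t) \<le> (2 - \<epsilon> / 2) * ln d" using L by (simp add: \<kappa>_def)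
    have "4 * exp 1 * ln d * d powr (- 3 / 4) * real (m * t) \<le> 4 * exp 1 * ln d * d powr (- 3 / 4) * (2 * L)"
      using lnd mt by (intro mult_left_mono) auto
    also have "\<dots> = 8 * exp 1 * ln d * d powr (- 3 / 4) * L" by simp
    finally have \<beta>1': "4 * exp 1 * ln d * d powr (- 3 / 4) * real (m * t) \<le> \<beta> * y" using \<beta>1 by linarith
    have "R \<le> exp (\<kappa> * y\<^sup>2 / 2 + m * (2 ^ t * (4 * ln d / d)\<^sup>2)) + 2 * \<beta>"
      unfolding R_def \<kappa>_def
      by (rule pair_ratio_le[where \<epsilon> = "\<epsilon> / 2"]) (use p d \<epsilon> y k3 \<beta> \<beta>1' \<beta>2 in auto)
    also have "\<kappa> * y\<^sup>2 / 2 + m * (2 ^ t * (4 * ln d / d)\<^sup>2) \<le> 50 * p * y\<^sup>2 + 32 * 2 ^ t * (ln d)\<^sup>2 / d\<^sup>2 * L"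
    proof (rule add_mono)
      show "\<kappa> * y\<^sup>2 / 2 \<le> 50 * p * y\<^sup>2" using mult_right_mono[OF \<kappa>(2), of "y\<^sup>2"] by simp
      have "real m \<le> real (m * t)" using t_pos by (simp del: of_nat_mult)
      then have "real m * (2 ^ t * (4 * ln d / d)\<^sup>2) \<le> (2 * L) * (2 ^ t * (4 * ln d / d)\<^sup>2)"
        using mt by (intro mult_right_mono) auto
      also have "\<dots> = 32 * 2 ^ t * (ln d)\<^sup>2 / d\<^sup>2 * L" by (simp add: power_divide power_mult_distrib)
      finally show "real m * (2 ^ t * (4 * ln d / d)\<^sup>2) \<le> 32 * 2 ^ t * (ln d)\<^sup>2 / d\<^sup>2 * L" .
    qed
    finally show ?thesis by simp
  qed
  moreover have "0 < R"
    unfolding R_def pair_ratio_def using p lnd d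
    by (intro add_pos_nonneg mult_pos_pos sum_nonneg) (auto simp: add_pos_nonneg)
  ultimately have "1 / (exp (50 * p * y\<^sup>2 + 32 * 2 ^ t * (ln d)\<^sup>2 / d\<^sup>2 * L) + 2 * \<beta>) \<le> 1 / R"
    by (intro frac_le) auto
  then show ?thesis using \<open>1 / R \<le> _\<close> by linarith
qed

lemma lower_tail_sparse:
  fixes n :: nat and p \<epsilon> d L \<theta> :: real
  defines "d \<equiv> n * p" and "L \<equiv> log (1 / (1 - p)) d" and "\<theta> \<equiv> \<epsilon> / (200 * t)"
  assumes p: "0 < p" "p \<le> 0.99" and \<epsilon>: "0 < \<epsilon>" "\<epsilon> \<le> 1"
    and d: "1 \<le> d" "4 * ln d \<le> d" "t \<le> 2 * ln d"
    and d1: "8 * exp 1 * ln d * d powr (- 1 / 4) \<le> \<theta>"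
    and d2: "32 * exp 1 * ln d * d powr (- \<epsilon> / 4) \<le> 1"
    and d3: "3200 * 2 ^ t * ln d \<le> \<theta>\<^sup>2 * d"
    and L: "4 * t \<le> \<epsilon> * L"
  shows "measure_pmf.prob (edge_pmf {1..n} p)
     {X. real (max_induced_matching T (graph_of {1..n} X)) \<le> (2 - \<epsilon>) * L} \<le>
     2 * exp (- (\<epsilon>\<^sup>2 * L\<^sup>2 / (128 * t\<^sup>2 * n)))"
proof -
  \<comment> \<open>Aiming at 2 - \<epsilon>/2 leaves a gap of \<epsilon> L / (2 t) above
    \<open>b\<close>, of which rounding down loses at most half, because 4 t \<le> \<epsilon>
    L.\<close>
  define m where "m = nat \<lfloor>(2 - \<epsilon> / 2) * L / t\<rfloor>"
  \<comment> \<open>Since p / d = 1 / n, this makes the head exponent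
    \<open>50 * p * y\<^sup>2\<close> equal to 200 \<theta>^2 L^2 / n, while the tail condition
    reduces to (ln d) d^(-1/4) being small against \<theta>.\<close>
  define y where "y = \<theta> * (2 * L) * d powr (- 1 / 2)"
  \<comment> \<open>Half the exponent of the two-tails bound at distance \<epsilon> L / (4 t): a
    ratio of at most 2 exp S leaves exp (-S) for the lower tail.\<close>
  define S where "S = \<epsilon>\<^sup>2 * L\<^sup>2 / (128 * t\<^sup>2 * n)"
  define b where "b = (2 - \<epsilon>) * L / t"
  have n: "0 < n" using d p by (cases n) (auto simp: d_def)
  have "0 < 4 * real t" using t_pos by simp
  then have "0 < \<epsilon> * L" using L by linarith
  then have L0: "0 < L" using \<epsilon> by (simp add: zero_less_mult_iff)
  have \<theta>: "0 < \<theta>" using \<epsilon> t_pos by (simp add: \<theta>_def)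
  have nn: "0 \<le> (2 - \<epsilon> / 2) * L / t" using \<epsilon> L0 by (intro divide_nonneg_nonneg mult_nonneg_nonneg) auto
  then have "real m \<le> (2 - \<epsilon> / 2) * L / t" by (simp add: m_def)
  then have m: "real (m * t) \<le> (2 - \<epsilon> / 2) * L" using t_pos by (simp add: field_simps)
  have mb: "\<epsilon> * L / (4 * t) \<le> m - b"
  proof -
    have "(2 - \<epsilon> / 2) * L / t - 1 \<le> m" using nn unfolding m_def by linarith
    moreover have "1 \<le> \<epsilon> * L / (4 * t)" using L t_pos by (simp add: field_simps)
    moreover have "(2 - \<epsilon> / 2) * L / t - b = 2 * (\<epsilon> * L / (4 * t))"
      by (simp add: b_def diff_divide_distrib[symmetric] algebra_simps)
    ultimately show ?thesis by linarith
  qed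
  have "0 \<le> \<epsilon> * L / (4 * t)" using \<epsilon> L0 by simp
  then have bm: "b \<le> m" using mb by linarith
  have ge: "1 / (2 * exp S) \<le> measure_pmf.prob (edge_pmf {1..n} p)
     {X. t * real m \<le> real (max_induced_matching T (graph_of {1..n} X))}"
  proof -
    have y: "0 < y" using \<theta> L0 d by (simp add: y_def)
    have y2: "50 * p * y\<^sup>2 = 200 * \<theta>\<^sup>2 * L\<^sup>2 / n"
    proof -
      have "(d powr (- 1 / 2))\<^sup>2 = 1 / d"
        using d by (simp add: power_divide powr_power powr_minus_divide)
      then have "y\<^sup>2 = 4 * \<theta>\<^sup>2 * L\<^sup>2 / d" by (simp add: y_def power_mult_distrib)
      then show ?thesis using n p by (simp add: d_def)
    qed
    \<comment> \<open>The constant \<beta> = 1/2 suffices, as a bounded factor in the ratio is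
      harmless against exp (-2 S).\<close>
    have "1 / (exp (50 * p * y\<^sup>2 + 32 * 2 ^ t * (ln d)\<^sup>2 / d\<^sup>2 * L) + 2 * (1 / 2)) \<le>
      measure_pmf.prob (edge_pmf {1..n} p)
       {X. real (m * t) \<le> real (max_induced_matching T (graph_of {1..n} X))}"
      unfolding d_def L_def
    proof (rule prob_max_induced_matching_ge'[where \<epsilon> = \<epsilon>], unfold d_def[symmetric], unfold L_def[symmetric])
      have "8 * exp 1 * ln d * d powr (- 3 / 4) * L = (8 * exp 1 * ln d * d powr (- 1 / 4)) * (d powr (- 1 / 2) * L)"
        using d by (simp add: powr_add[symmetric])
      also have "\<dots> \<le> \<theta> * (d powr (- 1 / 2) * L)" using d1 L0 by (intro mult_right_mono) auto
      also have "\<dots> = 1 / 2 * y" by (simp add: y_def)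
      finally show "8 * exp 1 * ln d * d powr (- 3 / 4) * L \<le> 1 / 2 * y" .
    qed (use p \<epsilon> d m y d2 in auto)
    note * = this
    have "50 * p * y\<^sup>2 + 32 * 2 ^ t * (ln d)\<^sup>2 / d\<^sup>2 * L \<le> S"
    proof -
      have "32 * 2 ^ t * (ln d)\<^sup>2 / d\<^sup>2 * L = (3200 * 2 ^ t * ln d) * (ln d * L / (100 * d\<^sup>2))"
        by (simp add: power2_eq_square)
      also have "\<dots> \<le> (\<theta>\<^sup>2 * d) * (ln d * L / (100 * d\<^sup>2))"
        using d L0 by (intro mult_right_mono[OF d3]) auto
      also have "\<dots> = \<theta>\<^sup>2 * L * (ln d / (100 * p)) / n" using n p by (simp add: d_def power2_eq_square mult_ac)
      also have "\<dots> \<le> \<theta>\<^sup>2 * L * L / n"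
        using log_bounds(1)[OF p] d L0 by (intro divide_right_mono mult_left_mono) (auto simp: L_def d_def)
      also have "\<dots> = \<theta>\<^sup>2 * L\<^sup>2 / n" by (simp add: power2_eq_square)
      finally have "32 * 2 ^ t * (ln d)\<^sup>2 / d\<^sup>2 * L \<le> \<theta>\<^sup>2 * L\<^sup>2 / n" .
      moreover have "200 * \<theta>\<^sup>2 * L\<^sup>2 / n + \<theta>\<^sup>2 * L\<^sup>2 / n = 201 * \<theta>\<^sup>2 * L\<^sup>2 / n"
        by (simp add: add_divide_distrib[symmetric])
      ultimately have "50 * p * y\<^sup>2 + 32 * 2 ^ t * (ln d)\<^sup>2 / d\<^sup>2 * L \<le> 201 * \<theta>\<^sup>2 * L\<^sup>2 / n"
        unfolding y2 by linarith
      \<comment> \<open>With \<theta> = \<epsilon> / (200 t) the total 201 \<theta>^2 falls below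
        \<epsilon>^2 / (128 t^2), the coefficient in S.\<close>
      also have "\<dots> = 201 / 40000 * (\<epsilon>\<^sup>2 * L\<^sup>2 / (t\<^sup>2 * n))" by (simp add: \<theta>_def power_divide power_mult_distrib)
      also have "\<dots> \<le> 1 / 128 * (\<epsilon>\<^sup>2 * L\<^sup>2 / (t\<^sup>2 * n))" by (intro mult_right_mono) auto
      also have "\<dots> = S" by (simp add: S_def)
      finally show ?thesis .
    qed
    then have "exp (50 * p * y\<^sup>2 + 32 * 2 ^ t * (ln d)\<^sup>2 / d\<^sup>2 * L) \<le> exp S" by simp
    moreover have "1 \<le> exp S" by (simp add: S_def)
    ultimately have "exp (50 * p * y\<^sup>2 + 32 * 2 ^ t * (ln d)\<^sup>2 / d\<^sup>2 * L) + 2 * (1 / 2) \<le> 2 * exp S"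
      by linarith
    then have "1 / (2 * exp S) \<le> 1 / (exp (50 * p * y\<^sup>2 + 32 * 2 ^ t * (ln d)\<^sup>2 / d\<^sup>2 * L) + 2 * (1 / 2))"
      by (intro divide_left_mono mult_pos_pos) (auto simp: add_pos_pos)
    with * have "1 / (2 * exp S) \<le> measure_pmf.prob (edge_pmf {1..n} p)
       {X. real (m * t) \<le> real (max_induced_matching T (graph_of {1..n} X))}" by linarith
    then show ?thesis by (simp add: mult.commute)
  qed
  have "measure_pmf.prob (edge_pmf {1..n} p) {X. t * real m \<le> real (max_induced_matching T (graph_of {1..n} X))} *
    measure_pmf.prob (edge_pmf {1..n} p) {X. real (max_induced_matching T (graph_of {1..n} X)) \<le> t * b} \<le>
    exp (- (m - b)\<^sup>2 / (4 * n))"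
    by (rule two_tails_max_induced_matching[OF n bm])
  also have "\<dots> \<le> exp (- 2 * S)"
  proof -
    have "(\<epsilon> * L / (4 * t))\<^sup>2 \<le> (m - b)\<^sup>2" using mb \<epsilon> L0 by (intro power_mono) auto
    then have "(\<epsilon> * L / (4 * t))\<^sup>2 / (4 * n) \<le> (m - b)\<^sup>2 / (4 * n)" by (intro divide_right_mono) auto
    moreover have "(\<epsilon> * L / (4 * t))\<^sup>2 / (4 * n) = 2 * S"
      by (simp add: S_def power_divide power_mult_distrib mult_ac)
    ultimately show ?thesis by simp
  qed
  finally have "1 / (2 * exp S) * measure_pmf.prob (edge_pmf {1..n} p)
      {X. real (max_induced_matching T (graph_of {1..n} X)) \<le> t * b} \<le> exp (- 2 * S)"
    by (rule order_trans[OF mult_right_mono[OF ge measure_nonneg]])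
  then have "measure_pmf.prob (edge_pmf {1..n} p)
      {X. real (max_induced_matching T (graph_of {1..n} X)) \<le> t * b} \<le> exp (- 2 * S) * (2 * exp S)"
    by (simp add: field_simps)
  also have "\<dots> = 2 * exp (- S)" by (simp flip: exp_add)
  also have "t * b = (2 - \<epsilon>) * L" using t_pos by (simp add: b_def)
  finally show ?thesis by (simp add: S_def)
qed

text \<open>For large d the second moment alone is sharp. Using L \<le> n (ln d) / d, the tail
  condition becomes (ln d)^2 n^0.52 d^(-5/4) small, and d \<ge> n^0.48 turns this into (ln n)^2
  n^(-0.08); the non-isolated part contributes (ln d)^3 n / d^3, at most (ln n)^3 n^(-0.44).\<close>

lemma lower_tail_dense:
  fixes n :: nat and p \<epsilon> d L \<beta> :: real
  defines "d \<equiv> n * p" and "L \<equiv> log (1 / (1 - p)) d"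
    and "\<beta> \<equiv> 8 * exp 1 * (ln n)\<^sup>2 * n powr (- 0.08) + 16 * exp 1 * ln n * n powr (- 0.12 * \<epsilon>)"
  assumes p: "0 < p" "p \<le> 0.99" and \<epsilon>: "0 < \<epsilon>" "\<epsilon> \<le> 1"
    and d: "1 \<le> d" "4 * ln d \<le> d" "t \<le> 2 * ln d"
    and dn: "n powr 0.48 \<le> d" and L: "4 * t \<le> \<epsilon> * L" and \<beta>: "\<beta> \<le> 1 / 2"
  shows "1 / (exp (50 * n powr (- 0.04) + 32 * 2 ^ t * (ln n) ^ 3 * n powr (- 0.44)) + 2 * \<beta>) \<le>
    measure_pmf.prob (edge_pmf {1..n} p)
     {X. (2 - \<epsilon>) * L \<le> real (max_induced_matching T (graph_of {1..n} X))}"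
proof -
  define m where "m = nat \<lfloor>(2 - \<epsilon> / 2) * L / t\<rfloor>"
  \<comment> \<open>Just below sqrt (n / d) = 1 / sqrt p, so that p y^2 = n^(-0.04) tends to
    0.\<close>
  define y where "y = n powr 0.48 * d powr (- 1 / 2)"
  have n: "0 < n" using d p by (cases n) (auto simp: d_def)
  have "0 < 4 * real t" using t_pos by simp
  then have "0 < \<epsilon> * L" using L by linarith
  then have L0: "0 < L" using \<epsilon> by (simp add: zero_less_mult_iff)
  have nn: "0 \<le> (2 - \<epsilon> / 2) * L / t" using \<epsilon> L0 by (intro divide_nonneg_nonneg mult_nonneg_nonneg) auto
  then have "real m \<le> (2 - \<epsilon> / 2) * L / t" by (simp add: m_def)
  then have m: "real (m * t) \<le> (2 - \<epsilon> / 2) * L" using t_pos by (simp add: field_simps)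
  have mL: "(2 - \<epsilon>) * L \<le> real (m * t)"
  proof -
    have "(2 - \<epsilon> / 2) * L / t - 1 \<le> m" using nn unfolding m_def by linarith
    then have "(2 - \<epsilon> / 2) * L - t \<le> m * t" using t_pos by (simp add: field_simps)
    then show ?thesis using L by (simp add: algebra_simps)
  qed
  have d_le_n: "d \<le> n" using p by (simp add: d_def mult_left_le)
  have lnd: "0 \<le> ln d" "ln d \<le> ln n" using d d_le_n n by auto
  have Ln: "L \<le> n * ln d / d"
    using log_bounds(2)[OF p] d n p by (simp add: L_def d_def)
  have dpow: "d powr (- a) \<le> n powr (- 0.48 * a)" if "0 \<le> a" for a
  proof -
    have "(n powr 0.48) powr a \<le> d powr a" using dn that by (intro powr_mono2) auto
    then have "1 / d powr a \<le> 1 / (n powr 0.48) powr a" using n d by (intro divide_left_mono) auto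
    then show ?thesis by (simp add: powr_minus_divide powr_powr)
  qed
  have y: "0 < y" using n d by (simp add: y_def)
  have y2: "50 * p * y\<^sup>2 = 50 * n powr (- 0.04)"
  proof -
    have "y\<^sup>2 = n powr 0.96 / d"
      using d by (simp add: y_def power2_eq_square powr_minus_divide powr_half_sqrt flip: powr_add)
    moreover have "n powr 0.96 / n = n powr (- 0.04)"
      using n powr_diff[of n "0.96" 1] by simp
    ultimately show ?thesis using n p by (simp add: d_def field_simps)
  qed
  have \<beta>1: "8 * exp 1 * ln d * d powr (- 3 / 4) * L \<le> \<beta> * y"
  proof -
    have "8 * exp 1 * ln d * d powr (- 3 / 4) * L \<le> 8 * exp 1 * ln d * d powr (- 3 / 4) * (n * ln d / d)"
      using lnd by (intro mult_left_mono Ln) auto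
    also have "\<dots> = 8 * exp 1 * (ln d)\<^sup>2 * (d powr (- 5 / 4) * (n powr 0.52)) * y"
    proof -
      have "d powr (- 3 / 4) / d = d powr (- 5 / 4) * d powr (- 1 / 2)"
        using d powr_diff[of d "- 3 / 4" 1] by (simp add: powr_add[symmetric])
      moreover have "real n = n powr 0.52 * n powr 0.48" using n by (simp add: powr_add[symmetric])
      ultimately have "8 * exp 1 * (ln d)\<^sup>2 * (d powr (- 3 / 4) / d) * real n =
          8 * exp 1 * (ln d)\<^sup>2 * (d powr (- 5 / 4) * d powr (- 1 / 2)) * (n powr 0.52 * n powr 0.48)"
        by (intro arg_cong2[where f = "(*)"] refl)
      then show ?thesis by (simp add: y_def power2_eq_square mult_ac)
    qed
    also have "\<dots> \<le> 8 * exp 1 * (ln n)\<^sup>2 * (n powr (- 0.6) * (n powr 0.52)) * y"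
      using lnd y dpow[of "5 / 4"] by (intro mult_right_mono mult_mono power_mono) auto
    also have "n powr (- 0.6) * (n powr 0.52) = n powr (- 0.08)" by (simp add: powr_add[symmetric])
    also have "8 * exp 1 * (ln n)\<^sup>2 * n powr (- 0.08) * y \<le> \<beta> * y"
      using y n by (intro mult_right_mono) (auto simp: \<beta>_def)
    finally show ?thesis .
  qed
  have \<beta>2: "16 * exp 1 * ln d * d powr (- \<epsilon> / 4) \<le> \<beta>"
  proof -
    have "16 * exp 1 * ln d * d powr (- \<epsilon> / 4) \<le> 16 * exp 1 * ln n * n powr (- 0.12 * \<epsilon>)"
      using lnd dpow[of "\<epsilon> / 4"] \<epsilon> by (intro mult_mono) auto
    moreover have "0 \<le> 8 * exp 1 * (ln n)\<^sup>2 * n powr (- 0.08)" by simp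
    ultimately show ?thesis unfolding \<beta>_def by linarith
  qed
  have \<beta>0: "0 \<le> \<beta>" using n by (simp add: \<beta>_def)
  have "1 / (exp (50 * p * y\<^sup>2 + 32 * 2 ^ t * (ln d)\<^sup>2 / d\<^sup>2 * L) + 2 * \<beta>) \<le>
      measure_pmf.prob (edge_pmf {1..n} p)
       {X. real (m * t) \<le> real (max_induced_matching T (graph_of {1..n} X))}"
    using prob_max_induced_matching_ge'[of p \<epsilon> n m y \<beta>] p \<epsilon> d m y \<beta> \<beta>1 \<beta>2
    unfolding d_def[symmetric] L_def[symmetric] by blast
  also have "\<dots> \<le> measure_pmf.prob (edge_pmf {1..n} p)
     {X. (2 - \<epsilon>) * L \<le> real (max_induced_matching T (graph_of {1..n} X))}"
    using mL by (intro measure_pmf.finite_measure_mono) auto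
  finally have *: "1 / (exp (50 * p * y\<^sup>2 + 32 * 2 ^ t * (ln d)\<^sup>2 / d\<^sup>2 * L) + 2 * \<beta>) \<le>
      measure_pmf.prob (edge_pmf {1..n} p)
       {X. (2 - \<epsilon>) * L \<le> real (max_induced_matching T (graph_of {1..n} X))}" .
  have "32 * 2 ^ t * (ln d)\<^sup>2 / d\<^sup>2 * L \<le> 32 * 2 ^ t * (ln d)\<^sup>2 / d\<^sup>2 * (n * ln d / d)"
    by (intro mult_left_mono Ln) auto
  also have "\<dots> = 32 * 2 ^ t * (ln d) ^ 3 * (n * d powr (- 3))"
    using d by (simp add: powr_minus_divide powr_numeral power2_eq_square power3_eq_cube)
  also have "\<dots> \<le> 32 * 2 ^ t * (ln n) ^ 3 * (n * n powr (- 1.44))"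
    using lnd dpow[of 3] by (intro mult_mono power_mono) auto
  also have "n * n powr (- 1.44) = n powr (- 0.44)" using n powr_add[of n 1 "- 1.44"] by simp
  finally have "exp (50 * p * y\<^sup>2 + 32 * 2 ^ t * (ln d)\<^sup>2 / d\<^sup>2 * L) + 2 * \<beta> \<le>
      exp (50 * n powr (- 0.04) + 32 * 2 ^ t * (ln n) ^ 3 * n powr (- 0.44)) + 2 * \<beta>"
    unfolding y2 by simp
  then show ?thesis
    using \<beta>0 by (intro order_trans[OF frac_le *]) (auto intro: add_pos_nonneg)
qed

end

section \<open>Limits in n and the threshold for d\<close>

lemma lower_bound_tendsto_1:
  fixes c \<epsilon> K a :: real
  assumes "0 < c" "0 < \<epsilon>" "0 < a"
  defines "\<beta> \<equiv> \<lambda>n :: nat. 8 * exp 1 * (ln (real n))\<^sup>2 * real n powr (- 0.08) + 16 * exp 1 * ln (real n) * real n powr (- 0.12 * \<epsilon>)"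
  shows "\<beta> \<longlonglongrightarrow> 0"
    "(\<lambda>n. 1 - (2 * exp (- c * real n powr 0.04) +
      (1 - 1 / (exp (50 * real n powr (- 0.04) + K * (ln (real n)) ^ 3 * real n powr (- 0.44)) + 2 * \<beta> n)) +
      2 * (1 / 2) powr (ln (real n) / a))) \<longlonglongrightarrow> 1"
proof -
  have "(\<lambda>n :: nat. 8 * exp 1 * (ln (real n))\<^sup>2 * real n powr (- 0.08)) \<longlonglongrightarrow> 0" by real_asymp
  moreover have "(\<lambda>n :: nat. 16 * exp 1 * ln (real n) * real n powr (- 0.12 * \<epsilon>)) \<longlonglongrightarrow> 0"
    using assms(2) by real_asymp
  ultimately show \<beta>: "\<beta> \<longlonglongrightarrow> 0" unfolding \<beta>_def by (rule tendsto_add_zero)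
  have 1: "(\<lambda>n. exp (- c * real n powr 0.04)) \<longlonglongrightarrow> 0" using assms(1) by real_asymp
  have 2: "(\<lambda>n. exp (50 * real n powr (- 0.04) + K * (ln (real n)) ^ 3 * real n powr (- 0.44))) \<longlonglongrightarrow> 1"
    by real_asymp
  have 3: "(\<lambda>n. (1 / 2) powr (ln (real n) / a)) \<longlonglongrightarrow> 0"
  proof -
    define b where "b = ln 2 / a"
    have "0 < b" using assms(3) by (simp add: b_def)
    then have "(\<lambda>n. exp (- b * ln (real n))) \<longlonglongrightarrow> 0" by real_asymp
    moreover have "(1 / 2) powr (ln (real n) / a) = exp (- b * ln (real n))" for n
      by (simp add: powr_def b_def ln_div)
    ultimately show ?thesis by simp
  qed
  have "(\<lambda>n. 1 - (2 * exp (- c * real n powr 0.04) +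
      (1 - 1 / (exp (50 * real n powr (- 0.04) + K * (ln (real n)) ^ 3 * real n powr (- 0.44)) + 2 * \<beta> n)) +
      2 * (1 / 2) powr (ln (real n) / a))) \<longlonglongrightarrow> 1 - (2 * 0 + (1 - 1 / (1 + 2 * 0)) + 2 * 0)"
    by (intro tendsto_intros 1 2 3 \<beta>) auto
  then show "(\<lambda>n. 1 - (2 * exp (- c * real n powr 0.04) +
      (1 - 1 / (exp (50 * real n powr (- 0.04) + K * (ln (real n)) ^ 3 * real n powr (- 0.44)) + 2 * \<beta> n)) +
      2 * (1 / 2) powr (ln (real n) / a))) \<longlonglongrightarrow> 1" by simp
qed

lemma ex_degree_threshold:
  fixes \<epsilon> \<theta> C a :: real
  assumes "0 < \<epsilon>" "0 < \<theta>" 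
  shows "\<exists>d\<^sub>0>0. \<forall>d\<ge>d\<^sub>0. exp 1 \<le> d \<and> 4 * ln d \<le> d \<and> a \<le> ln d \<and> 300 \<le> \<epsilon> * ln d \<and>
    8 * exp 1 * ln d * d powr (- 1 / 4) \<le> \<theta> \<and> 32 * exp 1 * ln d * d powr (- \<epsilon> / 4) \<le> 1 \<and>
    C * ln d \<le> \<theta>\<^sup>2 * d"
proof -
  have "\<forall>\<^sub>F d in at_top. exp 1 \<le> (d::real)" by (rule eventually_ge_at_top)
  moreover have "\<forall>\<^sub>F d in at_top. 4 * ln d \<le> (d::real)" by real_asymp
  moreover have "\<forall>\<^sub>F d in at_top. a \<le> ln (d::real)" by real_asymp
  moreover have "\<forall>\<^sub>F d in at_top. 300 \<le> \<epsilon> * ln (d::real)" using assms by real_asymp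
  moreover have "\<forall>\<^sub>F d in at_top. 8 * exp 1 * ln d * d powr (- 1 / 4) \<le> \<theta>"
  proof -
    have "((\<lambda>d::real. 8 * exp 1 * ln d * d powr (- 1 / 4)) \<longlongrightarrow> 0) at_top" by real_asymp
    then have "\<forall>\<^sub>F d in at_top. 8 * exp 1 * ln d * d powr (- 1 / 4) < \<theta>"
      using assms by (intro order_tendstoD(2)) auto
    then show ?thesis by (rule eventually_mono) simp
  qed
  moreover have "\<forall>\<^sub>F d in at_top. 32 * exp 1 * ln d * d powr (- \<epsilon> / 4) \<le> 1"
  proof -
    have "((\<lambda>d::real. 32 * exp 1 * ln d * d powr (- \<epsilon> / 4)) \<longlongrightarrow> 0) at_top" using assms by real_asymp
    then have "\<forall>\<^sub>F d in at_top. 32 * exp 1 * ln d * d powr (- \<epsilon> / 4) < 1"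
      by (intro order_tendstoD(2)) auto
    then show ?thesis by (rule eventually_mono) simp
  qed
  moreover have "\<forall>\<^sub>F d in at_top. C * ln d \<le> \<theta>\<^sup>2 * d"
  proof -
    have "((\<lambda>d::real. C * ln d / d) \<longlongrightarrow> 0) at_top" by real_asymp
    then have "\<forall>\<^sub>F d in at_top. C * ln d / d < \<theta>\<^sup>2" using assms by (intro order_tendstoD) auto
    then show ?thesis using eventually_gt_at_top[of 0]
      by eventually_elim (simp add: field_simps)
  qed
  ultimately have "\<forall>\<^sub>F d in at_top. exp 1 \<le> d \<and> 4 * ln d \<le> d \<and> a \<le> ln d \<and> 300 \<le> \<epsilon> * ln d \<and>
    8 * exp 1 * ln d * d powr (- 1 / 4) \<le> \<theta> \<and> 32 * exp 1 * ln d * d powr (- \<epsilon> / 4) \<le> 1 \<and>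
    C * ln d \<le> \<theta>\<^sup>2 * d"
    by eventually_elim blast
  then obtain d\<^sub>0 where "\<forall>d\<ge>d\<^sub>0. exp 1 \<le> d \<and> 4 * ln d \<le> d \<and> a \<le> ln d \<and> 300 \<le> \<epsilon> * ln d \<and>
    8 * exp 1 * ln d * d powr (- 1 / 4) \<le> \<theta> \<and> 32 * exp 1 * ln d * d powr (- \<epsilon> / 4) \<le> 1 \<and>
    C * ln d \<le> \<theta>\<^sup>2 * d" unfolding eventually_at_top_linorder by blast
  then show ?thesis by (intro exI[of _ "max d\<^sub>0 1"]) auto
qed


section \<open>Concentration of the maximum, uniformly in p\<close>

context tree_rep
begin

text \<open>Both lower-tail errors are added whichever range d falls into. The resulting bound
  depends on n but not on p, so p(n) may alternate between the ranges along the sequence.\<close>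

lemma prob_max_induced_matching_within:
  fixes n :: nat and p \<epsilon> d \<beta> R c :: real
  defines "d \<equiv> n * p" and "c \<equiv> \<epsilon>\<^sup>2 / (1280000 * t\<^sup>2)"
    and "\<beta> \<equiv> 8 * exp 1 * (ln n)\<^sup>2 * n powr (- 0.08) + 16 * exp 1 * ln n * n powr (- 0.12 * \<epsilon>)"
  defines "R \<equiv> exp (50 * n powr (- 0.04) + 32 * 2 ^ t * (ln n) ^ 3 * n powr (- 0.44)) + 2 * \<beta>"
  assumes p: "0 < p" "p \<le> 0.99" and \<epsilon>: "0 < \<epsilon>" "\<epsilon> \<le> 1"
    and d: "exp 1 \<le> d" "4 * ln d \<le> d" "150 * t \<le> ln d" "300 \<le> \<epsilon> * ln d"
    "8 * exp 1 * ln d * d powr (- 1 / 4) \<le> \<epsilon> / (200 * t)"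
    "32 * exp 1 * ln d * d powr (- \<epsilon> / 4) \<le> 1"
    "3200 * 2 ^ t * ln d \<le> (\<epsilon> / (200 * t))\<^sup>2 * d"
    and n: "400 * t \<le> \<epsilon> * ln n" and \<beta>: "\<beta> \<le> 1 / 2"
  shows "1 - (2 * exp (- c * n powr 0.04) + (1 - 1 / R) + 2 * (1 / 2) powr (ln n / (100 * t))) \<le>
    measure_pmf.prob (gnp n p)
     {G. (2 - \<epsilon>) * log (1 / (1 - p)) d \<le> real (max_induced_matching T G) \<and>
         real (max_induced_matching T G) \<le> (2 + \<epsilon>) * log (1 / (1 - p)) d}"
proof -
  define L where "L = log (1 / (1 - p)) d"
  define M where "M = edge_pmf {1..n} p"
  define Y where "Y = (\<lambda>X. real (max_induced_matching T (graph_of {1..n} X)))"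
  have d1: "1 \<le> d" using d(1) by (smt (verit) one_le_exp_iff)
  have n0: "0 < n" using d1 p by (cases n) (auto simp: d_def)
  have lnd: "1 \<le> ln d" using d(1) d1 by (subst ln_ge_iff) auto
  have td: "real t \<le> 2 * ln d" using d(3) by linarith
  have "ln n / 100 \<le> L" using log_bounds(3)[OF p] d1 d(1) by (simp add: d_def L_def)
  then have "\<epsilon> * (ln n / 100) \<le> \<epsilon> * L" using \<epsilon> by (intro mult_left_mono) auto
  then have L: "4 * t \<le> \<epsilon> * L" using n by linarith
  have \<beta>0: "0 \<le> \<beta>" using n0 by (simp add: \<beta>_def)
  have "1 \<le> exp (50 * n powr (- 0.04) + 32 * 2 ^ t * (ln n) ^ 3 * n powr (- 0.44))"
    using n0 by (simp add: add_nonneg_nonneg)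
  then have R: "1 \<le> R" using \<beta>0 unfolding R_def by linarith
  have lower: "measure_pmf.prob M {X. Y X < (2 - \<epsilon>) * L} \<le> 2 * exp (- c * n powr 0.04) + (1 - 1 / R)"
  proof (cases "n powr 0.48 \<le> d")
    case True
    have "1 / R \<le> measure_pmf.prob M {X. (2 - \<epsilon>) * L \<le> Y X}"
      unfolding R_def M_def Y_def L_def d_def \<beta>_def
      by (rule lower_tail_dense) (use p \<epsilon> d1 d td True L \<beta> in \<open>auto simp: d_def L_def \<beta>_def\<close>)
    also have "{X. (2 - \<epsilon>) * L \<le> Y X} = UNIV - {X. Y X < (2 - \<epsilon>) * L}" by auto
    also have "measure_pmf.prob M (UNIV - {X. Y X < (2 - \<epsilon>) * L}) = 1 - measure_pmf.prob M {X. Y X < (2 - \<epsilon>) * L}"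
      using measure_pmf.prob_compl[of "{X. Y X < (2 - \<epsilon>) * L}" M] by simp
    finally have "measure_pmf.prob M {X. Y X < (2 - \<epsilon>) * L} \<le> 1 - 1 / R" by linarith
    moreover have "0 \<le> 2 * exp (- c * n powr 0.04)" by simp
    ultimately show ?thesis by linarith
  next
    case False
    have "measure_pmf.prob M {X. Y X < (2 - \<epsilon>) * L} \<le> measure_pmf.prob M {X. Y X \<le> (2 - \<epsilon>) * L}"
      by (intro measure_pmf.finite_measure_mono) auto
    also have "\<dots> \<le> 2 * exp (- (\<epsilon>\<^sup>2 * L\<^sup>2 / (128 * t\<^sup>2 * n)))"
      unfolding M_def Y_def L_def d_def
      by (rule lower_tail_sparse) (use p \<epsilon> d1 d td L in \<open>auto simp: d_def L_def\<close>)
    \<comment> \<open>For d < n^0.48, L \<ge> n / (100 d) \<ge> n^0.52 / 100, hence L^2 / n \<ge>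
      n^0.04 / 10000; the denominator of c is 128 times 10000.\<close>
    also have "\<dots> \<le> 2 * exp (- c * n powr 0.04)"
    proof -
      have "n / d = 1 / p" using n0 p by (simp add: d_def)
      then have "n / (100 * d) = 1 / (100 * p)" by simp
      also have "\<dots> \<le> ln d / (100 * p)" using lnd p by (intro divide_right_mono) auto
      also have "\<dots> \<le> L" using log_bounds(1)[OF p] d1 by (simp add: d_def L_def)
      finally have "n / (100 * d) \<le> L" .
      moreover have "n powr 0.52 / 100 \<le> n / (100 * d)"
      proof -
        have "n powr 0.52 * d \<le> n powr 0.52 * n powr 0.48" using False by (intro mult_left_mono) auto
        also have "\<dots> = n" using n0 by (simp add: powr_add[symmetric])
        finally show ?thesis using d1 by (simp add: field_simps)
      qed
      ultimately have "(n powr 0.52 / 100)\<^sup>2 \<le> L\<^sup>2" by (intro power_mono) auto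
      moreover have "(n powr 0.52 / 100)\<^sup>2 = n powr 0.04 * n / 10000"
        using n0 powr_add[of n "0.04" 1] by (simp add: power2_eq_square powr_add[symmetric])
      ultimately have "n powr 0.04 * n / 10000 \<le> L\<^sup>2" by simp
      then have "\<epsilon>\<^sup>2 / (128 * t\<^sup>2 * n) * (n powr 0.04 * n / 10000) \<le> \<epsilon>\<^sup>2 / (128 * t\<^sup>2 * n) * L\<^sup>2"
        by (intro mult_left_mono) auto
      moreover have "\<epsilon>\<^sup>2 / (128 * t\<^sup>2 * n) * (n powr 0.04 * n / 10000) = c * n powr 0.04"
        using n0 by (simp add: c_def)
      moreover have "\<epsilon>\<^sup>2 / (128 * t\<^sup>2 * n) * L\<^sup>2 = \<epsilon>\<^sup>2 * L\<^sup>2 / (128 * t\<^sup>2 * n)" by simp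
      ultimately have "c * n powr 0.04 \<le> \<epsilon>\<^sup>2 * L\<^sup>2 / (128 * t\<^sup>2 * n)" by linarith
      then show ?thesis by simp
    qed
    finally have "measure_pmf.prob M {X. Y X < (2 - \<epsilon>) * L} \<le> 2 * exp (- c * n powr 0.04)" .
    moreover have "0 \<le> 1 - 1 / R" using R by simp
    ultimately show ?thesis by linarith
  qed
  have upper: "measure_pmf.prob M {X. (2 + \<epsilon>) * L < Y X} \<le> 2 * (1 / 2) powr (ln n / (100 * t))"
    unfolding M_def Y_def L_def d_def
    by (rule upper_tail) (use p \<epsilon> d in \<open>auto simp: d_def\<close>)
  have "measure_pmf.prob M (UNIV - {X. (2 - \<epsilon>) * L \<le> Y X \<and> Y X \<le> (2 + \<epsilon>) * L}) \<le>
      measure_pmf.prob M ({X. Y X < (2 - \<epsilon>) * L} \<union> {X. (2 + \<epsilon>) * L < Y X})"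
    by (intro measure_pmf.finite_measure_mono) auto
  also have "\<dots> \<le> measure_pmf.prob M {X. Y X < (2 - \<epsilon>) * L} + measure_pmf.prob M {X. (2 + \<epsilon>) * L < Y X}"
    by (rule measure_Un_le) auto
  also have "measure_pmf.prob M (UNIV - {X. (2 - \<epsilon>) * L \<le> Y X \<and> Y X \<le> (2 + \<epsilon>) * L}) =
      1 - measure_pmf.prob M {X. (2 - \<epsilon>) * L \<le> Y X \<and> Y X \<le> (2 + \<epsilon>) * L}"
    using measure_pmf.prob_compl[of "{X. (2 - \<epsilon>) * L \<le> Y X \<and> Y X \<le> (2 + \<epsilon>) * L}" M] by simp
  finally show ?thesis
    using lower upper by (simp add: gnp_eq L_def M_def Y_def)
qed

text \<open>The first conclusion, that n p is eventually at least 1, keeps the logarithm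
  nonnegative, which makes the event monotone in \<epsilon>.\<close>

lemma max_induced_matching_whp:
  assumes \<epsilon>: "0 < \<epsilon>" "\<epsilon> \<le> 1"
  shows "\<exists>d\<^sub>0::real. d\<^sub>0 > 0 \<and> (\<forall>p :: nat \<Rightarrow> real.
      (\<forall>\<^sub>F n in sequentially. d\<^sub>0 / real n \<le> p n \<and> p n \<le> 0.99) \<longrightarrow>
      (\<forall>\<^sub>F n in sequentially. 0 < p n \<and> p n \<le> 0.99 \<and> 1 \<le> n * p n) \<and>
      (\<lambda>n. measure_pmf.prob (gnp n (p n))
         {G. (2 - \<epsilon>) * log (1 / (1 - p n)) (real n * p n) \<le> real (max_induced_matching T G) \<and>
             real (max_induced_matching T G) \<le> (2 + \<epsilon>) * log (1 / (1 - p n)) (real n * p n)})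
        \<longlonglongrightarrow> 1)"
proof -
  define \<theta> where "\<theta> = \<epsilon> / (200 * t)"
  have \<theta>: "0 < \<theta>" using \<epsilon> t_pos by (simp add: \<theta>_def)
  obtain d\<^sub>0 where d0: "d\<^sub>0 > 0" and D: "\<And>d. d \<ge> d\<^sub>0 \<Longrightarrow> exp 1 \<le> d \<and> 4 * ln d \<le> d \<and>
      150 * real t \<le> ln d \<and> 300 \<le> \<epsilon> * ln d \<and>
      8 * exp 1 * ln d * d powr (- 1 / 4) \<le> \<theta> \<and> 32 * exp 1 * ln d * d powr (- \<epsilon> / 4) \<le> 1 \<and>
      3200 * 2 ^ t * ln d \<le> \<theta>\<^sup>2 * d"
    using ex_degree_threshold[OF \<epsilon>(1) \<theta>, of "150 * real t" "3200 * 2 ^ t"] by blast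
  define c where "c = \<epsilon>\<^sup>2 / (1280000 * (real t)\<^sup>2)"
  have c: "0 < c" using \<epsilon> t_pos by (simp add: c_def)
  define \<beta> where "\<beta> = (\<lambda>n :: nat. 8 * exp 1 * (ln (real n))\<^sup>2 * real n powr (- 0.08) +
    16 * exp 1 * ln (real n) * real n powr (- 0.12 * \<epsilon>))"
  define h where "h = (\<lambda>n :: nat. 1 - (2 * exp (- c * real n powr 0.04) +
      (1 - 1 / (exp (50 * real n powr (- 0.04) + 32 * 2 ^ t * (ln (real n)) ^ 3 * real n powr (- 0.44)) + 2 * \<beta> n)) +
      2 * (1 / 2) powr (ln (real n) / (100 * t))))"
  have h: "h \<longlonglongrightarrow> 1" and \<beta>: "\<beta> \<longlonglongrightarrow> 0"
    using lower_bound_tendsto_1[OF c \<epsilon>(1), of "100 * t"] t_pos by (simp_all add: h_def \<beta>_def)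
  show ?thesis
  proof (intro exI[of _ d\<^sub>0] conjI d0 allI impI)
    fix p :: "nat \<Rightarrow> real"
    assume ev: "\<forall>\<^sub>F n in sequentially. d\<^sub>0 / real n \<le> p n \<and> p n \<le> 0.99"
    have ev1: "\<forall>\<^sub>F n in sequentially. 0 < p n \<and> p n \<le> 0.99 \<and> d\<^sub>0 \<le> n * p n"
      using ev eventually_gt_at_top[of 0]
    proof eventually_elim
      case (elim n)
      have "0 < d\<^sub>0 / real n" using elim d0 by simp
      then have "0 < p n" using elim by linarith
      then show ?case using elim by (simp add: field_simps)
    qed
    then show "\<forall>\<^sub>F n in sequentially. 0 < p n \<and> p n \<le> 0.99 \<and> 1 \<le> n * p n"
    proof eventually_elim
      case (elim n)
      then have "exp 1 \<le> n * p n" using D by blast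
      moreover have "1 \<le> exp (1 :: real)" by simp
      ultimately show ?case using elim by linarith
    qed
    have ev2: "\<forall>\<^sub>F n in sequentially. 400 * real t \<le> \<epsilon> * ln (real n)"
      using \<epsilon>(1) by real_asymp
    have ev3: "\<forall>\<^sub>F n in sequentially. \<beta> n < 1 / 2" by (rule order_tendstoD(2)[OF \<beta>]) simp
    show "(\<lambda>n. measure_pmf.prob (gnp n (p n))
         {G. (2 - \<epsilon>) * log (1 / (1 - p n)) (real n * p n) \<le> real (max_induced_matching T G) \<and>
             real (max_induced_matching T G) \<le> (2 + \<epsilon>) * log (1 / (1 - p n)) (real n * p n)})
        \<longlonglongrightarrow> 1"
    proof (rule tendsto_sandwich[OF _ _ h tendsto_const])
      show "\<forall>\<^sub>F n in sequentially. h n \<le> measure_pmf.prob (gnp n (p n))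
         {G. (2 - \<epsilon>) * log (1 / (1 - p n)) (real n * p n) \<le> real (max_induced_matching T G) \<and>
             real (max_induced_matching T G) \<le> (2 + \<epsilon>) * log (1 / (1 - p n)) (real n * p n)}"
        using ev1 ev2 ev3
      proof eventually_elim
        case (elim n)
        then show ?case
          using prob_max_induced_matching_within[of "p n" \<epsilon> n] \<epsilon> D[of "n * p n"]
          by (simp add: h_def c_def \<beta>_def \<theta>_def)
      qed
    qed (simp add: measure_pmf.prob_le_1)
  qed
qed

end

theorem theorem1p2:
  fixes T :: "'a sgraph" and \<epsilon> :: real
  assumes "\<epsilon> > 0" and "is_tree T"
  shows "\<exists>d\<^sub>0::real. d\<^sub>0 > 0 \<and>
    (\<forall>p :: nat \<Rightarrow> real.
      (\<forall>\<^sub>F n in sequentially. d\<^sub>0 / real n \<le> p n \<and> p n \<le> 0.99) \<longrightarrow>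
      (\<lambda>n. measure_pmf.prob (gnp n (p n))
         {G. (2 - \<epsilon>) * log (1 / (1 - p n)) (real n * p n) \<le> real (max_induced_matching T G) \<and>
             real (max_induced_matching T G) \<le> (2 + \<epsilon>) * log (1 / (1 - p n)) (real n * p n)})
        \<longlonglongrightarrow> 1)"
proof -
  obtain vs par where "distinct vs" "set vs = verts T" "tree_order (length vs) par"
    "\<forall>j<length vs. \<forall>i<j. adj T (vs ! i) (vs ! j) \<longleftrightarrow> par j = i"
    using is_tree_ordering[OF assms(2)] by blast
  then interpret tree_rep "length vs" par T vs
    using assms(2) by (simp add: tree_rep_def tree_rep_axioms_def is_tree_def)
  \<comment> \<open>The estimates are for \<epsilon> \<le> 1; a larger \<epsilon> only widens the
    interval.\<close>
  define \<delta> where "\<delta> = min \<epsilon> 1"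
  have \<delta>: "0 < \<delta>" "\<delta> \<le> 1" "\<delta> \<le> \<epsilon>" using assms(1) by (auto simp: \<delta>_def)
  define A where "A = (\<lambda>e n p. {G :: nat sgraph.
    (2 - e) * log (1 / (1 - p)) (real n * p) \<le> real (max_induced_matching T G) \<and>
    real (max_induced_matching T G) \<le> (2 + e) * log (1 / (1 - p)) (real n * p)})"
  have "\<exists>d\<^sub>0::real. d\<^sub>0 > 0 \<and> (\<forall>p :: nat \<Rightarrow> real.
      (\<forall>\<^sub>F n in sequentially. d\<^sub>0 / real n \<le> p n \<and> p n \<le> 0.99) \<longrightarrow>
      (\<forall>\<^sub>F n in sequentially. 0 < p n \<and> p n \<le> 0.99 \<and> 1 \<le> n * p n) \<and>
      (\<lambda>n. measure_pmf.prob (gnp n (p n)) (A \<delta> n (p n))) \<longlonglongrightarrow> 1)"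
    unfolding A_def by (rule max_induced_matching_whp[OF \<delta>(1,2)])
  then obtain d\<^sub>0 where "d\<^sub>0 > 0" and whp:
    "\<And>p :: nat \<Rightarrow> real. \<forall>\<^sub>F n in sequentially. d\<^sub>0 / real n \<le> p n \<and> p n \<le> 0.99 \<Longrightarrow>
      (\<forall>\<^sub>F n in sequentially. 0 < p n \<and> p n \<le> 0.99 \<and> 1 \<le> n * p n) \<and>
      (\<lambda>n. measure_pmf.prob (gnp n (p n)) (A \<delta> n (p n))) \<longlonglongrightarrow> 1"
    by (elim exE conjE) simp
  have "(\<lambda>n. measure_pmf.prob (gnp n (p n)) (A \<epsilon> n (p n))) \<longlonglongrightarrow> 1"
    if ev: "\<forall>\<^sub>F n in sequentially. d\<^sub>0 / real n \<le> p n \<and> p n \<le> 0.99" for p :: "nat \<Rightarrow> real"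
  proof (rule tendsto_sandwich[OF _ _ conjunct2[OF whp[OF ev]] tendsto_const])
    show "\<forall>\<^sub>F n in sequentially. measure_pmf.prob (gnp n (p n)) (A \<delta> n (p n)) \<le>
        measure_pmf.prob (gnp n (p n)) (A \<epsilon> n (p n))"
      using conjunct1[OF whp[OF ev]]
    proof eventually_elim
      case (elim n)
      define L where "L = log (1 / (1 - p n)) (real n * p n)"
      have "0 \<le> L" unfolding L_def using elim by (intro zero_le_log_cancel_iff[THEN iffD2]) auto
      then have "(2 - \<epsilon>) * L \<le> (2 - \<delta>) * L" "(2 + \<delta>) * L \<le> (2 + \<epsilon>) * L"
        using \<delta> by (auto intro: mult_right_mono)
      then show ?case
        by (intro measure_pmf.finite_measure_mono) (auto simp: A_def simp flip: L_def)
    qed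
  qed (simp add: measure_pmf.prob_le_1)
  then show ?thesis unfolding A_def using \<open>d\<^sub>0 > 0\<close> by blast
qed

end
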